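(* Let $R$ be a Noetherian local ring, $I$ a proper ideal of $R$, $S=R/I$, and let $n=\text{f-rank}_S(I/I^2)$. Let $a_1,\dots,a_n,b_1,\dots,b_m$ be a minimal generating set of $I$ such that the classes of $a_1,\dots,a_n$ form a basis of a free direct summand $F$ of the $S$-module $I/I^2$ and the classes of $b_1,\dots,b_m$ minimally generate a complement of $F$. Let $R[X]$ be a minimal model of the quotient map $R\to S$ whose set $X_1$ of degree-one variables is chosen so that $\partial$ maps $X_1$ bijectively onto $\{a_1,\dots,a_n,b_1,\dots,b_m\}$, and let $X_1'=\{x_1,\dots,x_n\}\subseteq X_1$ with $\partial(x_i)=a_i$. Let $A$ be a dg algebra over $R$ such that $IA_0\subseteq\partial(A_1)$, and put $A[X]=A\otimes_R R[X]$. Then there are chain derivations $\theta_x\colon A[X]\to A[X]$ of degree $-1$, one for each $x\in X_1'$, vanishing on $A$ and satisfying $\theta_x(x)=1$ and $\theta_x(y)=0$ for all $y\in X_1\setminus\{x\}$, such that $W=\bigcap_{x\in X_1'}\ker(\theta_x)$ is a dg subalgebra of $A[X]$ and there is an isomorphism of dg algebras $$A[X]\;\cong\; W[z_1,\dots,z_n\mid \partial(z_i)=0].$$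
   Context: Dg algebras: a dg algebra over $R$ is a complex $(A,\partial)$ of $R$-modules concentrated in degrees $\ge 0$ with a unitary associative multiplication satisfying $A_iA_j\subseteq A_{i+j}$, $ab=(-1)^{|a||b|}ba$, $a^2=0$ for $|a|$ odd, and the Leibniz rule $\partial(ab)=\partial(a)b+(-1)^{|a|}a\,\partial(b)$; moreover $A_0$ is a Noetherian $R$-algebra and each $A_i$ is a finitely generated $A_0$-module. Semi-free extensions: a semi-free extension $A[X]$ of $A$ is a dg algebra obtained by successively adjoining sets of free variables $X=X_0\sqcup X_1\sqcup\cdots$ ($X_i$ in degree $i$), exterior variables in odd degrees and polynomial variables in even degrees, with $\partial(X_i)$ consisting of cycles of the dg algebra obtained after adjoining variables of degree less than $i$. $W[z_1,\dots,z_n\mid\partial(z_i)=0]$ denotes the semi-free extension of $W$ by exterior variables $z_i$ of degree $1$ with zero differential. Minimal model: a minimal model of $R\to S=R/I$ is a semi-free extension $R[X]$ of $R$ with $X=X_{\ge1}$, together with a quasi-isomorphism $R[X]\to S$ of dg algebras, such that $\partial(X_1)$ is a minimal generating set of $I$ and, with $\mathfrak m_R$ the maximal ideal of $R$, $\partial(X_i)\subseteq(X,\mathfrak m_R)^2$ for $i\ge 2$. A derivation of a graded algebra $B$ is a homogeneous additive map $\theta\colon B\to B$ (linear over the base ring $R$) with $\theta(uv)=\theta(u)v+(-1)^{|\theta||u|}u\,\theta(v)$ for homogeneous $u,v$; it is a chain derivation if it is also a chain map, i.e. $\partial\theta=(-1)^{|\theta|}\theta\partial$. For a finitely generated $S$-module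 $M$, $\text{f-rank}_S(M)$ is the maximal rank of a free direct summand of $M$. *)

theory Defs
  imports "HOL-Algebra.Module" "HOL-Algebra.Ideal_Product" "HOL-Algebra.QuotRing"
    "HOL-Algebra.Ring_Divisibility" "HOL-Algebra.Generated_Rings" "HOL-Algebra.Free_Abelian_Groups"
begin

section \<open>Local rings, bases and free summands\<close>

definition local_ring :: "('r, 'k) ring_scheme \<Rightarrow> bool" where
  "local_ring R \<longleftrightarrow> cring R \<and> (\<exists>!m. maximalideal m R)"

definition max_ideal :: "('r, 'k) ring_scheme \<Rightarrow> 'r set" where
  "max_ideal R = (THE m. maximalideal m R)"

text \<open>\<open>cl\<close> is a closure operator such as \<^term>\<open>genideal R\<close> or \<open>module_span S M\<close>. No proper
  subfamily generates, so a minimally generating family is automatically injective.\<close>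

definition minimally_generates :: "('g set \<Rightarrow> 'g set) \<Rightarrow> 'k set \<Rightarrow> ('k \<Rightarrow> 'g) \<Rightarrow> 'g set \<Rightarrow> bool" where
  "minimally_generates cl K g Y \<longleftrightarrow> cl (g ` K) = Y \<and> (\<forall>K'. K' \<subset> K \<longrightarrow> cl (g ` K') \<noteq> Y)"

definition module_span :: "('s, 'k) ring_scheme \<Rightarrow> ('s, 'm, 'l) module_scheme \<Rightarrow> 'm set \<Rightarrow> 'm set" where
  "module_span S M G = \<Inter>{N. submodule N S M \<and> G \<subseteq> N}"

definition module_basis ::
  "('s, 'k) ring_scheme \<Rightarrow> ('s, 'm, 'l) module_scheme \<Rightarrow> 'm set \<Rightarrow> 'i set \<Rightarrow> ('i \<Rightarrow> 'm) \<Rightarrow> bool" where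
  "module_basis S M F K e \<longleftrightarrow> finite K \<and> e ` K \<subseteq> F \<and>
     (\<forall>u\<in>F. \<exists>!c. c \<in> K \<rightarrow>\<^sub>E carrier S \<and> u = (\<Oplus>\<^bsub>M\<^esub>k\<in>K. c k \<odot>\<^bsub>M\<^esub> e k))"

definition module_direct_sum ::
  "('s, 'k) ring_scheme \<Rightarrow> ('s, 'm, 'l) module_scheme \<Rightarrow> 'm set \<Rightarrow> 'm set \<Rightarrow> bool" where
  "module_direct_sum S M F C \<longleftrightarrow> submodule F S M \<and> submodule C S M \<and>
     F <+>\<^bsub>M\<^esub> C = carrier M \<and> F \<inter> C = {\<zero>\<^bsub>M\<^esub>}"

text \<open>Meaningful when \<open>S\<close> is a nonzero commutative ring and \<open>M\<close> is finitely generated, so that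
  the set of ranks is finite; it always contains \<open>0\<close>.\<close>

definition f_rank :: "('s, 'k) ring_scheme \<Rightarrow> ('s, 'm, 'l) module_scheme \<Rightarrow> nat" where
  "f_rank S M = Max {k. \<exists>F C e. module_direct_sum S M F C \<and> module_basis S M F {1..k} e}"

text \<open>The module \<open>I/I\<^sup>2\<close> over \<open>R/I\<close>, with carrier the cosets of \<open>I\<^sup>2\<close> in \<open>I\<close>. The fields
  \<open>mult\<close> and \<open>one\<close> of the record play no role for a module.\<close>

definition conormal :: "('r, 'k) ring_scheme \<Rightarrow> 'r set \<Rightarrow> ('r set, 'r set) module" where
  "conormal R I =
    \<lparr>carrier = (\<lambda>u. ideal_prod R I I +>\<^bsub>R\<^esub> u) ` I, monoid.mult = undefined, one = undefined,
     ring.zero = ideal_prod R I I, ring.add = set_add R,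
     smult = (\<lambda>s m. \<Union>r\<in>s. \<Union>u\<in>m. ideal_prod R I I +>\<^bsub>R\<^esub> (r \<otimes>\<^bsub>R\<^esub> u))\<rparr>"


section \<open>Dg algebras\<close>

text \<open>A dg algebra is modelled by its total ring, the family of its homogeneous components as
  subsets of the carrier, and its differential.\<close>

record ('r, 'a) dga = "('r, 'a) module" +
  homog :: "nat \<Rightarrow> 'a set"
  diff :: "'a \<Rightarrow> 'a"

text \<open>\<open>(-1)\<^sup>k u\<close>\<close>

definition signed :: "('a, 'k) ring_scheme \<Rightarrow> int \<Rightarrow> 'a \<Rightarrow> 'a" where
  "signed A k u = (if even k then u else \<ominus>\<^bsub>A\<^esub> u)"

definition degree_zero_ring :: "('r, 'a) dga \<Rightarrow> ('r, 'a) dga" where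
  "degree_zero_ring A = A\<lparr>carrier := homog A 0\<rparr>"

locale dg_algebra = module R A + ring A
  for R :: "('r, 'k) ring_scheme" (structure) and A :: "('r, 'a) dga" (structure) +
  assumes smult_mult_left:
      "\<lbrakk>r \<in> carrier R; u \<in> carrier A; v \<in> carrier A\<rbrakk> \<Longrightarrow>
        (r \<odot>\<^bsub>A\<^esub> u) \<otimes>\<^bsub>A\<^esub> v = r \<odot>\<^bsub>A\<^esub> (u \<otimes>\<^bsub>A\<^esub> v)"
    and smult_mult_right:
      "\<lbrakk>r \<in> carrier R; u \<in> carrier A; v \<in> carrier A\<rbrakk> \<Longrightarrow>
        u \<otimes>\<^bsub>A\<^esub> (r \<odot>\<^bsub>A\<^esub> v) = r \<odot>\<^bsub>A\<^esub> (u \<otimes>\<^bsub>A\<^esub> v)"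
    and comp_submodule: "submodule (homog A i) R A"
    and decomposition:
      "u \<in> carrier A \<Longrightarrow> \<exists>!c. (\<forall>i. c i \<in> homog A i) \<and> finite {i. c i \<noteq> \<zero>\<^bsub>A\<^esub>} \<and>
        u = (\<Oplus>\<^bsub>A\<^esub>i\<in>{i. c i \<noteq> \<zero>\<^bsub>A\<^esub>}. c i)"
    and one_comp: "\<one>\<^bsub>A\<^esub> \<in> homog A 0"
    and mult_comp: "\<lbrakk>u \<in> homog A i; v \<in> homog A j\<rbrakk> \<Longrightarrow> u \<otimes>\<^bsub>A\<^esub> v \<in> homog A (i + j)"
    and graded_commute:
      "\<lbrakk>u \<in> homog A i; v \<in> homog A j\<rbrakk> \<Longrightarrow> u \<otimes>\<^bsub>A\<^esub> v = signed A (int (i * j)) (v \<otimes>\<^bsub>A\<^esub> u)"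
    and odd_square: "\<lbrakk>u \<in> homog A i; odd i\<rbrakk> \<Longrightarrow> u \<otimes>\<^bsub>A\<^esub> u = \<zero>\<^bsub>A\<^esub>"
    and diff_add:
      "\<lbrakk>u \<in> carrier A; v \<in> carrier A\<rbrakk> \<Longrightarrow> diff A (u \<oplus>\<^bsub>A\<^esub> v) = diff A u \<oplus>\<^bsub>A\<^esub> diff A v"
    and diff_smult:
      "\<lbrakk>r \<in> carrier R; u \<in> carrier A\<rbrakk> \<Longrightarrow> diff A (r \<odot>\<^bsub>A\<^esub> u) = r \<odot>\<^bsub>A\<^esub> diff A u"
    and diff_comp_0: "u \<in> homog A 0 \<Longrightarrow> diff A u = \<zero>\<^bsub>A\<^esub>"
    and diff_comp_Suc: "u \<in> homog A (Suc i) \<Longrightarrow> diff A u \<in> homog A i"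
    and diff_diff: "u \<in> carrier A \<Longrightarrow> diff A (diff A u) = \<zero>\<^bsub>A\<^esub>"
    and leibniz:
      "\<lbrakk>u \<in> homog A i; v \<in> homog A j\<rbrakk> \<Longrightarrow>
        diff A (u \<otimes>\<^bsub>A\<^esub> v) = diff A u \<otimes>\<^bsub>A\<^esub> v \<oplus>\<^bsub>A\<^esub> signed A (int i) (u \<otimes>\<^bsub>A\<^esub> diff A v)"
    and degree_zero_noetherian: "noetherian_ring (degree_zero_ring A)"
    and comp_fin_gen:
      "\<exists>G. finite G \<and> G \<subseteq> homog A i \<and>
        (\<forall>u\<in>homog A i. \<exists>c\<in>G \<rightarrow> homog A 0. u = (\<Oplus>\<^bsub>A\<^esub>g\<in>G. c g \<otimes>\<^bsub>A\<^esub> g))"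

definition dga_hom ::
  "('r, 'k) ring_scheme \<Rightarrow> ('r, 'a) dga \<Rightarrow> ('r, 'b) dga \<Rightarrow> ('a \<Rightarrow> 'b) set" where
  "dga_hom R A B = {f \<in> ring_hom A B.
     (\<forall>r\<in>carrier R. \<forall>u\<in>carrier A. f (r \<odot>\<^bsub>A\<^esub> u) = r \<odot>\<^bsub>B\<^esub> f u) \<and>
     (\<forall>i. f ` homog A i \<subseteq> homog B i) \<and>
     (\<forall>u\<in>carrier A. f (diff A u) = diff B (f u))}"

definition dga_iso ::
  "('r, 'k) ring_scheme \<Rightarrow> ('r, 'a) dga \<Rightarrow> ('r, 'b) dga \<Rightarrow> ('a \<Rightarrow> 'b) set" where
  "dga_iso R A B = {f \<in> dga_hom R A B. bij_betw f (carrier A) (carrier B)}"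

text \<open>A ring \<open>Q\<close> with structure map \<open>h\<close> from the base ring, as a dg algebra in degree \<open>0\<close>.\<close>

definition concentrated :: "('r \<Rightarrow> 'q) \<Rightarrow> ('q, 'k) ring_scheme \<Rightarrow> ('r, 'q) dga" where
  "concentrated h Q =
    \<lparr>carrier = carrier Q, monoid.mult = monoid.mult Q, one = \<one>\<^bsub>Q\<^esub>, ring.zero = \<zero>\<^bsub>Q\<^esub>, ring.add = ring.add Q,
     smult = (\<lambda>r q. h r \<otimes>\<^bsub>Q\<^esub> q),
     homog = (\<lambda>i. if i = 0 then carrier Q else {\<zero>\<^bsub>Q\<^esub>}), diff = (\<lambda>_. \<zero>\<^bsub>Q\<^esub>)\<rparr>"

definition sub_dga :: "('r, 'a) dga \<Rightarrow> 'a set \<Rightarrow> ('r, 'a) dga" where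
  "sub_dga A W = A\<lparr>carrier := W, homog := (\<lambda>i. homog A i \<inter> W)\<rparr>"

definition dg_subalgebra :: "('r, 'k) ring_scheme \<Rightarrow> 'a set \<Rightarrow> ('r, 'a) dga \<Rightarrow> bool" where
  "dg_subalgebra R W A \<longleftrightarrow> W \<subseteq> carrier A \<and> dg_algebra R (sub_dga A W)"


subsection \<open>Homology\<close>

definition cycles :: "('r, 'a) dga \<Rightarrow> nat \<Rightarrow> 'a set" where
  "cycles A i = {u \<in> homog A i. diff A u = \<zero>\<^bsub>A\<^esub>}"

definition boundaries :: "('r, 'a) dga \<Rightarrow> nat \<Rightarrow> 'a set" where
  "boundaries A i = diff A ` homog A (Suc i)"

definition homology :: "('r, 'a) dga \<Rightarrow> nat \<Rightarrow> 'a set set" where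
  "homology A i = (\<lambda>u. boundaries A i +>\<^bsub>A\<^esub> u) ` cycles A i"

definition quasi_iso ::
  "('r, 'k) ring_scheme \<Rightarrow> ('r, 'a) dga \<Rightarrow> ('r, 'b) dga \<Rightarrow> ('a \<Rightarrow> 'b) \<Rightarrow> bool" where
  "quasi_iso R A B f \<longleftrightarrow> f \<in> dga_hom R A B \<and>
     (\<forall>i. bij_betw (\<lambda>U. boundaries B i <+>\<^bsub>B\<^esub> f ` U) (homology A i) (homology B i))"


subsection \<open>Derivations\<close>

definition derivation ::
  "('r, 'k) ring_scheme \<Rightarrow> ('r, 'b) dga \<Rightarrow> int \<Rightarrow> ('b \<Rightarrow> 'b) \<Rightarrow> bool" where
  "derivation R B d \<theta> \<longleftrightarrow>
     \<theta> \<in> carrier B \<rightarrow> carrier B \<and>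
     (\<forall>u\<in>carrier B. \<forall>v\<in>carrier B. \<theta> (u \<oplus>\<^bsub>B\<^esub> v) = \<theta> u \<oplus>\<^bsub>B\<^esub> \<theta> v) \<and>
     (\<forall>r\<in>carrier R. \<forall>u\<in>carrier B. \<theta> (r \<odot>\<^bsub>B\<^esub> u) = r \<odot>\<^bsub>B\<^esub> \<theta> u) \<and>
     (\<forall>i. \<forall>u\<in>homog B i.
        if 0 \<le> int i + d then \<theta> u \<in> homog B (nat (int i + d)) else \<theta> u = \<zero>\<^bsub>B\<^esub>) \<and>
     (\<forall>i j. \<forall>u\<in>homog B i. \<forall>v\<in>homog B j.
        \<theta> (u \<otimes>\<^bsub>B\<^esub> v) = \<theta> u \<otimes>\<^bsub>B\<^esub> v \<oplus>\<^bsub>B\<^esub> signed B (d * int i) (u \<otimes>\<^bsub>B\<^esub> \<theta> v))"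

definition chain_derivation ::
  "('r, 'k) ring_scheme \<Rightarrow> ('r, 'b) dga \<Rightarrow> int \<Rightarrow> ('b \<Rightarrow> 'b) \<Rightarrow> bool" where
  "chain_derivation R B d \<theta> \<longleftrightarrow> derivation R B d \<theta> \<and>
     (\<forall>u\<in>carrier B. diff B (\<theta> u) = signed B d (\<theta> (diff B u)))"


subsection \<open>Tensor products\<close>

definition tensor_relations ::
  "('r, 'k) ring_scheme \<Rightarrow> ('r, 'a, 'l) module_scheme \<Rightarrow> ('r, 'b, 'm) module_scheme \<Rightarrow>
    ('a \<times> 'b \<Rightarrow>\<^sub>0 int) set" where
  "tensor_relations R M N = generate (free_Abelian_group (carrier M \<times> carrier N))
    ({frag_of (u \<oplus>\<^bsub>M\<^esub> u', v) - frag_of (u, v) - frag_of (u', v) | u u' v.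
        u \<in> carrier M \<and> u' \<in> carrier M \<and> v \<in> carrier N} \<union>
     {frag_of (u, v \<oplus>\<^bsub>N\<^esub> v') - frag_of (u, v) - frag_of (u, v') | u v v'.
        u \<in> carrier M \<and> v \<in> carrier N \<and> v' \<in> carrier N} \<union>
     {frag_of (r \<odot>\<^bsub>M\<^esub> u, v) - frag_of (u, r \<odot>\<^bsub>N\<^esub> v) | r u v.
        r \<in> carrier R \<and> u \<in> carrier M \<and> v \<in> carrier N})"

definition tensor_group ::
  "('r, 'k) ring_scheme \<Rightarrow> ('r, 'a, 'l) module_scheme \<Rightarrow> ('r, 'b, 'm) module_scheme \<Rightarrow>
    ('a \<times> 'b \<Rightarrow>\<^sub>0 int) set monoid" where
  "tensor_group R M N =
     free_Abelian_group (carrier M \<times> carrier N) Mod tensor_relations R M N"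

text \<open>The map \<open>\<Sum> k\<^sub>p p \<mapsto> \<Sum> k\<^sub>p \<beta> p\<close> on formal sums.\<close>

definition extend_formal_sum ::
  "('t, 'k) ring_scheme \<Rightarrow> ('p \<Rightarrow> 't) \<Rightarrow> ('p \<Rightarrow>\<^sub>0 int) \<Rightarrow> 't" where
  "extend_formal_sum T \<beta> c =
     (\<Oplus>\<^bsub>T\<^esub>p\<in>Poly_Mapping.keys c. add_pow T (Poly_Mapping.lookup c p) (\<beta> p))"

text \<open>\<open>T\<close> with \<open>j\<^sub>A: A \<rightarrow> T\<close> and \<open>j\<^sub>B: B \<rightarrow> T\<close> is the dg algebra \<open>A \<otimes>\<^sub>R B\<close>, where
  \<open>j\<^sub>A u = u \<otimes> 1\<close> and \<open>j\<^sub>B v = 1 \<otimes> v\<close>: the map \<open>u \<otimes> v \<mapsto> j\<^sub>A u j\<^sub>B v\<close> from the tensor product of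
  the underlying modules is bijective. As \<open>j\<^sub>A\<close> and \<open>j\<^sub>B\<close> are homomorphisms of dg algebras and
  \<open>T\<close> is graded commutative, the grading is the total one, the multiplication is
  \<open>(u \<otimes> v)(u' \<otimes> v') = (-1)\<^bsup>|v||u'|\<^esup> uu' \<otimes> vv'\<close> and the differential is
  \<open>u \<otimes> v \<mapsto> \<partial>u \<otimes> v + (-1)\<^bsup>|u|\<^esup> u \<otimes> \<partial>v\<close>.\<close>

definition is_dg_tensor ::
  "('r, 'k) ring_scheme \<Rightarrow> ('r, 'a) dga \<Rightarrow> ('r, 'b) dga \<Rightarrow> ('r, 't) dga \<Rightarrow>
    ('a \<Rightarrow> 't) \<Rightarrow> ('b \<Rightarrow> 't) \<Rightarrow> bool" where
  "is_dg_tensor R A B T jA jB \<longleftrightarrow>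
     dg_algebra R T \<and> jA \<in> dga_hom R A T \<and> jB \<in> dga_hom R B T \<and>
     (\<lambda>U. the_elem (extend_formal_sum T (\<lambda>(u, v). jA u \<otimes>\<^bsub>T\<^esub> jB v) ` U))
       \<in> iso (tensor_group R A B) (add_monoid T)"


section \<open>Semi-free extensions and minimal models\<close>

text \<open>The variables are a family \<open>\<xi>\<close> indexed by a set \<open>X\<close>, with degrees \<open>\<delta>\<close>. Over a chosen
  linear order \<open>r\<close> of the indices, a monomial is written as the weakly increasing list of the
  variables occurring in it, each repeated according to its exponent; variables of odd degree
  are exterior and occur at most once.\<close>

definition normal_words :: "'v set \<Rightarrow> ('v \<Rightarrow> nat) \<Rightarrow> 'v rel \<Rightarrow> 'v list set" where
  "normal_words X \<delta> r =
     {xs. set xs \<subseteq> X \<and> sorted_wrt (\<lambda>x y. (x, y) \<in> r \<and> (x = y \<longrightarrow> even (\<delta> x))) xs}"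

definition monomial :: "('b, 'k) ring_scheme \<Rightarrow> ('v \<Rightarrow> 'b) \<Rightarrow> 'v list \<Rightarrow> 'b" where
  "monomial B \<xi> xs = foldr (\<lambda>x p. \<xi> x \<otimes>\<^bsub>B\<^esub> p) xs \<one>\<^bsub>B\<^esub>"

text \<open>The underlying graded algebra of \<open>B\<close> is obtained from \<open>A\<close> by adjoining free variables:
  the monomials form a basis of \<open>B\<close> over \<open>A\<close>. Another choice of the order changes monomials
  only by a sign.\<close>

definition free_variables ::
  "('r, 'a) dga \<Rightarrow> ('r, 'b) dga \<Rightarrow> ('a \<Rightarrow> 'b) \<Rightarrow> 'v set \<Rightarrow> ('v \<Rightarrow> nat) \<Rightarrow> ('v \<Rightarrow> 'b) \<Rightarrow> bool" where
  "free_variables A B \<iota> X \<delta> \<xi> \<longleftrightarrow>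
     (\<forall>x\<in>X. \<xi> x \<in> homog B (\<delta> x)) \<and>
     (\<exists>r. linear_order_on X r \<and>
       (\<forall>u\<in>carrier B. \<exists>!c.
          (\<forall>xs\<in>normal_words X \<delta> r. c xs \<in> carrier A) \<and>
          (\<forall>xs. xs \<notin> normal_words X \<delta> r \<longrightarrow> c xs = \<zero>\<^bsub>A\<^esub>) \<and>
          finite {xs. c xs \<noteq> \<zero>\<^bsub>A\<^esub>} \<and>
          u = (\<Oplus>\<^bsub>B\<^esub>xs\<in>{xs. c xs \<noteq> \<zero>\<^bsub>A\<^esub>}. \<iota> (c xs) \<otimes>\<^bsub>B\<^esub> monomial B \<xi> xs)))"

text \<open>\<open>B = A[X]\<close> via \<open>\<iota>: A \<rightarrow> B\<close>. Being a family indexed by \<open>X\<close>, the variables make sense also over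
  the zero dg algebra. The elements \<open>\<partial>(\<xi> x)\<close> are automatically cycles since \<open>\<partial>\<^sup>2 = 0\<close>.\<close>

definition semi_free_extension ::
  "('r, 'k) ring_scheme \<Rightarrow> ('r, 'a) dga \<Rightarrow> ('r, 'b) dga \<Rightarrow> ('a \<Rightarrow> 'b) \<Rightarrow>
    'v set \<Rightarrow> ('v \<Rightarrow> nat) \<Rightarrow> ('v \<Rightarrow> 'b) \<Rightarrow> bool" where
  "semi_free_extension R A B \<iota> X \<delta> \<xi> \<longleftrightarrow>
     dg_algebra R A \<and> dg_algebra R B \<and> \<iota> \<in> dga_hom R A B \<and>
     free_variables A B \<iota> X \<delta> \<xi> \<and>
     (\<forall>x\<in>X. diff B (\<xi> x) \<in>
        generate_ring B (\<iota> ` carrier A \<union> \<xi> ` {y \<in> X. \<delta> y < \<delta> x}))"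

text \<open>\<open>B = W[z\<^sub>1,\<dots>,z\<^sub>n | \<partial>z\<^sub>i = 0]\<close> with exterior variables of degree \<open>1\<close>; this
  determines \<open>B\<close> up to isomorphism over \<open>W\<close>.\<close>

definition exterior_cycle_extension ::
  "('r, 'k) ring_scheme \<Rightarrow> ('r, 'a) dga \<Rightarrow> ('r, 'b) dga \<Rightarrow> ('a \<Rightarrow> 'b) \<Rightarrow>
    nat \<Rightarrow> (nat \<Rightarrow> 'b) \<Rightarrow> bool" where
  "exterior_cycle_extension R W B \<iota> n z \<longleftrightarrow>
     semi_free_extension R W B \<iota> {1..n} (\<lambda>_. 1) z \<and> (\<forall>i\<in>{1..n}. diff B (z i) = \<zero>\<^bsub>B\<^esub>)"

text \<open>The image of \<open>r\<close> under the structure map of an \<open>R\<close>-algebra.\<close>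

definition scalar :: "('r, 'a) dga \<Rightarrow> 'r \<Rightarrow> 'a" where
  "scalar A r = r \<odot>\<^bsub>A\<^esub> \<one>\<^bsub>A\<^esub>"

text \<open>\<open>B = R[X]\<close>, together with \<open>\<epsilon>: R[X] \<rightarrow> R/I\<close>, is a minimal model of \<open>R \<rightarrow> R/I\<close>. The map
  \<open>scalar B: R \<rightarrow> B\<close> is injective because \<open>B\<close> is free over \<open>R\<close>; \<open>G\<close> is \<open>\<partial>(X\<^sub>1)\<close> regarded as a
  subset of \<open>R\<close>.\<close>

definition minimal_model ::
  "('r, 'k) ring_scheme \<Rightarrow> 'r set \<Rightarrow> ('r, 'b) dga \<Rightarrow> 'v set \<Rightarrow> ('v \<Rightarrow> nat) \<Rightarrow> ('v \<Rightarrow> 'b) \<Rightarrow>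
    ('b \<Rightarrow> 'r set) \<Rightarrow> bool" where
  "minimal_model R I B X \<delta> \<xi> \<epsilon> \<longleftrightarrow>
     semi_free_extension R (concentrated (\<lambda>r. r) R) B (scalar B) X \<delta> \<xi> \<and>
     (\<forall>x\<in>X. 1 \<le> \<delta> x) \<and>
     quasi_iso R B (concentrated (\<lambda>r. I +>\<^bsub>R\<^esub> r) (R Quot I)) \<epsilon> \<and>
     (\<exists>G\<subseteq>carrier R. minimally_generates (genideal R) G (\<lambda>g. g) I \<and>
        diff B ` \<xi> ` {x \<in> X. \<delta> x = 1} = scalar B ` G) \<and>
     (let Q = genideal B (\<xi> ` X \<union> scalar B ` max_ideal R)
      in \<forall>x\<in>X. 2 \<le> \<delta> x \<longrightarrow> diff B (\<xi> x) \<in> ideal_prod B Q Q)"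

end

theory Submission
  imports Defs
begin

text \<open>Since \<open>R[X] \<rightarrow> S\<close> is a quasi-isomorphism, a derivation of \<open>R[X]\<close> of degree \<open>-1\<close> that commutes with
  the differential up to sign can be built one degree of variables at a time, choosing \<open>\<theta>(y)\<close> as a
  bounding element of the cycle \<open>-\<theta>(\<partial>y)\<close>. The only obstruction occurs for \<open>|y| = 2\<close>, where
  \<open>\<theta>\<^sub>x(\<partial>y)\<close> is the coefficient of \<open>x\<close> in \<open>\<partial>y\<close>: it lies in \<open>I\<close>, because \<open>\<partial>\<^sup>2y = 0\<close> is a relation
  between the \<open>a\<^sub>i\<close> and \<open>b\<^sub>j\<close> and the classes of the \<open>a\<^sub>i\<close> are a basis of a summand of \<open>I/I\<^sup>2\<close>.
  These derivations extend to \<open>A[X]\<close>. Choosing \<open>\<alpha>\<^sub>i \<in> A\<^sub>1\<close> with \<open>\<partial>\<alpha>\<^sub>i = a\<^sub>i\<close>, the cycles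
  \<open>z\<^sub>i = x\<^sub>i - \<alpha>\<^sub>i\<close> satisfy \<open>\<theta>\<^sub>i(z\<^sub>j) = \<delta>\<^sub>i\<^sub>j\<close>. Replacing \<open>\<theta>\<^sub>j\<close> by \<open>\<theta>\<^sub>j - z\<^sub>i[\<theta>\<^sub>i, \<theta>\<^sub>j]\<close> and \<open>\<theta>\<^sub>i\<close> by
  \<open>\<theta>\<^sub>i - z\<^sub>i\<theta>\<^sub>i\<^sup>2\<close> makes the derivations anticommute and square to zero; then each \<open>\<theta>\<^sub>i\<close> splits off the
  exterior variable \<open>z\<^sub>i\<close>, and \<open>A[X]\<close> itself is the extension of the common kernel by the \<open>z\<^sub>i\<close>.\<close>

section \<open>Additive maps and direct sums\<close>

text \<open>The bounding elements are arbitrary choices, so the derivations built on R[X] satisfy no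
  relations among each other, and \<theta>_j need not map the kernel of \<theta>_i into itself.
  Without such stability the exterior variables could not be split off one at a time. The repair has
  to wait for A[X], where elements \<open>\<alpha>\<^sub>i\<close> with boundary
  \<open>a\<^sub>i\<close> exist and make the \<open>z\<^sub>i\<close> cycles; conversely the
  derivations cannot be built directly on A[X], which need not be acyclic in positive degrees. The
  corrections are harmless because brackets and squares have degree -2: they vanish in degrees 0 and
  1, so the values on X_1 and on the \<open>z\<^sub>j\<close> survive, and they vanish on A. The
  square needs a correction of its own, since the bracket of \<theta> with itself is twice the
  square and 2 need not be invertible. That W is a dg subalgebra includes finite generation of its
  components over A_0. This comes from an A_0-linear projection of A[X] onto W, composed from the
  same splittings.\<close>

abbreviation add_hom :: "('a, 'k) ring_scheme \<Rightarrow> ('b, 'l) ring_scheme \<Rightarrow> ('a \<Rightarrow> 'b) set" where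
  "add_hom A B \<equiv> hom (add_monoid A) (add_monoid B)"

lemma add_homI:
  assumes "\<And>u. u \<in> carrier A \<Longrightarrow> f u \<in> carrier B"
    and "\<And>u v. \<lbrakk>u \<in> carrier A; v \<in> carrier A\<rbrakk> \<Longrightarrow> f (u \<oplus>\<^bsub>A\<^esub> v) = f u \<oplus>\<^bsub>B\<^esub> f v"
  shows "f \<in> add_hom A B"
  using assms by (auto simp: hom_def)

lemma add_hom_closed: "\<lbrakk>f \<in> add_hom A B; u \<in> carrier A\<rbrakk> \<Longrightarrow> f u \<in> carrier B"
  by (auto simp: hom_def)

lemma add_hom_add:
  "\<lbrakk>f \<in> add_hom A B; u \<in> carrier A; v \<in> carrier A\<rbrakk> \<Longrightarrow> f (u \<oplus>\<^bsub>A\<^esub> v) = f u \<oplus>\<^bsub>B\<^esub> f v"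
  by (auto simp: hom_def)

lemma add_hom_abelian_group_hom:
  assumes "abelian_group A" "abelian_group B" "f \<in> add_hom A B"
  shows "abelian_group_hom A B f"
  using assms by (intro abelian_group_homI group_hom.intro group_hom_axioms.intro abelian_group.a_group)

lemma add_hom_zero:
  assumes "abelian_group A" "abelian_group B" "f \<in> add_hom A B"
  shows "f \<zero>\<^bsub>A\<^esub> = \<zero>\<^bsub>B\<^esub>"
  using add_hom_abelian_group_hom[OF assms] abelian_group_hom.hom_zero by blast

lemma add_hom_neg:
  assumes "abelian_group A" "abelian_group B" "f \<in> add_hom A B" "u \<in> carrier A"
  shows "f (\<ominus>\<^bsub>A\<^esub> u) = \<ominus>\<^bsub>B\<^esub> f u"
  using abelian_group_hom.hom_a_inv[OF add_hom_abelian_group_hom[OF assms(1-3)] assms(4)] by simp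

lemma add_hom_diff:
  assumes "abelian_group A" "abelian_group B" "f \<in> add_hom A B" "u \<in> carrier A" "v \<in> carrier A"
  shows "f (u \<ominus>\<^bsub>A\<^esub> v) = f u \<ominus>\<^bsub>B\<^esub> f v"
  using assms by (simp add: a_minus_def add_hom_add add_hom_neg abelian_group.a_inv_closed)

lemma add_hom_finsum:
  assumes A: "abelian_group A" and B: "abelian_group B" and f: "f \<in> add_hom A B"
    and g: "\<And>i. i \<in> K \<Longrightarrow> g i \<in> carrier A"
  shows "f (\<Oplus>\<^bsub>A\<^esub>i\<in>K. g i) = (\<Oplus>\<^bsub>B\<^esub>i\<in>K. f (g i))"
proof -
  interpret A: abelian_group A by fact
  interpret B: abelian_group B by fact
  show ?thesis
    using g
  proof (induction K rule: infinite_finite_induct)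
    case (insert i K)
    then have "f (\<Oplus>\<^bsub>A\<^esub>i\<in>insert i K. g i) = f (g i \<oplus>\<^bsub>A\<^esub> (\<Oplus>\<^bsub>A\<^esub>i\<in>K. g i))"
      by (subst A.finsum_insert) auto
    also have "\<dots> = f (g i) \<oplus>\<^bsub>B\<^esub> f (\<Oplus>\<^bsub>A\<^esub>i\<in>K. g i)"
      using insert by (intro add_hom_add[OF f]) (auto intro!: A.finsum_closed)
    also have "\<dots> = (\<Oplus>\<^bsub>B\<^esub>i\<in>insert i K. f (g i))"
      using insert add_hom_closed[OF f] by (subst B.finsum_insert) auto
    finally show ?case .
  qed (use add_hom_zero[OF A B f] in auto)
qed

text \<open>One notion for two decompositions: the grading of a dg algebra, whose pieces are the
  components, and the monomial basis, whose pieces are copies of the base ring. The index set is a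
  whole type, so an index that should not occur receives the piece {0}.\<close>

locale decomposed_group = V: abelian_group V + B: abelian_group B
  for V :: "('c, 'k) ring_scheme" and B :: "('b, 'l) ring_scheme" (structure) +
  fixes C :: "'i \<Rightarrow> 'c set" and e :: "'i \<Rightarrow> 'c \<Rightarrow> 'b"
  assumes C_carrier: "c \<in> C i \<Longrightarrow> c \<in> carrier V"
    and C_zero: "\<zero>\<^bsub>V\<^esub> \<in> C i"
    and C_add: "\<lbrakk>c \<in> C i; d \<in> C i\<rbrakk> \<Longrightarrow> c \<oplus>\<^bsub>V\<^esub> d \<in> C i"
    and e_closed: "c \<in> C i \<Longrightarrow> e i c \<in> carrier B"
    and e_add: "\<lbrakk>c \<in> C i; d \<in> C i\<rbrakk> \<Longrightarrow> e i (c \<oplus>\<^bsub>V\<^esub> d) = e i c \<oplus> e i d"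
    and decomp: "u \<in> carrier B \<Longrightarrow> \<exists>!c. (\<forall>i. c i \<in> C i) \<and> finite {i. c i \<noteq> \<zero>\<^bsub>V\<^esub>} \<and>
        u = (\<Oplus>i\<in>{i. c i \<noteq> \<zero>\<^bsub>V\<^esub>}. e i (c i))"
begin

definition coef :: "'b \<Rightarrow> 'i \<Rightarrow> 'c" where
  "coef u = (THE c. (\<forall>i. c i \<in> C i) \<and> finite {i. c i \<noteq> \<zero>\<^bsub>V\<^esub>} \<and>
        u = (\<Oplus>i\<in>{i. c i \<noteq> \<zero>\<^bsub>V\<^esub>}. e i (c i)))"

lemma coef:
  assumes "u \<in> carrier B"
  shows "coef u i \<in> C i" "finite {i. coef u i \<noteq> \<zero>\<^bsub>V\<^esub>}"
    "u = (\<Oplus>i\<in>{i. coef u i \<noteq> \<zero>\<^bsub>V\<^esub>}. e i (coef u i))"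
  using theI'[OF decomp[OF assms]] unfolding coef_def by auto

text \<open>The summand maps are only assumed additive; f(0) + f(0) = f(0) cancels in the target
  group.\<close>

lemma additive_at_zero:
  assumes "abelian_group B'" and "f \<zero>\<^bsub>V\<^esub> \<in> carrier B'"
    and "f (\<zero>\<^bsub>V\<^esub> \<oplus>\<^bsub>V\<^esub> \<zero>\<^bsub>V\<^esub>) = f \<zero>\<^bsub>V\<^esub> \<oplus>\<^bsub>B'\<^esub> f \<zero>\<^bsub>V\<^esub>"
  shows "f \<zero>\<^bsub>V\<^esub> = \<zero>\<^bsub>B'\<^esub>"
proof -
  interpret B': abelian_group B' by fact
  show ?thesis
    using assms by (metis B'.add.l_cancel_one V.add.one_closed V.r_zero)
qed

lemma e_zero: "e i \<zero>\<^bsub>V\<^esub> = \<zero>"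
  by (rule additive_at_zero[of B "e i"]) (auto simp: B.abelian_group_axioms e_closed C_zero simp flip: e_add)

lemma coef_unique:
  assumes K: "finite K" and c: "\<And>i. c i \<in> C i" "\<And>i. i \<notin> K \<Longrightarrow> c i = \<zero>\<^bsub>V\<^esub>"
    and u: "u = (\<Oplus>i\<in>K. e i (c i))"
  shows "coef u = c"
proof -
  have uB: "u \<in> carrier B"
    unfolding u using c e_closed by (auto intro!: B.finsum_closed)
  have sub: "{i. c i \<noteq> \<zero>\<^bsub>V\<^esub>} \<subseteq> K"
    using c by blast
  have "u = (\<Oplus>i\<in>{i. c i \<noteq> \<zero>\<^bsub>V\<^esub>}. e i (c i))"
    unfolding u by (rule B.add.finprod_mono_neutral_cong_right)
      (use sub K c e_closed e_zero in \<open>auto\<close>)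
  then show ?thesis
    using decomp[OF uB] coef[OF uB] c(1) finite_subset[OF sub K] by blast
qed

lemma expand_coef:
  assumes u: "u \<in> carrier B" and K: "finite K" "{i. coef u i \<noteq> \<zero>\<^bsub>V\<^esub>} \<subseteq> K"
  shows "u = (\<Oplus>i\<in>K. e i (coef u i))"
  by (subst coef(3)[OF u], rule B.add.finprod_mono_neutral_cong_left)
    (use K coef[OF u] e_closed e_zero in auto)

lemma coef_add:
  assumes u: "u \<in> carrier B" and v: "v \<in> carrier B"
  shows "coef (u \<oplus> v) = (\<lambda>i. coef u i \<oplus>\<^bsub>V\<^esub> coef v i)"
proof -
  let ?K = "{i. coef u i \<noteq> \<zero>\<^bsub>V\<^esub>} \<union> {i. coef v i \<noteq> \<zero>\<^bsub>V\<^esub>}"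
  have K: "finite ?K"
    using coef[OF u] coef[OF v] by auto
  have uv: "u = (\<Oplus>i\<in>?K. e i (coef u i))" "v = (\<Oplus>i\<in>?K. e i (coef v i))"
    using expand_coef[OF u K] expand_coef[OF v K] by auto
  have "u \<oplus> v = (\<Oplus>i\<in>?K. e i (coef u i)) \<oplus> (\<Oplus>i\<in>?K. e i (coef v i))"
    using uv by metis
  also have "\<dots> = (\<Oplus>i\<in>?K. e i (coef u i) \<oplus> e i (coef v i))"
    by (rule B.finsum_addf[symmetric]) (use coef(1)[OF u] coef(1)[OF v] e_closed in auto)
  also have "\<dots> = (\<Oplus>i\<in>?K. e i (coef u i \<oplus>\<^bsub>V\<^esub> coef v i))"
    by (rule B.finsum_cong') (use coef(1)[OF u] coef(1)[OF v] e_closed e_add in auto)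
  finally show ?thesis
    by (intro coef_unique[OF K]) (use coef(1)[OF u] coef(1)[OF v] C_add in auto)
qed

lemma coef_e:
  assumes "c \<in> C i"
  shows "coef (e i c) = (\<lambda>j. if j = i then c else \<zero>\<^bsub>V\<^esub>)"
  by (rule coef_unique[of "{i}"]) (use assms C_zero e_closed in \<open>auto simp: B.finsum_insert\<close>)

lemma decomposed_induct [consumes 1, case_names zero summand add]:
  assumes "u \<in> carrier B"
    and zero: "P \<zero>" and sm: "\<And>i c. c \<in> C i \<Longrightarrow> P (e i c)"
    and add: "\<And>u v. \<lbrakk>u \<in> carrier B; v \<in> carrier B; P u; P v\<rbrakk> \<Longrightarrow> P (u \<oplus> v)"
  shows "P u"
proof -
  have *: "P (\<Oplus>i\<in>K. e i (coef u i))" if "finite K" for K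
    using that
  proof (induction K)
    case (insert i K)
    then show ?case
      using coef(1)[OF assms(1)] e_closed
      by (subst B.finsum_insert) (auto intro!: add sm B.finsum_closed)
  qed (simp add: zero)
  show ?thesis
    by (subst coef(3)[OF assms(1)], rule *) (use coef(2)[OF assms(1)] in auto)
qed

text \<open>Universal property of a direct sum. The supports of u, v and u + v differ, so additivity
  is checked over the union of the supports of u and v, where the surplus terms vanish.\<close>

lemma extend_additive:
  fixes B' :: "('d, 'm) ring_scheme"
  assumes B': "abelian_group B'"
    and f: "\<And>i c. c \<in> C i \<Longrightarrow> f i c \<in> carrier B'"
      "\<And>i c d. \<lbrakk>c \<in> C i; d \<in> C i\<rbrakk> \<Longrightarrow> f i (c \<oplus>\<^bsub>V\<^esub> d) = f i c \<oplus>\<^bsub>B'\<^esub> f i d"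
  shows "\<exists>h \<in> add_hom B B'. \<forall>i. \<forall>c\<in>C i. h (e i c) = f i c"
proof -
  interpret B': abelian_group B' by fact
  have f0: "f i \<zero>\<^bsub>V\<^esub> = \<zero>\<^bsub>B'\<^esub>" for i
    by (rule additive_at_zero[of B' "f i"]) (auto simp: B' f C_zero simp flip: f(2))
  define h where "h u = (\<Oplus>\<^bsub>B'\<^esub>i\<in>{i. coef u i \<noteq> \<zero>\<^bsub>V\<^esub>}. f i (coef u i))" for u
  have h_eq: "h u = (\<Oplus>\<^bsub>B'\<^esub>i\<in>K. f i (coef u i))"
    if "u \<in> carrier B" "finite K" "{i. coef u i \<noteq> \<zero>\<^bsub>V\<^esub>} \<subseteq> K" for u K
    unfolding h_def by (rule B'.add.finprod_mono_neutral_cong_left)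
      (use that coef[of u] f f0 in auto)
  have "h \<in> add_hom B B'"
  proof (rule add_homI)
    show "h u \<in> carrier B'" if "u \<in> carrier B" for u
      unfolding h_def using that coef(1) f by (auto intro!: B'.finsum_closed)
  next
    fix u v assume u: "u \<in> carrier B" and v: "v \<in> carrier B"
    let ?K = "{i. coef u i \<noteq> \<zero>\<^bsub>V\<^esub>} \<union> {i. coef v i \<noteq> \<zero>\<^bsub>V\<^esub>}"
    have K: "finite ?K"
      using coef[OF u] coef[OF v] by auto
    have "{i. coef (u \<oplus> v) i \<noteq> \<zero>\<^bsub>V\<^esub>} \<subseteq> ?K"
      using coef_add[OF u v] by (auto simp: V.l_zero)
    then have "h (u \<oplus> v) = (\<Oplus>\<^bsub>B'\<^esub>i\<in>?K. f i (coef u i \<oplus>\<^bsub>V\<^esub> coef v i))"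
      using h_eq[of "u \<oplus> v" ?K] K u v coef_add[OF u v] by simp
    also have "\<dots> = (\<Oplus>\<^bsub>B'\<^esub>i\<in>?K. f i (coef u i) \<oplus>\<^bsub>B'\<^esub> f i (coef v i))"
      by (rule B'.finsum_cong') (use coef(1)[OF u] coef(1)[OF v] f in auto)
    also have "\<dots> = h u \<oplus>\<^bsub>B'\<^esub> h v"
      using h_eq[OF u K] h_eq[OF v K] coef(1)[OF u] coef(1)[OF v] f
      by (subst B'.finsum_addf) auto
    finally show "h (u \<oplus> v) = h u \<oplus>\<^bsub>B'\<^esub> h v" .
  qed
  moreover have "h (e i c) = f i c" if "c \<in> C i" for i c
  proof -
    have "h (e i c) = (\<Oplus>\<^bsub>B'\<^esub>j\<in>{i}. f j (coef (e i c) j))"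
      by (rule h_eq) (use that in \<open>auto simp: e_closed coef_e\<close>)
    then show ?thesis
      using that f by (simp add: coef_e)
  qed
  ultimately show ?thesis
    by blast
qed

end

section \<open>The grading of a dg algebra\<close>

context ring
begin

lemma signed_closed [simp, intro]: "u \<in> carrier R \<Longrightarrow> signed R k u \<in> carrier R"
  by (simp add: signed_def)

lemma signed_add:
  "\<lbrakk>u \<in> carrier R; v \<in> carrier R\<rbrakk> \<Longrightarrow> signed R k (u \<oplus> v) = signed R k u \<oplus> signed R k v"
  by (simp add: signed_def minus_add)

lemma signed_signed [simp]: "u \<in> carrier R \<Longrightarrow> signed R k (signed R l u) = signed R (k + l) u"
  by (simp add: signed_def)

lemma signed_zero [simp]: "signed R k \<zero> = \<zero>"
  by (simp add: signed_def)

lemma signed_mult_left: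
  "\<lbrakk>u \<in> carrier R; v \<in> carrier R\<rbrakk> \<Longrightarrow> signed R k u \<otimes> v = signed R k (u \<otimes> v)"
  by (simp add: signed_def l_minus)

lemma signed_mult_right:
  "\<lbrakk>u \<in> carrier R; v \<in> carrier R\<rbrakk> \<Longrightarrow> u \<otimes> signed R k v = signed R k (u \<otimes> v)"
  by (simp add: signed_def r_minus)

lemma signed_even: "even k \<Longrightarrow> signed R k u = u"
  by (simp add: signed_def)

lemma signed_odd: "odd k \<Longrightarrow> signed R k u = \<ominus> u"
  by (simp add: signed_def)

lemma signed_cong: "even k = even l \<Longrightarrow> signed R k u = signed R l u"
  by (simp add: signed_def)

end

text \<open>The grading involution \<open>u \<mapsto> (-1)\<^bsup>|u|\<^esup>u\<close> puts the sign rules into a form that makes sense for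
  inhomogeneous elements.\<close>

definition involution :: "('r, 'a) dga \<Rightarrow> 'a \<Rightarrow> 'a" where
  "involution A = (SOME h. h \<in> add_hom A A \<and> (\<forall>i. \<forall>u\<in>homog A i. h u = signed A (int i) u))"

locale dga = dg_algebra R A for R :: "('r, 'k) ring_scheme" and A :: "('r, 'a) dga" (structure)
begin

lemma homog_carrier [intro, simp]: "u \<in> homog A i \<Longrightarrow> u \<in> carrier A"
  using submoduleE(1)[OF comp_submodule] by blast

lemma homog_add: "\<lbrakk>u \<in> homog A i; v \<in> homog A i\<rbrakk> \<Longrightarrow> u \<oplus> v \<in> homog A i"
  using submoduleE(5)[OF comp_submodule] by blast

lemma homog_neg: "u \<in> homog A i \<Longrightarrow> \<ominus> u \<in> homog A i"
  using submoduleE(3)[OF comp_submodule] by blast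

lemma homog_smult: "\<lbrakk>r \<in> carrier R; u \<in> homog A i\<rbrakk> \<Longrightarrow> r \<odot> u \<in> homog A i"
  using submoduleE(4)[OF comp_submodule] by blast

lemma homog_zero [simp, intro]: "\<zero> \<in> homog A i"
  using submoduleE(2)[OF comp_submodule, of i] homog_neg homog_add homog_carrier r_neg
  by (metis ex_in_conv)

lemma homog_diff: "\<lbrakk>u \<in> homog A i; v \<in> homog A i\<rbrakk> \<Longrightarrow> u \<ominus> v \<in> homog A i"
  by (simp add: a_minus_def homog_add homog_neg)

lemma homog_signed: "u \<in> homog A i \<Longrightarrow> signed A k u \<in> homog A i"
  by (simp add: signed_def homog_neg)

lemma homog_finsum: "(\<And>k. k \<in> K \<Longrightarrow> f k \<in> homog A i) \<Longrightarrow> (\<Oplus>k\<in>K. f k) \<in> homog A i"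
proof (induction K rule: infinite_finite_induct)
  case (insert x F)
  then show ?case
    by (subst finsum_insert) (auto intro: homog_add)
qed auto

sublocale G: decomposed_group A A "homog A" "\<lambda>_ u. u"
  by unfold_locales (use decomposition homog_add in \<open>auto\<close>)

lemma is_abelian: "abelian_group A"
  by (rule is_abelian_group)

lemmas add_rules = add_hom_closed add_hom_add add_hom_zero[OF is_abelian is_abelian]
  add_hom_neg[OF is_abelian is_abelian] add_hom_diff[OF is_abelian is_abelian]

lemma homog_induct [consumes 1, case_names homog add]:
  assumes "u \<in> carrier A"
    and "\<And>i u. u \<in> homog A i \<Longrightarrow> P u"
    and "\<And>u v. \<lbrakk>u \<in> carrier A; v \<in> carrier A; P u; P v\<rbrakk> \<Longrightarrow> P (u \<oplus> v)"
  shows "P u"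
  using assms(1)
proof (induction rule: G.decomposed_induct)
  case zero
  then show ?case by (rule assms(2)[OF homog_zero])
qed (use assms in auto)

lemma coef_homog: "u \<in> homog A i \<Longrightarrow> G.coef u j = (if j = i then u else \<zero>)"
  using G.coef_e by simp

lemma involution:
  "involution A \<in> add_hom A A" "u \<in> homog A i \<Longrightarrow> involution A u = signed A (int i) u"
proof -
  have "\<exists>h. h \<in> add_hom A A \<and> (\<forall>i. \<forall>u\<in>homog A i. h u = signed A (int i) u)"
    using G.extend_additive[OF is_abelian, of "\<lambda>i. signed A (int i)"] by (auto simp: signed_add)
  from someI_ex[OF this]
  show "involution A \<in> add_hom A A" "u \<in> homog A i \<Longrightarrow> involution A u = signed A (int i) u"
    by (auto simp: involution_def)
qed

lemma involution_closed [simp, intro]: "u \<in> carrier A \<Longrightarrow> involution A u \<in> carrier A"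
  using add_hom_closed[OF involution(1)] .

lemmas involution_add = add_hom_add[OF involution(1)]

lemma involution_homog: "u \<in> homog A i \<Longrightarrow> involution A u \<in> homog A i"
  by (simp add: involution(2) homog_signed)

lemma involution_involution [simp]:
  "u \<in> carrier A \<Longrightarrow> involution A (involution A u) = u"
proof (induction rule: homog_induct)
  case (homog i u)
  then show ?case
    by (simp add: involution(2)[OF homog_signed[OF homog]] involution(2) signed_even)
qed (simp add: involution_add)

lemma involution_mult:
  assumes u: "u \<in> carrier A" and v: "v \<in> carrier A"
  shows "involution A (u \<otimes> v) = involution A u \<otimes> involution A v"
  using u
proof (induction rule: homog_induct)
  case (homog i u)
  show ?case
    using v
  proof (induction rule: homog_induct)
    case (homog j v)
    then show ?case
      using \<open>u \<in> homog A i\<close> mult_comp[of u i v j]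
      by (simp add: involution(2) signed_mult_left signed_mult_right add.commute)
  qed (use homog in \<open>simp add: r_distr involution_add\<close>)
qed (simp add: l_distr involution_add v)

lemma diff_closed [simp, intro]: "u \<in> carrier A \<Longrightarrow> diff A u \<in> carrier A"
proof (induction rule: homog_induct)
  case (homog i u)
  then show ?case
    by (cases i) (use diff_comp_0 diff_comp_Suc in auto)
qed (simp add: diff_add)

lemma diff_add_hom: "diff A \<in> add_hom A A"
  by (rule add_homI) (auto simp: diff_add)

lemma diff_zero [simp]: "diff A \<zero> = \<zero>"
  by (rule add_rules[OF diff_add_hom])

lemma diff_neg: "u \<in> carrier A \<Longrightarrow> diff A (\<ominus> u) = \<ominus> diff A u"
  by (rule add_rules[OF diff_add_hom])

lemma diff_signed: "u \<in> carrier A \<Longrightarrow> diff A (signed A k u) = signed A k (diff A u)"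
  by (simp add: signed_def diff_neg)

lemma diff_involution:
  "u \<in> carrier A \<Longrightarrow> diff A (involution A u) = \<ominus> involution A (diff A u)"
proof (induction rule: homog_induct)
  case (homog i u)
  show ?case
  proof (cases i)
    case 0
    then show ?thesis
      using homog involution_homog[OF homog] add_rules(3)[OF involution(1)]
      by (simp add: diff_comp_0)
  next
    case (Suc j)
    then show ?thesis
      using homog diff_comp_Suc[of u j]
      by (simp add: involution(2) diff_signed diff_neg signed_def)
  qed
qed (simp add: involution_add diff_add minus_add)

lemma diff_mult:
  assumes u: "u \<in> carrier A" and v: "v \<in> carrier A"
  shows "diff A (u \<otimes> v) = diff A u \<otimes> v \<oplus> involution A u \<otimes> diff A v"
  using u
proof (induction rule: homog_induct)
  case (homog i u)
  show ?case
    using v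
  proof (induction rule: homog_induct)
    case (homog j v)
    then show ?case
      using \<open>u \<in> homog A i\<close>
      by (simp add: involution(2) leibniz signed_mult_left)
  next
    case (add v w)
    then show ?case
      using \<open>u \<in> homog A i\<close> by (simp add: r_distr diff_add a_ac)
  qed
next
  case (add u w)
  then show ?case
    using v by (simp add: l_distr diff_add involution_add a_ac)
qed

text \<open>For odd |z| the sign of the exchange depends only on the parity of |u|, so it is the
  sign of the grading involution, and the rule extends additively to inhomogeneous u.\<close>

lemma odd_commute_involution:
  assumes z: "z \<in> homog A i" "odd i" and u: "u \<in> carrier A"
  shows "z \<otimes> u = involution A u \<otimes> z"
  using u
proof (induction rule: homog_induct)
  case (homog j u)
  have "even (int (i * j)) = even (int j)"
    using z by simp
  then show ?case
    using homog graded_commute[of z i u j] z(1)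
    by (metis homog_carrier involution(2) signed_cong signed_mult_left)
qed (use z in \<open>simp add: l_distr r_distr involution_add\<close>)

lemma involution_smult:
  assumes "r \<in> carrier R" "u \<in> carrier A"
  shows "involution A (r \<odot> u) = r \<odot> involution A u"
  using assms(2)
proof (induction rule: homog_induct)
  case (homog i u)
  then show ?case
    using assms(1) homog_smult[OF assms(1) homog] smult_r_minus[OF assms(1)]
    by (simp add: involution(2) signed_def)
qed (use assms(1) in \<open>simp add: smult_r_distr involution_add\<close>)

lemma scalar_closed [simp, intro]: "r \<in> carrier R \<Longrightarrow> scalar A r \<in> carrier A"
  by (simp add: scalar_def)

lemma scalar_homog: "r \<in> carrier R \<Longrightarrow> scalar A r \<in> homog A 0"
  by (simp add: scalar_def homog_smult one_comp)

lemma scalar_mult: "\<lbrakk>r \<in> carrier R; u \<in> carrier A\<rbrakk> \<Longrightarrow> scalar A r \<otimes> u = r \<odot> u"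
  by (simp add: scalar_def smult_mult_left)

lemma diff_scalar: "r \<in> carrier R \<Longrightarrow> diff A (scalar A r) = \<zero>"
  by (simp add: diff_comp_0 scalar_homog)

lemma diff_one: "diff A \<one> = \<zero>"
  by (simp add: diff_comp_0 one_comp)

lemma involution_one: "involution A \<one> = \<one>"
  using involution(2)[OF one_comp] by (simp add: signed_even)

end

section \<open>Derivations\<close>

text \<open>Degree -1 with degrees in the natural numbers: \<open>degree_0\<close> expresses that
  the component of degree -1 is zero. The Leibniz rule with the involution applies to inhomogeneous
  elements as well.\<close>

locale odd_derivation = dga +
  fixes \<theta> :: "'c \<Rightarrow> 'c"
  assumes additive: "\<theta> \<in> add_hom A A"
    and linear: "\<lbrakk>r \<in> carrier R; u \<in> carrier A\<rbrakk> \<Longrightarrow> \<theta> (r \<odot> u) = r \<odot> \<theta> u"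
    and degree_0: "u \<in> homog A 0 \<Longrightarrow> \<theta> u = \<zero>"
    and degree_Suc: "u \<in> homog A (Suc i) \<Longrightarrow> \<theta> u \<in> homog A i"
    and product: "\<lbrakk>u \<in> carrier A; v \<in> carrier A\<rbrakk> \<Longrightarrow>
      \<theta> (u \<otimes> v) = \<theta> u \<otimes> v \<oplus> involution A u \<otimes> \<theta> v"
begin

lemma closed [simp, intro]: "u \<in> carrier A \<Longrightarrow> \<theta> u \<in> carrier A"
  by (rule add_rules[OF additive])

lemma plus: "\<lbrakk>u \<in> carrier A; v \<in> carrier A\<rbrakk> \<Longrightarrow> \<theta> (u \<oplus> v) = \<theta> u \<oplus> \<theta> v"
  by (rule add_rules[OF additive])

lemma zero [simp]: "\<theta> \<zero> = \<zero>"
  by (rule add_rules[OF additive])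

lemma neg: "u \<in> carrier A \<Longrightarrow> \<theta> (\<ominus> u) = \<ominus> \<theta> u"
  by (rule add_rules[OF additive])

lemma minus: "\<lbrakk>u \<in> carrier A; v \<in> carrier A\<rbrakk> \<Longrightarrow> \<theta> (u \<ominus> v) = \<theta> u \<ominus> \<theta> v"
  by (rule add_rules[OF additive])

lemma one: "\<theta> \<one> = \<zero>"
  by (rule degree_0[OF one_comp])

lemma scalar_zero: "r \<in> carrier R \<Longrightarrow> \<theta> (scalar A r) = \<zero>"
  by (rule degree_0[OF scalar_homog])

text \<open>The derivation changes the parity of the degree, hence reverses the sign that the
  involution attaches.\<close>

lemma involution_commute: "u \<in> carrier A \<Longrightarrow> involution A (\<theta> u) = \<ominus> \<theta> (involution A u)"
proof (induction rule: homog_induct)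
  case (homog i u)
  show ?case
  proof (cases i)
    case 0
    then show ?thesis
      using homog involution_homog[OF homog] degree_0 add_rules(3)[OF involution(1)] by simp
  next
    case (Suc j)
    then show ?thesis
      using homog degree_Suc[of u j] by (simp add: involution(2) signed_def neg)
  qed
qed (simp add: involution_add plus minus_add)

lemma derivation: "derivation R A (-1) \<theta>"
proof -
  have "if 0 \<le> int i + (-1) then \<theta> u \<in> homog A (nat (int i + (-1))) else \<theta> u = \<zero>"
    if "u \<in> homog A i" for u i
    using that degree_0 degree_Suc by (cases i) auto
  moreover have "\<theta> (u \<otimes> v) = \<theta> u \<otimes> v \<oplus> signed A (- 1 * int i) (u \<otimes> \<theta> v)"
    if "u \<in> homog A i" "v \<in> homog A j" for u v i j
    using that homog_carrier[OF that(1)] homog_carrier[OF that(2)]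
    by (simp add: product involution(2) l_minus signed_def)
  ultimately show ?thesis
    unfolding derivation_def using linear plus by (intro conjI allI ballI Pi_I closed) blast+
qed

end

locale chain_odd_derivation = odd_derivation +
  assumes chain: "u \<in> carrier A \<Longrightarrow> diff A (\<theta> u) = \<ominus> \<theta> (diff A u)"
begin

lemma chain_derivation: "chain_derivation R A (-1) \<theta>"
  using derivation chain by (simp add: chain_derivation_def signed_def)

end

text \<open>Degree -2, the common home of brackets and squares of derivations of degree -1. Even
  degree removes all signs, and vanishing in degrees 0 and 1 is what protects degree-one values
  under the corrections below.\<close>

locale chain_even_derivation = dga +
  fixes D :: "'c \<Rightarrow> 'c"
  assumes additive: "D \<in> add_hom A A"
    and linear: "\<lbrakk>r \<in> carrier R; u \<in> carrier A\<rbrakk> \<Longrightarrow> D (r \<odot> u) = r \<odot> D u"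
    and degree_le_1: "u \<in> homog A 0 \<union> homog A (Suc 0) \<Longrightarrow> D u = \<zero>"
    and degree_Suc_Suc: "u \<in> homog A (Suc (Suc i)) \<Longrightarrow> D u \<in> homog A i"
    and product: "\<lbrakk>u \<in> carrier A; v \<in> carrier A\<rbrakk> \<Longrightarrow> D (u \<otimes> v) = D u \<otimes> v \<oplus> u \<otimes> D v"
    and chain: "u \<in> carrier A \<Longrightarrow> diff A (D u) = D (diff A u)"
begin

lemma closed [simp, intro]: "u \<in> carrier A \<Longrightarrow> D u \<in> carrier A"
  by (rule add_rules[OF additive])

lemma plus: "\<lbrakk>u \<in> carrier A; v \<in> carrier A\<rbrakk> \<Longrightarrow> D (u \<oplus> v) = D u \<oplus> D v"
  by (rule add_rules[OF additive])

end

section \<open>Brackets, squares and corrections of chain derivations\<close>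

context dga
begin

text \<open>In the expansion of both composites on a product, the mixed terms occur with opposite
  signs, because \<phi> and \<theta> anticommute with the involution.\<close>

lemma chain_bracket:
  assumes "chain_odd_derivation R A \<phi>" "chain_odd_derivation R A \<theta>"
  shows "chain_even_derivation R A (\<lambda>u. \<phi> (\<theta> u) \<oplus> \<theta> (\<phi> u))"
proof -
  interpret p: chain_odd_derivation R A \<phi> by fact
  interpret t: chain_odd_derivation R A \<theta> by fact
  show ?thesis
  proof unfold_locales
    show "(\<lambda>u. \<phi> (\<theta> u) \<oplus> \<theta> (\<phi> u)) \<in> add_hom A A"
      by (rule add_homI) (auto simp: p.plus t.plus a_ac)
    show "\<phi> (\<theta> u) \<oplus> \<theta> (\<phi> u) = \<zero>" if "u \<in> homog A 0 \<union> homog A (Suc 0)" for u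
      using that p.degree_0 t.degree_0 p.degree_Suc[of u 0] t.degree_Suc[of u 0] by auto
    show "\<phi> (\<theta> (u \<otimes> v)) \<oplus> \<theta> (\<phi> (u \<otimes> v)) =
        (\<phi> (\<theta> u) \<oplus> \<theta> (\<phi> u)) \<otimes> v \<oplus> u \<otimes> (\<phi> (\<theta> v) \<oplus> \<theta> (\<phi> v))"
      if [simp]: "u \<in> carrier A" "v \<in> carrier A" for u v
    proof -
      have "\<phi> (\<theta> (u \<otimes> v)) = \<phi> (\<theta> u) \<otimes> v \<oplus> \<ominus> (\<theta> (involution A u) \<otimes> \<phi> v)
          \<oplus> (\<phi> (involution A u) \<otimes> \<theta> v \<oplus> u \<otimes> \<phi> (\<theta> v))"
        by (simp add: t.product p.product p.plus t.involution_commute l_minus)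
      moreover have "\<theta> (\<phi> (u \<otimes> v)) = \<theta> (\<phi> u) \<otimes> v \<oplus> \<ominus> (\<phi> (involution A u) \<otimes> \<theta> v)
          \<oplus> (\<theta> (involution A u) \<otimes> \<phi> v \<oplus> u \<otimes> \<theta> (\<phi> v))"
        by (simp add: t.product p.product t.plus p.involution_commute l_minus)
      moreover have "\<phi> (\<theta> u) \<in> carrier A" "\<theta> (\<phi> u) \<in> carrier A" "\<phi> (\<theta> v) \<in> carrier A"
        "\<theta> (\<phi> v) \<in> carrier A" "\<theta> (involution A u) \<in> carrier A" "\<phi> (involution A u) \<in> carrier A"
        "\<phi> v \<in> carrier A" "\<theta> v \<in> carrier A"
        by auto
      ultimately show ?thesis
        using that by algebra
    qed
  qed (auto simp: p.linear t.linear smult_r_distr p.degree_Suc t.degree_Suc homog_add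
      diff_add p.chain t.chain p.neg t.neg)
qed

text \<open>The mixed terms cancel as for the bracket. Deducing this from the bracket of \<theta>
  with itself would require division by 2.\<close>

lemma chain_square:
  assumes "chain_odd_derivation R A \<theta>"
  shows "chain_even_derivation R A (\<lambda>u. \<theta> (\<theta> u))"
proof -
  interpret t: chain_odd_derivation R A \<theta> by fact
  show ?thesis
  proof unfold_locales
    show "(\<lambda>u. \<theta> (\<theta> u)) \<in> add_hom A A"
      by (rule add_homI) (auto simp: t.plus)
    show "\<theta> (\<theta> u) = \<zero>" if "u \<in> homog A 0 \<union> homog A (Suc 0)" for u
      using that t.degree_0 t.degree_Suc[of u 0] by auto
    show "\<theta> (\<theta> (u \<otimes> v)) = \<theta> (\<theta> u) \<otimes> v \<oplus> u \<otimes> \<theta> (\<theta> v)"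
      if [simp]: "u \<in> carrier A" "v \<in> carrier A" for u v
    proof -
      have "\<theta> (\<theta> (u \<otimes> v)) = \<theta> (\<theta> u) \<otimes> v \<oplus> \<ominus> (\<theta> (involution A u) \<otimes> \<theta> v)
          \<oplus> (\<theta> (involution A u) \<otimes> \<theta> v \<oplus> u \<otimes> \<theta> (\<theta> v))"
        by (simp add: t.product t.plus t.involution_commute l_minus)
      moreover have "\<theta> (\<theta> u) \<in> carrier A" "\<theta> (\<theta> v) \<in> carrier A" "\<theta> (involution A u) \<in> carrier A"
        "\<theta> v \<in> carrier A"
        by auto
      ultimately show ?thesis
        using that by algebra
    qed
  qed (auto simp: t.linear t.degree_Suc t.chain t.neg)
qed

text \<open>Multiplication by z raises the degree -2 of D to -1. Moving z past u produces the
  involution in the Leibniz rule, and since z is an odd cycle, the differential anticommutes with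
  multiplication by z, which gives the sign in the chain rule.\<close>

lemma chain_correction:
  assumes "chain_odd_derivation R A \<theta>" "chain_even_derivation R A D"
    and z: "z \<in> homog A (Suc 0)" and dz: "diff A z = \<zero>"
  shows "chain_odd_derivation R A (\<lambda>u. \<theta> u \<ominus> z \<otimes> D u)"
proof -
  interpret t: chain_odd_derivation R A \<theta> by fact
  interpret D: chain_even_derivation R A D by fact
  have zc [simp]: "z \<in> carrier A"
    using z by auto
  have sz: "involution A z = \<ominus> z"
    using involution(2)[OF z] by (simp add: signed_def)
  show ?thesis
  proof unfold_locales
    show "(\<lambda>u. \<theta> u \<ominus> z \<otimes> D u) \<in> add_hom A A"
      by (rule add_homI) (auto simp: t.plus D.plus r_distr a_minus_def minus_add a_ac)
    show "\<theta> (r \<odot> u) \<ominus> z \<otimes> D (r \<odot> u) = r \<odot> (\<theta> u \<ominus> z \<otimes> D u)"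
      if "r \<in> carrier R" "u \<in> carrier A" for r u
      using that by (simp add: t.linear D.linear smult_mult_right a_minus_def smult_r_distr smult_r_minus)
    show "\<theta> u \<ominus> z \<otimes> D u = \<zero>" if "u \<in> homog A 0" for u
      using that t.degree_0 D.degree_le_1[of u] by (simp add: a_minus_def)
    show "\<theta> u \<ominus> z \<otimes> D u \<in> homog A i" if u: "u \<in> homog A (Suc i)" for u i
    proof (cases i)
      case 0
      then show ?thesis
        using u t.degree_Suc[OF u] D.degree_le_1[of u] by (simp add: a_minus_def)
    next
      case (Suc j)
      then show ?thesis
        using u t.degree_Suc[OF u] D.degree_Suc_Suc[of u j] mult_comp[OF z, of "D u" j]
        by (simp add: homog_diff)
    qed
    show "\<theta> (u \<otimes> v) \<ominus> z \<otimes> D (u \<otimes> v) =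
        (\<theta> u \<ominus> z \<otimes> D u) \<otimes> v \<oplus> involution A u \<otimes> (\<theta> v \<ominus> z \<otimes> D v)"
      if [simp]: "u \<in> carrier A" "v \<in> carrier A" for u v
    proof -
      have "z \<otimes> (u \<otimes> D v) = involution A u \<otimes> (z \<otimes> D v)"
        using odd_commute_involution[OF z, of u] by (simp flip: m_assoc)
      then show ?thesis
        by (simp add: t.product D.product a_minus_def l_distr r_distr r_minus l_minus minus_add m_assoc a_ac)
    qed
    show "diff A (\<theta> u \<ominus> z \<otimes> D u) = \<ominus> (\<theta> (diff A u) \<ominus> z \<otimes> D (diff A u))"
      if "u \<in> carrier A" for u
      using that by (simp add: diff_add diff_neg t.chain diff_mult dz sz D.chain l_minus a_minus_def minus_add)
  qed
qed

text \<open>If \<open>\<phi>\<^sup>2 = 0\<close> and \<open>E = [\<phi>, \<theta>]\<close>, then \<open>[\<phi>, E] = 0\<close>, so that \<open>[\<phi>, zE] = E\<close> when \<open>\<phi> z = 1\<close>.\<close>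

lemma anticommuting_correction:
  assumes "chain_odd_derivation R A \<phi>" "chain_odd_derivation R A \<theta>"
    and z: "z \<in> homog A (Suc 0)" and pz: "\<phi> z = \<one>"
    and pp: "\<And>u. u \<in> carrier A \<Longrightarrow> \<phi> (\<phi> u) = \<zero>"
    and u [simp]: "u \<in> carrier A"
  defines "\<theta>' \<equiv> \<lambda>u. \<theta> u \<ominus> z \<otimes> (\<phi> (\<theta> u) \<oplus> \<theta> (\<phi> u))"
  shows "\<phi> (\<theta>' u) \<oplus> \<theta>' (\<phi> u) = \<zero>"
proof -
  interpret p: chain_odd_derivation R A \<phi> by fact
  interpret t: chain_odd_derivation R A \<theta> by fact
  have [simp]: "z \<in> carrier A"
    using z by auto
  have sz: "involution A z = \<ominus> z"
    using involution(2)[OF z] by (simp add: signed_def)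
  have "\<phi> (\<theta>' u) = \<phi> (\<theta> u) \<ominus> (\<phi> (\<theta> u) \<oplus> \<theta> (\<phi> u) \<ominus> z \<otimes> \<phi> (\<theta> (\<phi> u)))"
    unfolding \<theta>'_def by (simp add: p.neg p.product p.plus pz sz pp l_minus a_minus_def)
  moreover have "\<theta>' (\<phi> u) = \<theta> (\<phi> u) \<ominus> z \<otimes> \<phi> (\<theta> (\<phi> u))"
    unfolding \<theta>'_def by (simp add: pp)
  moreover have "z \<in> carrier A" "\<phi> (\<theta> u) \<in> carrier A" "\<theta> (\<phi> u) \<in> carrier A" "\<phi> (\<theta> (\<phi> u)) \<in> carrier A"
    by auto
  ultimately show ?thesis
    by algebra
qed

text \<open>By the Jacobi identity, the correction along \<open>\<phi>\<close> does not destroy \<open>[\<psi>, \<theta>] = 0\<close>.\<close>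

lemma anticommuting_correction_preserves:
  assumes "chain_odd_derivation R A \<phi>" "chain_odd_derivation R A \<theta>" "chain_odd_derivation R A \<psi>"
    and z: "z \<in> homog A (Suc 0)" and pz: "\<psi> z = \<zero>"
    and pp: "\<And>u. u \<in> carrier A \<Longrightarrow> \<psi> (\<phi> u) \<oplus> \<phi> (\<psi> u) = \<zero>"
    and pt: "\<And>u. u \<in> carrier A \<Longrightarrow> \<psi> (\<theta> u) \<oplus> \<theta> (\<psi> u) = \<zero>"
    and u [simp]: "u \<in> carrier A"
  defines "\<theta>' \<equiv> \<lambda>u. \<theta> u \<ominus> z \<otimes> (\<phi> (\<theta> u) \<oplus> \<theta> (\<phi> u))"
  shows "\<psi> (\<theta>' u) \<oplus> \<theta>' (\<psi> u) = \<zero>"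
proof -
  interpret p: chain_odd_derivation R A \<phi> by fact
  interpret t: chain_odd_derivation R A \<theta> by fact
  interpret s: chain_odd_derivation R A \<psi> by fact
  have [simp]: "z \<in> carrier A"
    using z by auto
  have sz: "involution A z = \<ominus> z"
    using involution(2)[OF z] by (simp add: signed_def)
  have st: "\<psi> (\<theta> v) = \<ominus> \<theta> (\<psi> v)" and sp: "\<psi> (\<phi> v) = \<ominus> \<phi> (\<psi> v)" if "v \<in> carrier A" for v
    using pp[OF that] pt[OF that] that minus_equality by auto
  have "\<psi> (\<theta>' u) = \<ominus> \<theta> (\<psi> u) \<oplus> z \<otimes> (\<phi> (\<theta> (\<psi> u)) \<oplus> \<theta> (\<phi> (\<psi> u)))"
    unfolding \<theta>'_def
    by (simp add: s.neg s.product s.plus pz sz st sp p.neg t.neg l_minus a_minus_def)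
  moreover have "z \<in> carrier A" "\<theta> (\<psi> u) \<in> carrier A" "\<phi> (\<theta> (\<psi> u)) \<in> carrier A"
    "\<theta> (\<phi> (\<psi> u)) \<in> carrier A"
    by auto
  ultimately show ?thesis
    unfolding \<theta>'_def by algebra
qed

text \<open>From \<theta> z = 1 one gets \<theta>(\<theta>' u) = z \<theta>^3 u, and applying
  \<theta> again gives \<theta>^3 u - z \<theta>^4 u. In \<theta>'(\<theta>' u) the terms z
  \<theta>^3 u cancel and the rest contains z^2 = 0.\<close>

lemma square_correction:
  assumes "chain_odd_derivation R A \<theta>"
    and z: "z \<in> homog A (Suc 0)" and tz: "\<theta> z = \<one>"
    and u [simp]: "u \<in> carrier A"
  defines "\<theta>' \<equiv> \<lambda>u. \<theta> u \<ominus> z \<otimes> \<theta> (\<theta> u)"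
  shows "\<theta>' (\<theta>' u) = \<zero>"
proof -
  interpret t: chain_odd_derivation R A \<theta> by fact
  have [simp]: "z \<in> carrier A"
    using z by auto
  have sz: "involution A z = \<ominus> z"
    using involution(2)[OF z] by (simp add: signed_def)
  have zz: "z \<otimes> (z \<otimes> v) = \<zero>" if "v \<in> carrier A" for v
    using odd_square[OF z] that by (simp flip: m_assoc)
  have 1: "\<theta> (\<theta>' u) = z \<otimes> \<theta> (\<theta> (\<theta> u))"
    unfolding \<theta>'_def by (simp add: t.plus t.neg t.product tz sz l_minus minus_add r_neg2 a_minus_def)
  have "\<theta> (\<theta> (\<theta>' u)) = \<theta> (\<theta> (\<theta> u)) \<ominus> z \<otimes> \<theta> (\<theta> (\<theta> (\<theta> u)))"
    unfolding 1 by (simp add: t.product tz sz l_minus a_minus_def)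
  then show ?thesis
    using 1 unfolding \<theta>'_def
    by (simp add: a_minus_def r_distr r_minus zz r_neg)
qed

text \<open>A derivation \<psi> that anticommutes with \<theta> commutes with its square, and \<psi>
  z = 0 makes it anticommute with multiplication by z; so it anticommutes with the correction
  term.\<close>

lemma square_correction_preserves:
  assumes "chain_odd_derivation R A \<theta>" "chain_odd_derivation R A \<psi>"
    and z: "z \<in> homog A (Suc 0)" and pz: "\<psi> z = \<zero>"
    and pt: "\<And>u. u \<in> carrier A \<Longrightarrow> \<psi> (\<theta> u) \<oplus> \<theta> (\<psi> u) = \<zero>"
    and u [simp]: "u \<in> carrier A"
  defines "\<theta>' \<equiv> \<lambda>u. \<theta> u \<ominus> z \<otimes> \<theta> (\<theta> u)"
  shows "\<psi> (\<theta>' u) \<oplus> \<theta>' (\<psi> u) = \<zero>"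
proof -
  interpret t: chain_odd_derivation R A \<theta> by fact
  interpret s: chain_odd_derivation R A \<psi> by fact
  have [simp]: "z \<in> carrier A"
    using z by auto
  have sz: "involution A z = \<ominus> z"
    using involution(2)[OF z] by (simp add: signed_def)
  have st: "\<psi> (\<theta> v) = \<ominus> \<theta> (\<psi> v)" if "v \<in> carrier A" for v
    using pt[OF that] that minus_equality by auto
  have "\<psi> (\<theta>' u) = \<ominus> \<theta> (\<psi> u) \<oplus> z \<otimes> \<theta> (\<theta> (\<psi> u))"
    unfolding \<theta>'_def
    by (simp add: s.neg s.plus s.product pz sz st t.neg l_minus a_minus_def)
  moreover have "z \<in> carrier A" "\<theta> (\<psi> u) \<in> carrier A" "\<theta> (\<theta> (\<psi> u)) \<in> carrier A"
    by auto
  ultimately show ?thesis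
    unfolding \<theta>'_def by algebra
qed

end

section \<open>Derivations of free graded commutative algebras\<close>

context dga
begin

text \<open>The sum of the two composites of \<theta> with the differential satisfies the Leibniz
  rule without signs, as both maps anticommute with the involution. Its zero set is therefore closed
  under products, and generators suffice.\<close>

lemma chain_on_generated:
  assumes "odd_derivation R A \<theta>" and H: "H \<subseteq> carrier A"
    and chain: "\<And>h. h \<in> H \<Longrightarrow> diff A (\<theta> h) = \<ominus> \<theta> (diff A h)"
    and u: "u \<in> generate_ring A H"
  shows "diff A (\<theta> u) = \<ominus> \<theta> (diff A u)"
proof -
  interpret t: odd_derivation R A \<theta> by fact
  have carr: "v \<in> carrier A" if "v \<in> generate_ring A H" for v
    using generate_ring_in_carrier[OF H] that by blast
  show ?thesis
    using u
  proof (induction rule: generate_ring.induct)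
    case one
    then show ?case
      by (simp add: t.one diff_one)
  next
    case (a_inv h)
    then show ?case
      by (simp add: carr t.neg diff_neg)
  next
    case (eng_add u v)
    then show ?case
      by (simp add: carr t.plus diff_add minus_add)
  next
    case (eng_mult u v)
    then have [simp]: "u \<in> carrier A" "v \<in> carrier A"
      by (auto simp: carr)
    have "diff A (\<theta> (u \<otimes> v)) = \<ominus> \<theta> (diff A u) \<otimes> v \<oplus> \<ominus> \<theta> (involution A u) \<otimes> diff A v
        \<oplus> (\<ominus> involution A (diff A u) \<otimes> \<theta> v \<oplus> u \<otimes> \<ominus> \<theta> (diff A v))"
      using eng_mult
      by (simp add: t.product diff_add diff_mult t.involution_commute diff_involution)
    moreover have "\<theta> (diff A (u \<otimes> v)) = \<theta> (diff A u) \<otimes> v \<oplus> involution A (diff A u) \<otimes> \<theta> v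
        \<oplus> (\<theta> (involution A u) \<otimes> diff A v \<oplus> u \<otimes> \<theta> (diff A v))"
      by (simp add: t.product t.plus diff_mult)
    moreover have "\<theta> (diff A u) \<in> carrier A" "\<theta> (involution A u) \<in> carrier A" "diff A v \<in> carrier A"
      "involution A (diff A u) \<in> carrier A" "\<theta> v \<in> carrier A" "\<theta> (diff A v) \<in> carrier A"
      "u \<in> carrier A" "v \<in> carrier A"
      by auto
    ultimately show ?case
      by algebra
  qed (use chain in auto)
qed

text \<open>This makes the value of a derivation on the boundary of a variable depend only on its
  values on variables of smaller degree.\<close>

lemma odd_derivation_eq_on_generated:
  assumes "odd_derivation R A \<theta>" "odd_derivation R A \<theta>'" and H: "H \<subseteq> carrier A"
    and eq: "\<And>h. h \<in> H \<Longrightarrow> \<theta> h = \<theta>' h"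
    and u: "u \<in> generate_ring A H"
  shows "\<theta> u = \<theta>' u"
proof -
  interpret t: odd_derivation R A \<theta> by fact
  interpret t': odd_derivation R A \<theta>' by fact
  have carr: "v \<in> carrier A" if "v \<in> generate_ring A H" for v
    using generate_ring_in_carrier[OF H] that by blast
  show ?thesis
    using u
  proof (induction rule: generate_ring.induct)
    case one
    then show ?case
      by (simp add: t.one t'.one)
  qed (use eq in \<open>auto simp: carr t.neg t'.neg t.plus t'.plus t.product t'.product\<close>)
qed

text \<open>A homogeneous element may be a sum of generators of other degrees whose contributions
  cancel, so no direct induction over generators applies. The claim is restated for the components
  of an arbitrary element, a form that is additive.\<close>

lemma lowers_degree:
  assumes f: "f \<in> add_hom A A"
    and gen: "carrier A \<subseteq> generate (add_monoid A) S"
    and S: "\<And>g. g \<in> S \<Longrightarrow> \<exists>i. g \<in> homog A i \<and> (i = 0 \<longrightarrow> f g = \<zero>) \<and> f g \<in> homog A (i - 1)"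
  shows "u \<in> homog A 0 \<Longrightarrow> f u = \<zero>" and "u \<in> homog A (Suc i) \<Longrightarrow> f u \<in> homog A i"
proof -
  \<comment> \<open>f shifts every component of u down by one. For homogeneous u this reduces to the
    claim, since u is its only component.\<close>
  let ?P = "\<lambda>u. f (G.coef u 0) = \<zero> \<and> (\<forall>j. f (G.coef u (Suc j)) = G.coef (f u) j)"
  have hom: "?P g" if i: "g \<in> homog A i" "i = 0 \<longrightarrow> f g = \<zero>" "f g \<in> homog A (i - 1)" for g i
    using i coef_homog[OF i(1)] coef_homog[OF i(3)] add_rules(3)[OF f] coef_homog[of \<zero>]
    by (cases i) auto
  have SA: "S \<subseteq> carrier A"
    using S by blast
  have *: "\<forall>u\<in>carrier A. ?P u"
  proof
    fix u assume "u \<in> carrier A"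
    then have "u \<in> generate (add_monoid A) S"
      using gen by blast
    then show "?P u"
    proof (induction rule: generate.induct)
      case one
      show ?case
        using hom[OF homog_zero[of 0]] add_rules(3)[OF f] by simp
    next
      case (incl g)
      then show ?case
        using S hom by blast
    next
      case (inv g)
      then obtain i where i: "g \<in> homog A i" "i = 0 \<longrightarrow> f g = \<zero>" "f g \<in> homog A (i - 1)"
        using S by blast
      have "?P (\<ominus> g)"
        using hom[OF homog_neg[OF i(1)]] i add_rules(4)[OF f] homog_neg[OF i(3)] by auto
      then show ?case
        by (simp add: a_inv_def)
    next
      case (eng u v)
      then have uv: "u \<in> carrier A" "v \<in> carrier A"
        using add.generate_in_carrier[OF SA] by auto
      then have "G.coef u j \<in> carrier A" "G.coef v j \<in> carrier A" for j
        using G.coef(1) by auto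
      then show ?case
        using eng.IH uv by (simp add: G.coef_add add_rules[OF f])
    qed
  qed
  show "f u = \<zero>" if "u \<in> homog A 0"
  proof -
    have "f (G.coef u 0) = \<zero>"
      using bspec[OF * homog_carrier[OF that]] by (rule conjunct1)
    moreover have "G.coef u 0 = u"
      using coef_homog[OF that, of 0] by simp
    ultimately show ?thesis
      by metis
  qed
  show "f u \<in> homog A i" if u: "u \<in> homog A (Suc i)"
  proof -
    have "G.coef u (Suc i) = u"
      using coef_homog[OF u, of "Suc i"] by simp
    then have "f u = G.coef (f u) i"
      using conjunct2[OF bspec[OF * homog_carrier[OF u]]] by metis
    moreover have "G.coef (f u) i \<in> homog A i"
      using G.coef(1) add_rules(1)[OF f homog_carrier[OF u]] by blast
    ultimately show ?thesis
      by metis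
  qed
qed

lemma mult_swap:
  assumes "u \<in> homog A i" "v \<in> homog A j" "w \<in> carrier A"
  shows "u \<otimes> (v \<otimes> w) = signed A (int (i * j)) (v \<otimes> (u \<otimes> w))"
proof -
  have c: "u \<in> carrier A" "v \<in> carrier A"
    using assms by auto
  have "u \<otimes> (v \<otimes> w) = signed A (int (i * j)) (v \<otimes> u) \<otimes> w"
    using assms c graded_commute[OF assms(1,2)] by (simp flip: m_assoc)
  then show ?thesis
    using assms c by (simp add: signed_mult_left m_assoc)
qed

end

text \<open>The case with coefficients in the base ring. The order, which
  \<open>free_variables\<close> only asserts to exist, is fixed so that the basis can be referred
  to.\<close>

locale free_dga = dga +
  fixes X :: "'v set" and \<delta> :: "'v \<Rightarrow> nat" and \<xi> :: "'v \<Rightarrow> 'c" and ord :: "'v rel"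
  assumes var_homog: "x \<in> X \<Longrightarrow> \<xi> x \<in> homog A (\<delta> x)"
    and linear_ord: "linear_order_on X ord"
    and monomial_basis: "u \<in> carrier A \<Longrightarrow> \<exists>!c.
          (\<forall>xs\<in>normal_words X \<delta> ord. c xs \<in> carrier R) \<and>
          (\<forall>xs. xs \<notin> normal_words X \<delta> ord \<longrightarrow> c xs = \<zero>\<^bsub>R\<^esub>) \<and>
          finite {xs. c xs \<noteq> \<zero>\<^bsub>R\<^esub>} \<and>
          u = (\<Oplus>xs\<in>{xs. c xs \<noteq> \<zero>\<^bsub>R\<^esub>}. scalar A (c xs) \<otimes> monomial A \<xi> xs)"
begin

abbreviation normal :: "'v list \<Rightarrow> bool" where
  "normal xs \<equiv> xs \<in> normal_words X \<delta> ord"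

lemma var_carrier [simp, intro]: "x \<in> X \<Longrightarrow> \<xi> x \<in> carrier A"
  using var_homog by auto

lemma monomial_Nil [simp]: "monomial A \<xi> [] = \<one>"
  and monomial_Cons [simp]: "monomial A \<xi> (x # xs) = \<xi> x \<otimes> monomial A \<xi> xs"
  by (simp_all add: monomial_def)

lemma monomial_homog: "set xs \<subseteq> X \<Longrightarrow> monomial A \<xi> xs \<in> homog A (sum_list (map \<delta> xs))"
  by (induction xs) (auto simp: one_comp mult_comp var_homog)

lemma monomial_carrier [simp, intro]: "set xs \<subseteq> X \<Longrightarrow> monomial A \<xi> xs \<in> carrier A"
  using monomial_homog by auto

lemma normal_subset: "normal xs \<Longrightarrow> set xs \<subseteq> X"
  by (simp add: normal_words_def)

lemma monomial_append:
  "\<lbrakk>set xs \<subseteq> X; set ys \<subseteq> X\<rbrakk> \<Longrightarrow> monomial A \<xi> (xs @ ys) = monomial A \<xi> xs \<otimes> monomial A \<xi> ys"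
  by (induction xs) (auto simp: m_assoc)

text \<open>Words that are not normal get the piece {0}, so that the basis becomes a decomposition
  indexed by all lists.\<close>

sublocale M: decomposed_group R A
  "\<lambda>xs. if normal xs then carrier R else {\<zero>\<^bsub>R\<^esub>}"
  "\<lambda>xs r. if normal xs then r \<odot> monomial A \<xi> xs else \<zero>"
proof
  show "\<exists>!c. (\<forall>xs. c xs \<in> (if normal xs then carrier R else {\<zero>\<^bsub>R\<^esub>})) \<and> finite {xs. c xs \<noteq> \<zero>\<^bsub>R\<^esub>} \<and>
        u = (\<Oplus>xs\<in>{xs. c xs \<noteq> \<zero>\<^bsub>R\<^esub>}. if normal xs then c xs \<odot> monomial A \<xi> xs else \<zero>)"
    if "u \<in> carrier A" for u
  proof -
    have C: "(\<forall>xs. c xs \<in> (if normal xs then carrier R else {\<zero>\<^bsub>R\<^esub>})) \<longleftrightarrow>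
      (\<forall>xs\<in>normal_words X \<delta> ord. c xs \<in> carrier R) \<and> (\<forall>xs. \<not> normal xs \<longrightarrow> c xs = \<zero>\<^bsub>R\<^esub>)" for c
      by auto
    have "(\<Oplus>xs\<in>{xs. c xs \<noteq> \<zero>\<^bsub>R\<^esub>}. if normal xs then c xs \<odot> monomial A \<xi> xs else \<zero>) =
        (\<Oplus>xs\<in>{xs. c xs \<noteq> \<zero>\<^bsub>R\<^esub>}. scalar A (c xs) \<otimes> monomial A \<xi> xs)"
      if "\<forall>xs\<in>normal_words X \<delta> ord. c xs \<in> carrier R" "\<forall>xs. \<not> normal xs \<longrightarrow> c xs = \<zero>\<^bsub>R\<^esub>" for c
    proof (rule finsum_cong')
      fix xs assume "xs \<in> {xs. c xs \<noteq> \<zero>\<^bsub>R\<^esub>}"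
      then have "normal xs"
        using that(2) by auto
      then show "(if normal xs then c xs \<odot> monomial A \<xi> xs else \<zero>) = scalar A (c xs) \<otimes> monomial A \<xi> xs"
        using that(1) normal_subset by (simp add: scalar_mult)
    next
      show "(\<lambda>xs. scalar A (c xs) \<otimes> monomial A \<xi> xs) \<in> {xs. c xs \<noteq> \<zero>\<^bsub>R\<^esub>} \<rightarrow> carrier A"
      proof (rule Pi_I)
        fix xs assume "xs \<in> {xs. c xs \<noteq> \<zero>\<^bsub>R\<^esub>}"
        then have "normal xs"
          using that(2) by auto
        then show "scalar A (c xs) \<otimes> monomial A \<xi> xs \<in> carrier A"
          using that(1) normal_subset by simp
      qed
    qed (rule refl)
    then have "(\<forall>xs\<in>normal_words X \<delta> ord. c xs \<in> carrier R) \<and> (\<forall>xs. \<not> normal xs \<longrightarrow> c xs = \<zero>\<^bsub>R\<^esub>)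
        \<and> finite {xs. c xs \<noteq> \<zero>\<^bsub>R\<^esub>} \<and>
        u = (\<Oplus>xs\<in>{xs. c xs \<noteq> \<zero>\<^bsub>R\<^esub>}. if normal xs then c xs \<odot> monomial A \<xi> xs else \<zero>) \<longleftrightarrow>
      (\<forall>xs\<in>normal_words X \<delta> ord. c xs \<in> carrier R) \<and> (\<forall>xs. \<not> normal xs \<longrightarrow> c xs = \<zero>\<^bsub>R\<^esub>)
        \<and> finite {xs. c xs \<noteq> \<zero>\<^bsub>R\<^esub>} \<and> u = (\<Oplus>xs\<in>{xs. c xs \<noteq> \<zero>\<^bsub>R\<^esub>}. scalar A (c xs) \<otimes> monomial A \<xi> xs)" for c
      by auto
    then show ?thesis
      using monomial_basis[OF that] unfolding C conj_assoc by simp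
  qed
qed (use normal_subset smult_l_distr in \<open>auto split: if_splits\<close>)

text \<open>The value forced on a monomial by the Leibniz rule once each variable x is sent to
  \<open>t x\<close>. It is defined for all words, because concatenating two normal words need not
  give a normal one.\<close>

fun word_derivation :: "('v \<Rightarrow> 'c) \<Rightarrow> 'v list \<Rightarrow> 'c" where
  "word_derivation t [] = \<zero>"
| "word_derivation t (x # xs) =
     t x \<otimes> monomial A \<xi> xs \<oplus> signed A (int (\<delta> x)) (\<xi> x \<otimes> word_derivation t xs)"

end

text \<open>\<open>pos_degree\<close> keeps the natural-number subtraction in \<open>t_homog\<close>
  from truncating.\<close>

locale free_dga_values = free_dga +
  fixes t :: "'d \<Rightarrow> 'c"
  assumes pos_degree: "x \<in> X \<Longrightarrow> 1 \<le> \<delta> x"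
    and t_homog: "x \<in> X \<Longrightarrow> t x \<in> homog A (\<delta> x - 1)"
begin

abbreviation "D \<equiv> word_derivation t"

lemma t_carrier [simp, intro]: "x \<in> X \<Longrightarrow> t x \<in> carrier A"
  using t_homog by auto

lemma D_carrier [simp, intro]: "set xs \<subseteq> X \<Longrightarrow> D xs \<in> carrier A"
  by (induction xs) auto

lemma D_homog: "set xs \<subseteq> X \<Longrightarrow> xs \<noteq> [] \<Longrightarrow> D xs \<in> homog A (sum_list (map \<delta> xs) - 1)"
proof (induction xs)
  case (Cons x xs)
  have 1: "t x \<otimes> monomial A \<xi> xs \<in> homog A (\<delta> x - 1 + sum_list (map \<delta> xs))"
    using Cons.prems by (intro mult_comp t_homog monomial_homog) auto
  have 2: "\<xi> x \<otimes> D xs \<in> homog A (sum_list (map \<delta> (x # xs)) - 1)"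
  proof (cases xs)
    case (Cons y ys)
    then have "\<xi> x \<otimes> D xs \<in> homog A (\<delta> x + (sum_list (map \<delta> xs) - 1))"
      using Cons.prems Cons.IH by (auto intro!: mult_comp var_homog)
    then show ?thesis
      using pos_degree[of y] Cons Cons.prems by simp
  qed (use Cons.prems in auto)
  show ?case
    using 1 2 pos_degree[of x] Cons.prems by (auto intro!: homog_add homog_signed)
qed simp

lemma D_append:
  "\<lbrakk>set xs \<subseteq> X; set ys \<subseteq> X\<rbrakk> \<Longrightarrow>
    D (xs @ ys) = D xs \<otimes> monomial A \<xi> ys \<oplus> involution A (monomial A \<xi> xs) \<otimes> D ys"
proof (induction xs)
  case Nil
  then show ?case by (simp add: involution_one)
next
  case (Cons x xs)
  then show ?case
    using involution(2)[OF var_homog[of x]]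
    by (simp add: monomial_append l_distr r_distr m_assoc involution_mult
        signed_mult_left signed_add a_ac)
qed

text \<open>Word values obey the sign rule of monomials. Both sides of the second claim have three
  terms, according to whether x, y or the tail is differentiated; they match after exchanging two
  factors, with the signs compared for each pair of parities.\<close>

lemma swap:
  assumes [simp]: "x \<in> X" "y \<in> X" "set xs \<subseteq> X"
  shows "monomial A \<xi> (x # y # xs) = signed A (int (\<delta> x * \<delta> y)) (monomial A \<xi> (y # x # xs))"
    and "D (x # y # xs) = signed A (int (\<delta> x * \<delta> y)) (D (y # x # xs))"
proof -
  let ?m = "monomial A \<xi> xs"
  show "monomial A \<xi> (x # y # xs) = signed A (int (\<delta> x * \<delta> y)) (monomial A \<xi> (y # x # xs))"
    using mult_swap[OF var_homog var_homog, of x y ?m] by simp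
  obtain i j where ij: "\<delta> x = Suc i" "\<delta> y = Suc j"
    using pos_degree[of x] pos_degree[of y] assms by (metis Suc_le_D One_nat_def)
  have h: "t x \<in> homog A i" "t y \<in> homog A j" "\<xi> x \<in> homog A (Suc i)" "\<xi> y \<in> homog A (Suc j)"
    using t_homog[of x] t_homog[of y] var_homog[of x] var_homog[of y] ij by auto
  have a: "t x \<otimes> (\<xi> y \<otimes> ?m) = signed A (int (i * Suc j)) (\<xi> y \<otimes> (t x \<otimes> ?m))"
    "\<xi> x \<otimes> (t y \<otimes> ?m) = signed A (int (Suc i * j)) (t y \<otimes> (\<xi> x \<otimes> ?m))"
    "\<xi> x \<otimes> (\<xi> y \<otimes> D xs) = signed A (int (Suc i * Suc j)) (\<xi> y \<otimes> (\<xi> x \<otimes> D xs))"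
    by (intro mult_swap h; simp)+
  have e: "even (1 + int i + int (Suc i * j)) = even (int (Suc i * Suc j))"
    "even (int (Suc i * Suc j) + (1 + int j)) = even (int (i * Suc j))"
    by auto
  show "D (x # y # xs) = signed A (int (\<delta> x * \<delta> y)) (D (y # x # xs))"
    by (cases "even i"; cases "even j")
      (simp_all add: ij r_distr signed_add signed_mult_right a signed_even signed_odd minus_add a_ac r_minus)
qed

text \<open>For odd x the value \<open>t x\<close> has even degree and commutes with \<xi> x, so the
  terms differentiating one of the two copies cancel, and the third contains the square of \<xi> x.
  The exchange rule alone would only show that twice the value vanishes.\<close>

lemma odd_repeat:
  assumes [simp]: "x \<in> X" "set xs \<subseteq> X" and odd: "odd (\<delta> x)"
  shows "monomial A \<xi> (x # x # xs) = \<zero>" and "D (x # x # xs) = \<zero>"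
proof -
  have sq: "\<xi> x \<otimes> (\<xi> x \<otimes> v) = \<zero>" if "v \<in> carrier A" for v
    using odd_square[OF var_homog odd] that by (simp flip: m_assoc)
  show "monomial A \<xi> (x # x # xs) = \<zero>"
    by (simp add: sq)
  have "t x \<otimes> (\<xi> x \<otimes> monomial A \<xi> xs) = \<xi> x \<otimes> (t x \<otimes> monomial A \<xi> xs)"
    using mult_swap[OF t_homog[of x] var_homog[of x], of "monomial A \<xi> xs"] odd
    by (simp add: signed_even)
  then show "D (x # x # xs) = \<zero>"
    using odd by (simp add: signed_odd r_distr r_minus sq r_neg)
qed

lemma monomial_D_cong:
  assumes "x \<in> X" "set xs \<subseteq> X" "set ys \<subseteq> X"
    and "monomial A \<xi> xs = signed A k (monomial A \<xi> ys)" "D xs = signed A k (D ys)"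
  shows "monomial A \<xi> (x # xs) = signed A k (monomial A \<xi> (x # ys))"
    and "D (x # xs) = signed A k (D (x # ys))"
  using assms by (simp_all add: signed_mult_right signed_add add.commute)

text \<open>Sorting a word changes its monomial and the value \<^term>\<open>D\<close> on it by the same sign, or makes both
  zero; hence values on normal words determine a well-defined derivation.\<close>

definition normalizable :: "'d list \<Rightarrow> bool" where
  "normalizable xs \<longleftrightarrow> monomial A \<xi> xs = \<zero> \<and> D xs = \<zero> \<or>
     (\<exists>ys k. normal ys \<and> mset ys = mset xs \<and>
        monomial A \<xi> xs = signed A k (monomial A \<xi> ys) \<and> D xs = signed A k (D ys))"

lemma normalizable_trans:
  assumes "normalizable ys" "set xs \<subseteq> X" "set ys \<subseteq> X" "mset ys = mset xs"
    and "monomial A \<xi> xs = signed A k (monomial A \<xi> ys)" "D xs = signed A k (D ys)"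
  shows "normalizable xs"
  using assms(1) unfolding normalizable_def
proof (elim disjE exE conjE)
  fix zs l assume z: "normal zs" "mset zs = mset ys"
    "monomial A \<xi> ys = signed A l (monomial A \<xi> zs)" "D ys = signed A l (D zs)"
  then have "set zs \<subseteq> X" "mset zs = mset xs"
    using normal_subset assms by auto
  then have "monomial A \<xi> xs = signed A (k + l) (monomial A \<xi> zs) \<and> D xs = signed A (k + l) (D zs)"
    using assms z by simp
  then show "monomial A \<xi> xs = \<zero> \<and> D xs = \<zero> \<or> (\<exists>ys k. normal ys \<and> mset ys = mset xs \<and>
        monomial A \<xi> xs = signed A k (monomial A \<xi> ys) \<and> D xs = signed A k (D ys))"
    using z \<open>mset zs = mset xs\<close> by blast
qed (use assms in simp)

lemma normal_Cons:
  "normal (x # xs) \<longleftrightarrow> x \<in> X \<and> normal xs \<and> (\<forall>y\<in>set xs. (x, y) \<in> ord \<and> (x = y \<longrightarrow> even (\<delta> x)))"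
  by (auto simp: normal_words_def)

lemma ord_facts:
  "\<lbrakk>(x, y) \<in> ord; (y, z) \<in> ord\<rbrakk> \<Longrightarrow> (x, z) \<in> ord"
  "\<lbrakk>(x, y) \<in> ord; (y, x) \<in> ord\<rbrakk> \<Longrightarrow> x = y"
  "x \<in> X \<Longrightarrow> (x, x) \<in> ord"
  "\<lbrakk>x \<in> X; y \<in> X\<rbrakk> \<Longrightarrow> (x, y) \<in> ord \<or> (y, x) \<in> ord"
  using linear_ord
  unfolding linear_order_on_def partial_order_on_def preorder_on_def
  by (auto simp: total_on_def antisym_def refl_on_def elim: transE) metis

text \<open>The inner step of insertion sort. Either x repeats an odd letter and everything
  vanishes, or x may stay in front, or x moves past the first letter at the cost of a sign.\<close>

lemma normalizable_insert:
  "\<lbrakk>x \<in> X; normal xs\<rbrakk> \<Longrightarrow> normalizable (x # xs)"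
proof (induction xs)
  case Nil
  have "normal [x]"
    using Nil by (simp add: normal_words_def)
  then show ?case
    unfolding normalizable_def by (intro disjI2 exI[of _ "[x]"] exI[of _ 0]) (simp add: signed_def)
next
  case (Cons y xs)
  have y: "y \<in> X" "normal xs" "\<And>z. z \<in> set xs \<Longrightarrow> (y, z) \<in> ord \<and> (y = z \<longrightarrow> even (\<delta> y))"
    using Cons.prems by (auto simp: normal_Cons)
  have xs: "set xs \<subseteq> X"
    using normal_subset y by blast
  consider "x = y" "odd (\<delta> x)" | "(x, y) \<in> ord" "x = y \<longrightarrow> even (\<delta> x)" | "(y, x) \<in> ord" "x \<noteq> y"
    using ord_facts(3,4) Cons.prems y by blast
  then show ?case
  proof cases
    case 1
    then show ?thesis
      unfolding normalizable_def using odd_repeat Cons.prems xs by blast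
  next
    case 2
    have "normal (x # y # xs)"
      using 2 Cons.prems y ord_facts(1,2)
      by (subst normal_Cons) (use y(3) ord_facts(1,2) in \<open>fastforce\<close>)
    then show ?thesis
      unfolding normalizable_def by (intro disjI2 exI[of _ "x # y # xs"] exI[of _ 0]) (simp add: signed_def)
  next
    case 3
    \<comment> \<open>The tail with x inserted is sorted by induction. Sorting preserves the
      letters, so y still lies below all of them and may be put back in front.\<close>
    have "normalizable (x # xs)"
      using Cons y by blast
    then have "normalizable (y # x # xs)"
    proof (subst (asm) normalizable_def, elim disjE exE conjE)
      assume "monomial A \<xi> (x # xs) = \<zero>" "D (x # xs) = \<zero>"
      then have "monomial A \<xi> (y # x # xs) = \<zero>" "D (y # x # xs) = \<zero>"
        using y(1) Cons.prems(1) xs by (auto simp del: word_derivation.simps(2) monomial_Cons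
            simp: monomial_Cons[of y] word_derivation.simps(2)[of t y])
      then show ?thesis
        unfolding normalizable_def by blast
    next
      fix zs k assume z: "normal zs" "mset zs = mset (x # xs)"
        "monomial A \<xi> (x # xs) = signed A k (monomial A \<xi> zs)" "D (x # xs) = signed A k (D zs)"
      have sz: "set zs = insert x (set xs)"
        using mset_eq_setD[OF z(2)] by simp
      have "normal (y # zs)"
        using z(1) y 3 sz by (auto simp: normal_Cons)
      moreover have "monomial A \<xi> (y # x # xs) = signed A k (monomial A \<xi> (y # zs))"
        "D (y # x # xs) = signed A k (D (y # zs))"
        by (rule monomial_D_cong; use y(1) Cons.prems(1) xs sz z in auto)+
      ultimately show ?thesis
        unfolding normalizable_def using z(2)
        by (intro disjI2 exI[of _ "y # zs"] exI[of _ k]) simp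
    qed
    then show ?thesis
      by (rule normalizable_trans[OF _ _ _ _ swap]) (use Cons.prems y xs in auto)
  qed
qed

lemma normalizable: "set xs \<subseteq> X \<Longrightarrow> normalizable xs"
proof (induction xs)
  case Nil
  have "normal []"
    by (simp add: normal_words_def)
  then show ?case
    unfolding normalizable_def by (intro disjI2 exI[of _ "[]"] exI[of _ 0]) (simp add: signed_def)
next
  case (Cons x xs)
  then have "normalizable xs"
    by simp
  then show ?case
  proof (subst (asm) normalizable_def, elim disjE exE conjE)
    assume "monomial A \<xi> xs = \<zero>" "D xs = \<zero>"
    then show ?thesis
      unfolding normalizable_def using Cons.prems by simp
  next
    fix ys k assume y: "normal ys" "mset ys = mset xs"
      "monomial A \<xi> xs = signed A k (monomial A \<xi> ys)" "D xs = signed A k (D ys)"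
    have "set ys \<subseteq> X"
      using y normal_subset by blast
    then have "monomial A \<xi> (x # xs) = signed A k (monomial A \<xi> (x # ys))"
      "D (x # xs) = signed A k (D (x # ys))"
      using monomial_D_cong[of x xs ys k] Cons.prems y by auto
    then show ?thesis
      using normalizable_trans[OF normalizable_insert[of x ys], of "x # xs" k] y Cons.prems \<open>set ys \<subseteq> X\<close>
      by (simp del: monomial_Cons word_derivation.simps)
  qed
qed

end

lemma (in module) smult_left_commute:
  "\<lbrakk>r \<in> carrier R; s \<in> carrier R; u \<in> carrier M\<rbrakk> \<Longrightarrow> r \<odot>\<^bsub>M\<^esub> (s \<odot>\<^bsub>M\<^esub> u) = s \<odot>\<^bsub>M\<^esub> (r \<odot>\<^bsub>M\<^esub> u)"
  by (simp add: R.m_comm flip: smult_assoc1)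

context free_dga
begin

text \<open>The monomial case ranges over arbitrary words, in step with word formulas that do not
  depend on sorting. The zero element is the scalar 0 times the empty word.\<close>

lemma monomial_induct [consumes 1, case_names monomial add]:
  assumes "u \<in> carrier A"
    and m: "\<And>r xs. \<lbrakk>r \<in> carrier R; set xs \<subseteq> X\<rbrakk> \<Longrightarrow> P (r \<odot> monomial A \<xi> xs)"
    and "\<And>u v. \<lbrakk>u \<in> carrier A; v \<in> carrier A; P u; P v\<rbrakk> \<Longrightarrow> P (u \<oplus> v)"
  shows "P u"
  using assms(1)
proof (induction rule: M.decomposed_induct)
  case zero
  then show ?case
    using m[of "\<zero>\<^bsub>R\<^esub>" "[]"] by simp
next
  case (summand xs r)
  then show ?case
    using m[of r xs] m[of "\<zero>\<^bsub>R\<^esub>" "[]"] normal_subset[of xs] by (cases "normal xs") auto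
qed (use assms in auto)

lemma generated_by_variables: "carrier A \<subseteq> generate_ring A (scalar A ` carrier R \<union> \<xi> ` X)"
proof
  fix u assume "u \<in> carrier A"
  then show "u \<in> generate_ring A (scalar A ` carrier R \<union> \<xi> ` X)"
  proof (induction rule: monomial_induct)
    case (monomial r xs)
    have "monomial A \<xi> xs \<in> generate_ring A (scalar A ` carrier R \<union> \<xi> ` X)"
      using monomial(2) by (induction xs) (auto intro: generate_ring.intros)
    then have "scalar A r \<otimes> monomial A \<xi> xs \<in> generate_ring A (scalar A ` carrier R \<union> \<xi> ` X)"
      using monomial(1) by (auto intro: generate_ring.intros)
    then show ?case
      using monomial by (simp add: scalar_mult)
  qed (rule generate_ring.intros)
qed

end

text \<open>An additive map can be prescribed freely on the basis of normal words. Once it is known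
  to be given by \<open>D\<close> on every word, linearity is immediate and the Leibniz rule reduces
  to the formula for a concatenation.\<close>

lemma (in free_dga_values) derivation_exists:
  "\<exists>\<theta>. odd_derivation R A \<theta> \<and> (\<forall>x\<in>X. \<theta> (\<xi> x) = t x)"
proof -
  obtain h where h: "h \<in> add_hom A A"
    and h_normal: "\<And>xs r. \<lbrakk>normal xs; r \<in> carrier R\<rbrakk> \<Longrightarrow> h (r \<odot> monomial A \<xi> xs) = r \<odot> D xs"
  proof -
    have "\<exists>h\<in>add_hom A A. \<forall>xs. \<forall>r\<in>(if normal xs then carrier R else {\<zero>\<^bsub>R\<^esub>}).
        h (if normal xs then r \<odot> monomial A \<xi> xs else \<zero>) = (if normal xs then r \<odot> D xs else \<zero>)"
      by (rule M.extend_additive[OF is_abelian]) (use normal_subset smult_l_distr in \<open>auto split: if_splits\<close>)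
    then obtain h where h: "h \<in> add_hom A A"
      and eq: "\<forall>xs. \<forall>r\<in>(if normal xs then carrier R else {\<zero>\<^bsub>R\<^esub>}).
        h (if normal xs then r \<odot> monomial A \<xi> xs else \<zero>) = (if normal xs then r \<odot> D xs else \<zero>)"
      by blast
    show ?thesis
    proof (rule that[OF h])
      fix xs r assume "normal xs" "r \<in> carrier R"
      then show "h (r \<odot> monomial A \<xi> xs) = r \<odot> D xs"
        using spec[OF eq, of xs] by simp
    qed
  qed
  note h_rules = add_rules[OF h]
  \<comment> \<open>A word and its sorted form have monomials and values related by the same sign,
    or else both its monomial and its value vanish; so the formula passes from normal words to all
    words.\<close>
  have h_mono: "h (r \<odot> monomial A \<xi> xs) = r \<odot> D xs" if r: "r \<in> carrier R" and xs: "set xs \<subseteq> X" for r xs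
    using normalizable[OF xs] unfolding normalizable_def
  proof (elim disjE exE conjE)
    fix ys k assume y: "normal ys" "monomial A \<xi> xs = signed A k (monomial A \<xi> ys)" "D xs = signed A k (D ys)"
    have [simp]: "set ys \<subseteq> X"
      using y normal_subset by blast
    show ?thesis
      using r h_normal[OF y(1) r] h_rules(4) by (auto simp: y(2,3) signed_def smult_r_minus)
  qed (use r h_rules(3) in simp)
  have linear: "h (r \<odot> u) = r \<odot> h u" if "r \<in> carrier R" "u \<in> carrier A" for r u
    using that(2)
  proof (induction rule: monomial_induct)
    case (monomial s xs)
    then show ?case
      using that(1) by (simp add: h_mono flip: smult_assoc1)
  qed (use that(1) h_rules in \<open>simp add: smult_r_distr\<close>)
  have mult: "h (u \<otimes> v) = h u \<otimes> v \<oplus> involution A u \<otimes> h v" if u: "u \<in> carrier A" and v: "v \<in> carrier A" for u v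
    using u
  proof (induction rule: monomial_induct)
    case (monomial r xs)
    show ?case
      using v
    proof (induction rule: monomial_induct)
      case (monomial s ys)
      have "h ((r \<odot> monomial A \<xi> xs) \<otimes> (s \<odot> monomial A \<xi> ys))
          = h (r \<odot> (s \<odot> monomial A \<xi> (xs @ ys)))"
        using monomial \<open>r \<in> carrier R\<close> \<open>set xs \<subseteq> X\<close>
        using smult_left_commute[of r s "monomial A \<xi> (xs @ ys)"]
        by (simp add: smult_mult_left smult_mult_right monomial_append)
      also have "\<dots> = r \<odot> (s \<odot> D (xs @ ys))"
        using monomial \<open>r \<in> carrier R\<close> \<open>set xs \<subseteq> X\<close>
        by (subst linear) (simp_all add: h_mono)
      finally show ?case
        using monomial \<open>r \<in> carrier R\<close> \<open>set xs \<subseteq> X\<close>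
        by (simp add: smult_left_commute[of r s] D_append h_mono smult_mult_left smult_mult_right smult_r_distr involution_smult)
    next
      case (add v w)
      then show ?case
        using monomial h_rules by (simp add: r_distr a_ac)
    qed
  next
    case (add u w)
    then show ?case
      using v h_rules by (simp add: l_distr involution_add a_ac)
  qed
  let ?S = "{r \<odot> monomial A \<xi> xs | r xs. r \<in> carrier R \<and> set xs \<subseteq> X}"
  have deg: "u \<in> homog A 0 \<Longrightarrow> h u = \<zero>" "u \<in> homog A (Suc i) \<Longrightarrow> h u \<in> homog A i" for u i
  proof -
    have span: "carrier A \<subseteq> generate (add_monoid A) ?S"
    proof
      fix u assume "u \<in> carrier A"
      then show "u \<in> generate (add_monoid A) ?S"
      proof (induction rule: monomial_induct)
        case (monomial r xs)
        then show ?case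
          by (intro generate.incl) blast
      next
        case (add u v)
        then show ?case
          using generate.eng[of u "add_monoid A" ?S v] by simp
      qed
    qed
    have gen: "\<exists>i. g \<in> homog A i \<and> (i = 0 \<longrightarrow> h g = \<zero>) \<and> h g \<in> homog A (i - 1)" if g_in: "g \<in> ?S" for g
    proof -
      obtain r xs where g: "g = r \<odot> monomial A \<xi> xs" "r \<in> carrier R" "set xs \<subseteq> X"
        using g_in by blast
      show ?thesis
      proof (intro exI conjI)
        show "g \<in> homog A (sum_list (map \<delta> xs))"
          using g by (simp add: homog_smult monomial_homog)
        show "h g \<in> homog A (sum_list (map \<delta> xs) - 1)"
          using g D_homog[OF g(3)] h_mono[OF g(2,3)] by (cases "xs = []") (auto simp: homog_smult)
        show "sum_list (map \<delta> xs) = 0 \<longrightarrow> h g = \<zero>"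
        proof (cases xs)
          case Nil
          then show ?thesis
            using g h_mono[OF g(2,3)] by simp
        next
          case (Cons x ys)
          then show ?thesis
            using g pos_degree[of x] by simp
        qed
      qed
    qed
    show "u \<in> homog A 0 \<Longrightarrow> h u = \<zero>" "u \<in> homog A (Suc i) \<Longrightarrow> h u \<in> homog A i"
      by (rule lowers_degree[OF h span gen], assumption+)+
  qed
  have "odd_derivation R A h"
    by unfold_locales (use h linear deg mult in auto)
  moreover have "h (\<xi> x) = t x" if "x \<in> X" for x
    using h_mono[of "\<one>\<^bsub>R\<^esub>" "[x]"] that by simp
  ultimately show ?thesis
    by blast
qed

section \<open>The conormal module\<close>

locale conormal_module = ideal I R + cring R for I and R (structure)
begin

abbreviation "cls u \<equiv> ideal_prod R I I +> u"
abbreviation "M \<equiv> conormal R I"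

lemma square_ideal: "ideal (ideal_prod R I I) R"
  using ideal_prod_is_ideal is_ideal by blast

lemma cls_eq_iff: "\<lbrakk>u \<in> carrier R; v \<in> carrier R\<rbrakk> \<Longrightarrow> cls u = cls v \<longleftrightarrow> u \<ominus> v \<in> ideal_prod R I I"
  using quotient_eq_iff_same_a_r_cos[OF square_ideal] by blast

lemma carrier_conormal: "carrier M = cls ` I"
  by (simp add: conormal_def)

lemma cls_carrier: "u \<in> I \<Longrightarrow> cls u \<in> carrier M"
  by (simp add: carrier_conormal)

lemma cls_add: "\<lbrakk>u \<in> I; v \<in> I\<rbrakk> \<Longrightarrow> cls u \<oplus>\<^bsub>M\<^esub> cls v = cls (u \<oplus> v)"
  using abelian_subgroup.a_rcos_sum[OF abelian_subgroupI3[OF ideal.axioms(1)[OF square_ideal] is_abelian_group]]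
  by (simp add: conormal_def Icarr)

lemma zero_conormal: "\<zero>\<^bsub>M\<^esub> = cls \<zero>"
  using additive_subgroup.a_subset[OF ideal.axioms(1)[OF square_ideal]]
  by (simp add: conormal_def)

text \<open>The scalar action in \<open>conormal\<close> is a union over all representatives, so it
  has to be seen that they all yield one coset: for h in I and j in the square of I, (h + r)(j + u)
  - ru = (h + r)j + hu again lies in the square.\<close>

lemma cls_smult:
  assumes r: "r \<in> carrier R" and u: "u \<in> I"
  shows "(I +> r) \<odot>\<^bsub>M\<^esub> cls u = cls (r \<otimes> u)"
proof -
  let ?J = "ideal_prod R I I"
  have uR: "u \<in> carrier R"
    using u by (rule Icarr)
  have J: "ideal ?J R"
    by (rule square_ideal)
  have eq: "cls (r' \<otimes> u') = cls (r \<otimes> u)" if r': "r' \<in> I +> r" and u': "u' \<in> cls u" for r' u'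
  proof -
    obtain h where h: "h \<in> I" "r' = h \<oplus> r"
      using r' by (auto simp: a_r_coset_def')
    obtain j where j: "j \<in> ?J" "u' = j \<oplus> u"
      using u' by (auto simp: a_r_coset_def')
    have c: "h \<in> carrier R" "j \<in> carrier R"
      using h j Icarr ideal.Icarr[OF J] by auto
    have "(h \<oplus> r) \<otimes> (j \<oplus> u) \<ominus> r \<otimes> u = (h \<oplus> r) \<otimes> j \<oplus> h \<otimes> u"
      using c r uR by algebra
    moreover have "(h \<oplus> r) \<otimes> j \<in> ?J"
      using ideal.I_l_closed[OF J j(1)] c r by simp
    moreover have "h \<otimes> u \<in> ?J"
      using h u by (intro ideal_prod.prod)
    ultimately have "r' \<otimes> u' \<ominus> r \<otimes> u \<in> ?J"
      unfolding h j using additive_subgroup.a_closed[OF ideal.axioms(1)[OF J]] by simp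
    then show ?thesis
      using cls_eq_iff[of "r' \<otimes> u'" "r \<otimes> u"] h j c r uR by simp
  qed
  have "r \<in> I +> r" "u \<in> cls u"
    using a_rcos_self[OF r] abelian_subgroup.a_rcos_self[OF abelian_subgroupI3[OF ideal.axioms(1)[OF J] is_abelian_group] uR] by auto
  then have "(\<Union>r'\<in>I +> r. \<Union>u'\<in>cls u. cls (r' \<otimes> u')) = cls (r \<otimes> u)"
    using eq by blast
  then show ?thesis
    by (simp add: conormal_def)
qed

lemma conormal_abelian: "abelian_monoid M"
proof (rule abelian_monoidI)
  fix p q s
  show "\<zero>\<^bsub>M\<^esub> \<in> carrier M"
    by (simp add: zero_conormal carrier_conormal)
  assume "p \<in> carrier M" "q \<in> carrier M"
  then obtain u v where u: "u \<in> I" "p = cls u" and v: "v \<in> I" "q = cls v"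
    by (auto simp: carrier_conormal)
  then show "p \<oplus>\<^bsub>M\<^esub> q \<in> carrier M"
    by (simp add: cls_add cls_carrier)
  show "p \<oplus>\<^bsub>M\<^esub> q = q \<oplus>\<^bsub>M\<^esub> p"
    using u v by (simp add: cls_add a_comm Icarr)
  show "\<zero>\<^bsub>M\<^esub> \<oplus>\<^bsub>M\<^esub> p = p"
    using u by (simp add: zero_conormal cls_add Icarr)
  assume "s \<in> carrier M"
  then obtain w where "w \<in> I" "s = cls w"
    by (auto simp: carrier_conormal)
  then show "p \<oplus>\<^bsub>M\<^esub> q \<oplus>\<^bsub>M\<^esub> s = p \<oplus>\<^bsub>M\<^esub> (q \<oplus>\<^bsub>M\<^esub> s)"
    using u v by (simp add: cls_add a_assoc Icarr)
qed

lemma ideal_finsum: "(\<And>k. k \<in> K \<Longrightarrow> f k \<in> I) \<Longrightarrow> (\<Oplus>k\<in>K. f k) \<in> I"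
proof (induction K rule: infinite_finite_induct)
  case (insert k K)
  then show ?case
    by (subst finsum_insert) (auto intro: Icarr)
qed auto

lemma cls_finsum:
  assumes "finite K" "\<And>k. k \<in> K \<Longrightarrow> r k \<in> carrier R" "\<And>k. k \<in> K \<Longrightarrow> g k \<in> I"
  shows "cls (\<Oplus>k\<in>K. r k \<otimes> g k) = (\<Oplus>\<^bsub>M\<^esub>k\<in>K. (I +> r k) \<odot>\<^bsub>M\<^esub> cls (g k))"
  using assms
proof (induction K)
  case empty
  interpret M: abelian_monoid M
    by (rule conormal_abelian)
  show ?case
    by (simp add: zero_conormal)
next
  case (insert k K)
  interpret M: abelian_monoid M
    by (rule conormal_abelian)
  have sm: "(I +> r l) \<odot>\<^bsub>M\<^esub> cls (g l) = cls (r l \<otimes> g l)" "r l \<otimes> g l \<in> I" if "l \<in> insert k K" for l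
    using insert.prems that by (auto simp: cls_smult intro: I_l_closed)
  have "(\<Oplus>k\<in>insert k K. r k \<otimes> g k) = r k \<otimes> g k \<oplus> (\<Oplus>k\<in>K. r k \<otimes> g k)"
    using insert.hyps sm(2) Icarr by (intro finsum_insert) auto
  moreover have "(\<Oplus>\<^bsub>M\<^esub>k\<in>insert k K. (I +> r k) \<odot>\<^bsub>M\<^esub> cls (g k)) =
      (I +> r k) \<odot>\<^bsub>M\<^esub> cls (g k) \<oplus>\<^bsub>M\<^esub> (\<Oplus>\<^bsub>M\<^esub>k\<in>K. (I +> r k) \<odot>\<^bsub>M\<^esub> cls (g k))"
    using insert.hyps sm cls_carrier by (intro M.finsum_insert) auto
  ultimately show ?case
    using insert sm ideal_finsum[of K "\<lambda>k. r k \<otimes> g k"] by (simp flip: cls_add)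
qed

lemma quot_carrier: "r \<in> carrier R \<Longrightarrow> I +> r \<in> carrier (R Quot I)"
  by (simp add: FactRing_def a_rcosetsI[OF a_subset])

lemma submodule_finsum:
  assumes N: "submodule N (R Quot I) M" and "finite K"
    and "\<And>k. k \<in> K \<Longrightarrow> r k \<in> carrier R" "\<And>k. k \<in> K \<Longrightarrow> g k \<in> I" "\<And>k. k \<in> K \<Longrightarrow> cls (g k) \<in> N"
  shows "cls (\<Oplus>k\<in>K. r k \<otimes> g k) \<in> N"
proof -
  interpret M: abelian_monoid M
    by (rule conormal_abelian)
  have sub: "subgroup N (add_monoid M)"
    using N by (rule submodule.axioms(1))
  have sm: "(I +> r l) \<odot>\<^bsub>M\<^esub> cls (g l) \<in> N" if "l \<in> K" for l
    using submodule.smult_closed[OF N quot_carrier] assms that by auto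
  have NM: "N \<subseteq> carrier M"
    using subgroup.subset[OF sub] by simp
  have "(\<Oplus>\<^bsub>M\<^esub>k\<in>K. (I +> r k) \<odot>\<^bsub>M\<^esub> cls (g k)) \<in> N"
    using \<open>finite K\<close> sm
  proof (induction K)
    case empty
    then show ?case
      using subgroup.one_closed[OF sub] by simp
  next
    case (insert k K)
    then show ?case
      using subgroup.m_closed[OF sub] NM by (subst M.finsum_insert) auto
  qed
  then show ?thesis
    using cls_finsum[OF \<open>finite K\<close>, of r g] assms by simp
qed

text \<open>The first sum represents an element of \<open>F\<close>, the second one of \<open>C\<close>, and \<open>F \<inter> C = 0\<close>.\<close>

lemma syzygy_coefficient:
  assumes sum: "module_direct_sum (R Quot I) M F C"
    and basis: "module_basis (R Quot I) M F L (\<lambda>i. cls (a i))"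
    and a: "\<And>i. i \<in> L \<Longrightarrow> a i \<in> I" and r: "\<And>i. i \<in> L \<Longrightarrow> r i \<in> carrier R"
    and K: "finite K" and g: "\<And>k. k \<in> K \<Longrightarrow> g k \<in> I" "\<And>k. k \<in> K \<Longrightarrow> cls (g k) \<in> C"
    and s: "\<And>k. k \<in> K \<Longrightarrow> s k \<in> carrier R"
    and syz: "(\<Oplus>i\<in>L. r i \<otimes> a i) \<oplus> (\<Oplus>k\<in>K. s k \<otimes> g k) = \<zero>"
    and i: "i \<in> L"
  shows "r i \<in> I"
proof -
  have L: "finite L" and F: "submodule F (R Quot I) M" and C: "submodule C (R Quot I) M"
    and FC: "F \<inter> C = {\<zero>\<^bsub>M\<^esub>}" and aF: "\<And>i. i \<in> L \<Longrightarrow> cls (a i) \<in> F"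
    using sum basis by (auto simp: module_direct_sum_def module_basis_def)
  let ?t = "\<Oplus>i\<in>L. r i \<otimes> a i"
  have tF: "cls ?t \<in> F"
    by (rule submodule_finsum[OF F L]) (use r a aF in auto)
  \<comment> \<open>The relation identifies the first sum with the negative of the second, which is
    again a combination of the \<open>g k\<close>. So the class of the first sum lies in C as well
    as in F.\<close>
  have "(\<Oplus>k\<in>K. s k \<otimes> g k) \<oplus> (\<Oplus>k\<in>K. \<ominus> s k \<otimes> g k) = (\<Oplus>k\<in>K. \<zero>)"
  proof -
    have "(\<Oplus>k\<in>K. s k \<otimes> g k) \<oplus> (\<Oplus>k\<in>K. \<ominus> s k \<otimes> g k) = (\<Oplus>k\<in>K. s k \<otimes> g k \<oplus> \<ominus> s k \<otimes> g k)"
      using s g Icarr by (intro finsum_addf[symmetric]) auto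
    also have "\<dots> = (\<Oplus>k\<in>K. \<zero>)"
      using s g Icarr by (intro finsum_cong') (auto simp: l_minus r_neg)
    finally show ?thesis .
  qed
  then have "\<ominus> (\<Oplus>k\<in>K. s k \<otimes> g k) = (\<Oplus>k\<in>K. \<ominus> s k \<otimes> g k)"
    using s g Icarr by (intro minus_equality) (auto intro!: finsum_closed simp: a_comm)
  moreover have "\<ominus> (\<Oplus>k\<in>K. s k \<otimes> g k) = ?t"
    using syz r a s g Icarr by (intro minus_equality) (auto intro!: finsum_closed)
  ultimately have "?t = (\<Oplus>k\<in>K. \<ominus> s k \<otimes> g k)"
    by simp
  moreover have "cls (\<Oplus>k\<in>K. \<ominus> s k \<otimes> g k) \<in> C"
    by (rule submodule_finsum[OF C K]) (use s g in auto)
  ultimately have t0: "cls ?t = \<zero>\<^bsub>M\<^esub>"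
    using tF FC by auto
  \<comment> \<open>The residues of the \<open>r i\<close> and the zero family both express the zero
    class in the basis of F, and uniqueness equates them. Both are restricted to L, since uniqueness
    is stated for extensional functions.\<close>
  define c where "c = (\<lambda>i\<in>L. I +> r i)"
  define d where "d = (\<lambda>i\<in>L. I +> \<zero>)"
  interpret M: abelian_monoid M
    by (rule conormal_abelian)
  have sm: "(I +> p) \<odot>\<^bsub>M\<^esub> cls (a i) \<in> carrier M" if "i \<in> L" "p \<in> carrier R" for i p
    using a that by (auto simp: cls_smult intro!: cls_carrier I_l_closed)
  have "(\<Oplus>\<^bsub>M\<^esub>i\<in>L. c i \<odot>\<^bsub>M\<^esub> cls (a i)) = (\<Oplus>\<^bsub>M\<^esub>i\<in>L. (I +> r i) \<odot>\<^bsub>M\<^esub> cls (a i))"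
    using sm r by (intro M.finsum_cong') (auto simp: c_def)
  also have "\<dots> = \<zero>\<^bsub>M\<^esub>"
    using cls_finsum[OF L, of r a] r a t0 by simp
  finally have c0: "\<zero>\<^bsub>M\<^esub> = (\<Oplus>\<^bsub>M\<^esub>i\<in>L. c i \<odot>\<^bsub>M\<^esub> cls (a i))"
    by simp
  have "(\<Oplus>\<^bsub>M\<^esub>i\<in>L. d i \<odot>\<^bsub>M\<^esub> cls (a i)) = (\<Oplus>\<^bsub>M\<^esub>i\<in>L. \<zero>\<^bsub>M\<^esub>)"
    using sm a cls_smult[of \<zero>] cls_carrier[of \<zero>] Icarr by (intro M.finsum_cong') (auto simp: d_def zero_conormal)
  then have d0: "\<zero>\<^bsub>M\<^esub> = (\<Oplus>\<^bsub>M\<^esub>i\<in>L. d i \<odot>\<^bsub>M\<^esub> cls (a i))"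
    by simp
  have "c \<in> L \<rightarrow>\<^sub>E carrier (R Quot I)" "d \<in> L \<rightarrow>\<^sub>E carrier (R Quot I)"
    using r quot_carrier[of \<zero>] by (auto simp: c_def d_def intro: quot_carrier)
  moreover have "\<exists>!c. c \<in> L \<rightarrow>\<^sub>E carrier (R Quot I) \<and> \<zero>\<^bsub>M\<^esub> = (\<Oplus>\<^bsub>M\<^esub>i\<in>L. c i \<odot>\<^bsub>M\<^esub> cls (a i))"
    using basis t0 tF by (auto simp: module_basis_def)
  ultimately have "c = d"
    using c0 d0 by blast
  then have "I +> r i = I +> \<zero>"
    using i by (auto simp: c_def d_def dest: fun_cong[of _ _ i])
  then have "r i \<ominus> \<zero> \<in> I"
    using quotient_eq_iff_same_a_r_cos[OF is_ideal r[OF i], of \<zero>] by simp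
  then show ?thesis
    using r[OF i] by (simp add: a_minus_def)
qed

end

section \<open>Chain derivations of semi-free algebras\<close>

text \<open>The classes of u and of 0 have the same image, so they agree by injectivity on homology.
  Writing the hypothesis as \<open>f u = f \<zero>\<close> avoids any algebraic assumption on the
  target.\<close>

lemma (in dga) quasi_iso_boundary:
  assumes f: "quasi_iso R A B f" and u: "u \<in> homog A i" "diff A u = \<zero>" and fu: "f u = f \<zero>"
  shows "\<exists>w \<in> homog A (Suc i). diff A w = u"
proof -
  have hom: "f (v \<oplus> w) = f v \<oplus>\<^bsub>B\<^esub> f w" if "v \<in> carrier A" "w \<in> carrier A" for v w
    using f that by (auto simp: quasi_iso_def dga_hom_def ring_hom_add)
  have inj: "inj_on (\<lambda>U. boundaries B i <+>\<^bsub>B\<^esub> f ` U) (homology A i)"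
    using f by (auto simp: quasi_iso_def bij_betw_def)
  have bd: "b \<in> carrier A" if "b \<in> boundaries A i" for b
    using that by (auto simp: boundaries_def)
  have "f (b \<oplus> u) = f (b \<oplus> \<zero>)" if "b \<in> boundaries A i" for b
    using hom[of b u] hom[of b \<zero>] bd[OF that] u fu by simp
  then have "f ` (boundaries A i +> u) = f ` (boundaries A i +> \<zero>)"
    unfolding a_r_coset_def' by (force simp: image_iff)
  moreover have "boundaries A i +> v \<in> homology A i" if "v \<in> {u, \<zero>}" for v
    using that u by (auto simp: homology_def cycles_def)
  ultimately have "boundaries A i +> u = boundaries A i +> \<zero>"
    using inj by (auto simp: inj_on_def)
  moreover have "u \<in> boundaries A i +> u"
  proof -
    have "\<zero> \<in> boundaries A i"
      using diff_zero homog_zero[of "Suc i"] unfolding boundaries_def by (metis imageI)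
    then show ?thesis
      using u unfolding a_r_coset_def' by force
  qed
  ultimately obtain b where "b \<in> boundaries A i" "u = b \<oplus> \<zero>"
    unfolding a_r_coset_def' by blast
  then show ?thesis
    using bd by (auto simp: boundaries_def)
qed

context free_dga
begin

text \<open>A scalar is recovered as the coefficient of the empty word.\<close>

lemma scalar_inj: "inj_on (scalar A) (carrier R)"
proof (rule inj_onI)
  fix r s assume r: "r \<in> carrier R" "s \<in> carrier R" and eq: "scalar A r = scalar A s"
  have "normal []"
    by (simp add: normal_words_def)
  then have *: "M.coef (scalar A p) [] = p" if "p \<in> carrier R" for p
    using M.coef_e[of p "[]"] that by (simp add: scalar_def)
  show "r = s"
    using *[OF r(1)] *[OF r(2)] unfolding eq by simp
qed

text \<open>As all variables have positive degree, a monomial of degree 1 is a single variable of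
  degree 1.\<close>

lemma degree_one_expansion:
  assumes pos: "\<And>x. x \<in> X \<Longrightarrow> 1 \<le> \<delta> x" and u: "u \<in> homog A (Suc 0)"
  shows "\<exists>K r. finite K \<and> K \<subseteq> {x \<in> X. \<delta> x = 1} \<and> (\<forall>x. r x \<in> carrier R) \<and> (\<forall>x. x \<notin> K \<longrightarrow> r x = \<zero>\<^bsub>R\<^esub>) \<and>
    u = (\<Oplus>x\<in>K. r x \<odot> \<xi> x)"
proof -
  \<comment> \<open>The induction over monomials leaves degree 1, so the claim is made about the
    degree-one component of an arbitrary element.\<close>
  let ?P = "\<lambda>u K r. finite K \<and> K \<subseteq> {x \<in> X. \<delta> x = 1} \<and> (\<forall>x. r x \<in> carrier R) \<and>
    (\<forall>x. x \<notin> K \<longrightarrow> r x = \<zero>\<^bsub>R\<^esub>) \<and> G.coef u (Suc 0) = (\<Oplus>x\<in>K. r x \<odot> \<xi> x)"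
  have "u \<in> carrier A"
    using u by auto
  then have "\<exists>K r. ?P u K r"
  proof (induction rule: monomial_induct)
    case (monomial r xs)
    show ?case
    proof (cases "sum_list (map \<delta> xs) = 1")
      case True
      then obtain x ys where xs: "xs = x # ys"
        by (cases xs) auto
      moreover have "ys = []"
      proof (cases ys)
        case (Cons y zs)
        then show ?thesis
          using True xs pos[of x] pos[of y] monomial by simp
      qed simp
      ultimately have "xs = [x]" "x \<in> X" "\<delta> x = 1"
        using True monomial by auto
      then have "?P (r \<odot> monomial A \<xi> xs) {x} (\<lambda>y. if y = x then r else \<zero>\<^bsub>R\<^esub>)"
        using monomial coef_homog[OF homog_smult[OF monomial(1) var_homog[of x]], of "Suc 0"]
        by (simp add: finsum_insert)
      then show ?thesis
        by (intro exI)
    next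
      case False
      then have "?P (r \<odot> monomial A \<xi> xs) {} (\<lambda>_. \<zero>\<^bsub>R\<^esub>)"
        using coef_homog[OF homog_smult[OF monomial(1) monomial_homog[OF monomial(2)]], of "Suc 0"] by simp
      then show ?thesis
        by (intro exI)
    qed
  next
    case (add u v)
    obtain K r where K: "?P u K r"
      using add(3) by (elim exE)
    obtain L s where L: "?P v L s"
      using add(4) by (elim exE)
    have KL: "x \<in> X" if "x \<in> K \<union> L" for x
      using K L that by blast
    have "(\<Oplus>x\<in>K. r x \<odot> \<xi> x) = (\<Oplus>x\<in>K \<union> L. r x \<odot> \<xi> x)"
      "(\<Oplus>x\<in>L. s x \<odot> \<xi> x) = (\<Oplus>x\<in>K \<union> L. s x \<odot> \<xi> x)"
      by (rule add.finprod_mono_neutral_cong_left; use K L KL in auto)+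
    then have "(\<Oplus>x\<in>K. r x \<odot> \<xi> x) \<oplus> (\<Oplus>x\<in>L. s x \<odot> \<xi> x) =
        (\<Oplus>x\<in>K \<union> L. r x \<odot> \<xi> x \<oplus> s x \<odot> \<xi> x)"
      using K L KL by (auto simp: finsum_addf)
    also have "\<dots> = (\<Oplus>x\<in>K \<union> L. (r x \<oplus>\<^bsub>R\<^esub> s x) \<odot> \<xi> x)"
      using K L KL by (intro finsum_cong') (auto simp: smult_l_distr)
    finally have "?P (u \<oplus> v) (K \<union> L) (\<lambda>x. r x \<oplus>\<^bsub>R\<^esub> s x)"
      using K L add.hyps by (simp add: G.coef_add)
    then show ?case
      by (intro exI)
  qed
  then obtain K r where "?P u K r"
    by (elim exE)
  then show ?thesis
    using coef_homog[OF u, of "Suc 0"] by (intro exI[of _ K] exI[of _ r]) simp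
qed

text \<open>The values \<open>\<theta>(\<xi> y)\<close> are chosen by induction on the degree of \<open>y\<close>, as bounding elements of
  the cycles \<open>-\<theta>(\<partial>(\<xi> y))\<close>.\<close>

lemma chain_derivation_exists:
  assumes pos: "\<And>x. x \<in> X \<Longrightarrow> 1 \<le> \<delta> x"
    and gen: "\<And>x. x \<in> X \<Longrightarrow>
      diff A (\<xi> x) \<in> generate_ring A (scalar A ` carrier R \<union> \<xi> ` {y \<in> X. \<delta> y < \<delta> x})"
    and acyclic: "\<And>i u. \<lbrakk>u \<in> homog A (Suc i); diff A u = \<zero>\<rbrakk> \<Longrightarrow> \<exists>w\<in>homog A (Suc (Suc i)). diff A w = u"
    and x0: "x0 \<in> X" "\<delta> x0 = 1"
    and base: "\<And>\<theta> u. \<lbrakk>odd_derivation R A \<theta>; \<theta> (\<xi> x0) = \<one>;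
        \<And>y. \<lbrakk>y \<in> X; \<delta> y = 1; y \<noteq> x0\<rbrakk> \<Longrightarrow> \<theta> (\<xi> y) = \<zero>; u \<in> homog A (Suc 0); diff A u = \<zero>\<rbrakk>
      \<Longrightarrow> \<exists>w\<in>homog A (Suc 0). diff A w = \<theta> u"
  shows "\<exists>\<theta>. chain_odd_derivation R A \<theta> \<and> \<theta> (\<xi> x0) = \<one> \<and>
    (\<forall>y\<in>X. \<delta> y = 1 \<and> y \<noteq> x0 \<longrightarrow> \<theta> (\<xi> y) = \<zero>)"
proof -
  \<comment> \<open>Every family of values of the right degrees extends to a derivation; one
    extension is chosen for each family, and the induction below only modifies the family.\<close>
  define valid where "valid t \<longleftrightarrow> (\<forall>x\<in>X. t x \<in> homog A (\<delta> x - 1))" for t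
  have "\<exists>\<theta>. valid t \<longrightarrow> odd_derivation R A \<theta> \<and> (\<forall>x\<in>X. \<theta> (\<xi> x) = t x)" for t
  proof (cases "valid t")
    case True
    interpret free_dga_values R A X \<delta> \<xi> ord t
      by unfold_locales (use True pos in \<open>auto simp: valid_def\<close>)
    show ?thesis
      using derivation_exists by blast
  qed blast
  then obtain der where der: "\<And>t. valid t \<Longrightarrow> odd_derivation R A (der t)"
    and der_var: "\<And>t x. \<lbrakk>valid t; x \<in> X\<rbrakk> \<Longrightarrow> der t (\<xi> x) = t x"
    by metis
  define H where "H d = scalar A ` carrier R \<union> \<xi> ` {y \<in> X. \<delta> y < d}" for d
  have H: "H d \<subseteq> carrier A" for d
    by (auto simp: H_def)
  have agree: "der t u = der t' u"
    if "valid t" "valid t'" "\<And>y. \<lbrakk>y \<in> X; \<delta> y < d\<rbrakk> \<Longrightarrow> t y = t' y" "u \<in> generate_ring A (H d)" for t t' u d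
  proof (rule odd_derivation_eq_on_generated[OF der der H _ that(4)])
    show "der t h = der t' h" if "h \<in> H d" for h
      using that odd_derivation.scalar_zero[OF der] \<open>valid t\<close> \<open>valid t'\<close> der_var
        \<open>\<And>y. \<lbrakk>y \<in> X; \<delta> y < d\<rbrakk> \<Longrightarrow> t y = t' y\<close>
      by (auto simp: H_def)
  qed fact+
  define ok where "ok t y \<longleftrightarrow> diff A (t y) = \<ominus> der t (diff A (\<xi> y))" for t y
  have chain_H: "diff A (der t u) = \<ominus> der t (diff A u)"
    if "valid t" "\<And>y. \<lbrakk>y \<in> X; \<delta> y < d\<rbrakk> \<Longrightarrow> ok t y" "u \<in> generate_ring A (H d)" for t u d
  proof (rule chain_on_generated[OF der H _ that(3)])
    interpret t: odd_derivation R A "der t"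
      by (rule der) fact
    show "diff A (der t h) = \<ominus> der t (diff A h)" if "h \<in> H d" for h
      using that \<open>valid t\<close> der_var \<open>\<And>y. \<lbrakk>y \<in> X; \<delta> y < d\<rbrakk> \<Longrightarrow> ok t y\<close>
      by (auto simp: H_def t.scalar_zero diff_scalar ok_def)
  qed fact
  \<comment> \<open>At stage d the chain condition holds for the variables of degree at most d + 1.
    \<open>Q\<close> records that later stages leave the values at these variables alone.\<close>
  define P where "P d t \<longleftrightarrow> valid t \<and> t x0 = \<one> \<and> (\<forall>y\<in>X. \<delta> y = 1 \<and> y \<noteq> x0 \<longrightarrow> t y = \<zero>) \<and>
      (\<forall>y\<in>X. \<delta> y \<le> Suc d \<longrightarrow> ok t y)" for d t
  define Q where "Q d t t' \<longleftrightarrow> (\<forall>y\<in>X. \<delta> y \<le> Suc d \<longrightarrow> t' y = t y)" for d and t t' :: "'v \<Rightarrow> 'c"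
  have diff_degree: "diff A (\<xi> y) \<in> homog A (\<delta> y - 1)" if "y \<in> X" for y
    using diff_comp_Suc[of "\<xi> y" "\<delta> y - 1"] var_homog[OF that] pos[OF that] by simp
  have "\<exists>f. \<forall>d. P d (f d) \<and> Q d (f d) (f (Suc d))"
  proof (rule dependent_nat_choice)
    \<comment> \<open>Boundaries of degree-one variables lie in degree 0 and are killed by the
      derivation, so these values satisfy the chain condition there. The zeros in higher degrees are
      provisional.\<close>
    define t where "t y = (if y = x0 then \<one> else \<zero>)" for y
    have v: "valid t"
      using x0 one_comp by (auto simp: valid_def t_def)
    interpret t: odd_derivation R A "der t"
      by (rule der) fact
    have "ok t y" if "y \<in> X" "\<delta> y \<le> Suc 0" for y
    proof -
      have "diff A (\<xi> y) \<in> homog A 0"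
        using diff_degree[OF that(1)] that(2) by (metis One_nat_def diff_is_0_eq)
      then show ?thesis
        by (auto simp: ok_def t_def t.degree_0 diff_one)
    qed
    then have "P 0 t"
      using v by (auto simp: P_def t_def)
    then show "\<exists>t. P 0 t" by (intro exI[of _ t])
  next
    fix t d assume Pt: "P d t"
    then have v: "valid t" and okt: "\<And>y. \<lbrakk>y \<in> X; \<delta> y \<le> Suc d\<rbrakk> \<Longrightarrow> ok t y"
      by (auto simp: P_def)
    interpret t: odd_derivation R A "der t"
      by (rule der) fact
    have "\<exists>w\<in>homog A (Suc d). diff A w = \<ominus> der t (diff A (\<xi> y))" if y: "y \<in> X" "\<delta> y = Suc (Suc d)" for y
    proof -
      let ?u = "diff A (\<xi> y)"
      have u: "?u \<in> homog A (Suc d)"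
        using diff_degree[OF y(1)] y(2) by simp
      have du: "diff A ?u = \<zero>"
        using y by (simp add: diff_diff)
      have "?u \<in> generate_ring A (H (Suc (Suc d)))"
        using gen[OF y(1)] y(2) by (simp add: H_def)
      from chain_H[OF v okt this] have z: "diff A (der t ?u) = \<zero>"
        by (simp add: du)
      have "\<exists>w\<in>homog A (Suc d). diff A w = der t ?u"
      proof (cases d)
        case 0
        show ?thesis
          using base[OF der[OF v], of ?u] u du Pt x0 unfolding 0 by (auto simp: P_def der_var)
      next
        case (Suc e)
        then show ?thesis
          using acyclic[of "der t ?u" e] z u t.degree_Suc[of ?u d] by simp
      qed
      then obtain w where "w \<in> homog A (Suc d)" "diff A w = der t ?u"
        by blast
      then show ?thesis
        by (intro bexI[of _ "\<ominus> w"]) (auto simp: homog_neg diff_neg)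
    qed
    then obtain w where w: "\<And>y. \<lbrakk>y \<in> X; \<delta> y = Suc (Suc d)\<rbrakk> \<Longrightarrow>
        w y \<in> homog A (Suc d) \<and> diff A (w y) = \<ominus> der t (diff A (\<xi> y))"
      by metis
    define t' where "t' y = (if \<delta> y = Suc (Suc d) then w y else t y)" for y
    have v': "valid t'"
      using v w by (auto simp: valid_def t'_def)
    have "ok t' y" if y: "y \<in> X" "\<delta> y \<le> Suc (Suc d)" for y
    proof -
      have "der t (diff A (\<xi> y)) = der t' (diff A (\<xi> y))"
        using gen[OF y(1)] y(2) unfolding H_def[symmetric]
        by (intro agree[OF v v', of "\<delta> y"]) (auto simp: t'_def)
      then show ?thesis
        using okt[of y] w[of y] y by (auto simp: ok_def t'_def)
    qed
    then show "\<exists>t'. P (Suc d) t' \<and> Q d t t'"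
      using Pt v' x0 by (intro exI[of _ t']) (auto simp: P_def Q_def t'_def)
  qed
  then obtain f where Pf: "\<And>d. P d (f d)" and Qf: "\<And>d. Q d (f d) (f (Suc d))"
    by blast
  have stable: "f (d + k) y = f d y" if "y \<in> X" "\<delta> y \<le> Suc d" for d k y
    using that by (induction k) (use Qf in \<open>auto simp: Q_def\<close>)
  \<comment> \<open>The value at y no longer changes once the stage has reached its degree, so the
    diagonal is the limit of the successive choices.\<close>
  define T where "T y = f (\<delta> y) y" for y
  have T: "f d y = T y" if "y \<in> X" "\<delta> y \<le> Suc d" for d y
  proof (cases "\<delta> y \<le> d")
    case True
    then show ?thesis
      using stable[of y "\<delta> y" "d - \<delta> y"] that(1) by (simp add: T_def)
  next
    case False
    then show ?thesis
      using stable[of y d 1] that by (simp add: T_def le_Suc_eq)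
  qed
  have vT: "valid T"
    using Pf by (auto simp: valid_def T_def P_def)
  interpret T: odd_derivation R A "der T"
    by (rule der) fact
  have "ok T y" if y: "y \<in> X" for y
  proof -
    have v: "valid (f (\<delta> y))" and "ok (f (\<delta> y)) y"
      using Pf[of "\<delta> y"] y by (auto simp: P_def)
    moreover have "der (f (\<delta> y)) (diff A (\<xi> y)) = der T (diff A (\<xi> y))"
      using gen[OF y] T unfolding H_def[symmetric] by (intro agree[OF v vT, of "\<delta> y"]) auto
    ultimately show ?thesis
      using T[OF y, of "\<delta> y"] by (simp add: ok_def)
  qed
  note okT = this
  have "chain_odd_derivation R A (der T)"
  proof
    fix u assume u: "u \<in> carrier A"
    show "diff A (der T u) = \<ominus> der T (diff A u)"
    proof (rule chain_on_generated[OF der[OF vT]])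
      show "u \<in> generate_ring A (scalar A ` carrier R \<union> \<xi> ` X)"
        using generated_by_variables u by blast
    qed (use okT der_var[OF vT] in \<open>auto simp: T.scalar_zero diff_scalar ok_def\<close>)
  qed
  moreover have "T x0 = \<one>" "\<forall>y\<in>X. \<delta> y = 1 \<and> y \<noteq> x0 \<longrightarrow> T y = \<zero>"
    using Pf x0 by (auto simp: T_def P_def)
  ultimately show ?thesis
    using der_var[OF vT] x0 by (intro exI[of _ "der T"]) auto
qed

end

section \<open>Derivations of tensor products\<close>

context abelian_group
begin

lemma add_pow_zero_int: "add_pow G (0::int) u = \<zero>"
  by (simp add: add_pow_def)

lemma extend_formal_sum_superset:
  assumes \<beta>: "\<beta> \<in> S \<rightarrow> carrier G" and K: "finite K" "Poly_Mapping.keys c \<subseteq> K" "K \<subseteq> S"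
  shows "extend_formal_sum G \<beta> c = (\<Oplus>p\<in>K. add_pow G (Poly_Mapping.lookup c p) (\<beta> p))"
  unfolding extend_formal_sum_def
  by (rule add.finprod_mono_neutral_cong_left)
    (use assms in \<open>auto simp: in_keys_iff add_pow_zero_int intro!: add.int_pow_closed\<close>)

lemma extend_formal_sum_closed:
  assumes \<beta>: "\<beta> \<in> S \<rightarrow> carrier G" and c: "Poly_Mapping.keys c \<subseteq> S"
  shows "extend_formal_sum G \<beta> c \<in> carrier G"
  unfolding extend_formal_sum_def using assms by (intro finsum_closed) (auto intro!: add.int_pow_closed)

lemma extend_formal_sum_add:
  assumes \<beta>: "\<beta> \<in> S \<rightarrow> carrier G" and c: "Poly_Mapping.keys c \<subseteq> S" "Poly_Mapping.keys d \<subseteq> S"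
  shows "extend_formal_sum G \<beta> (c + d) = extend_formal_sum G \<beta> c \<oplus> extend_formal_sum G \<beta> d"
proof -
  let ?K = "Poly_Mapping.keys c \<union> Poly_Mapping.keys d"
  have \<beta>K: "\<beta> p \<in> carrier G" if "p \<in> ?K" for p
    using that \<beta> c by auto
  have "extend_formal_sum G \<beta> (c + d) = (\<Oplus>p\<in>?K. add_pow G (Poly_Mapping.lookup (c + d) p) (\<beta> p))"
    by (rule extend_formal_sum_superset[OF \<beta>]) (use c keys_add[of c d] in auto)
  also have "\<dots> = (\<Oplus>p\<in>?K. add_pow G (Poly_Mapping.lookup c p) (\<beta> p) \<oplus> add_pow G (Poly_Mapping.lookup d p) (\<beta> p))"
    by (rule finsum_cong') (use \<beta>K in \<open>auto simp: lookup_add add.int_pow_mult intro!: add.int_pow_closed\<close>)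
  also have "\<dots> = (\<Oplus>p\<in>?K. add_pow G (Poly_Mapping.lookup c p) (\<beta> p)) \<oplus> (\<Oplus>p\<in>?K. add_pow G (Poly_Mapping.lookup d p) (\<beta> p))"
    by (rule finsum_addf) (use \<beta>K in \<open>auto intro!: add.int_pow_closed\<close>)
  also have "\<dots> = extend_formal_sum G \<beta> c \<oplus> extend_formal_sum G \<beta> d"
    using extend_formal_sum_superset[OF \<beta>, of ?K c] extend_formal_sum_superset[OF \<beta>, of ?K d] c by simp
  finally show ?thesis .
qed

lemma extend_formal_sum_of:
  assumes "\<beta> p \<in> carrier G"
  shows "extend_formal_sum G \<beta> (frag_of p) = \<beta> p"
  using assms by (simp add: extend_formal_sum_def finsum_insert add.int_pow_1)

lemma extend_formal_sum_diff:
  assumes \<beta>: "\<beta> \<in> S \<rightarrow> carrier G" and c: "Poly_Mapping.keys c \<subseteq> S" "Poly_Mapping.keys d \<subseteq> S"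
  shows "extend_formal_sum G \<beta> (c - d) = extend_formal_sum G \<beta> c \<ominus> extend_formal_sum G \<beta> d"
proof -
  have k: "Poly_Mapping.keys (c - d) \<subseteq> S"
    using keys_diff[of c d] c by auto
  have "extend_formal_sum G \<beta> c = extend_formal_sum G \<beta> (c - d) \<oplus> extend_formal_sum G \<beta> d"
    using extend_formal_sum_add[OF \<beta> k c(2)] by simp
  then show ?thesis
    using extend_formal_sum_closed[OF \<beta>] k c by (simp add: a_minus_def a_assoc r_neg)
qed

end

lemma add_hom_eq_on_generate:
  assumes T: "abelian_group T" and T': "abelian_group T'" and f: "f \<in> add_hom T T'" and g: "g \<in> add_hom T T'"
    and S: "S \<subseteq> carrier T" "carrier T \<subseteq> generate (add_monoid T) S"
    and eq: "\<And>s. s \<in> S \<Longrightarrow> f s = g s" and t: "t \<in> carrier T"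
  shows "f t = g t"
proof -
  interpret T: abelian_group T by fact
  have "t \<in> generate (add_monoid T) S"
    using S t by blast
  then show ?thesis
  proof (induction rule: generate.induct)
    case one
    show ?case
      using add_hom_zero[OF T T' f] add_hom_zero[OF T T' g] by simp
  next
    case (inv s)
    then have "f (\<ominus>\<^bsub>T\<^esub> s) = g (\<ominus>\<^bsub>T\<^esub> s)"
      using add_hom_neg[OF T T' f] add_hom_neg[OF T T' g] eq S by auto
    then show ?case
      by (simp add: a_inv_def)
  next
    case (eng u v)
    then have "u \<in> carrier T" "v \<in> carrier T"
      using T.add.generate_in_carrier[OF _ eng.hyps(1)] T.add.generate_in_carrier[OF _ eng.hyps(2)] S by auto
    then show ?case
      using eng.IH add_hom_add[OF f] add_hom_add[OF g] by simp
  qed (rule eq)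
qed

text \<open>The target enters only through its additive group, as the tensor product is a quotient
  of a free abelian group; linearity over R is established separately for the maps obtained.\<close>

definition balanced ::
  "('r, 'k) ring_scheme \<Rightarrow> ('r, 'a, 'l) module_scheme \<Rightarrow> ('r, 'b, 'm) module_scheme \<Rightarrow>
    ('t, 'n) ring_scheme \<Rightarrow> ('a \<times> 'b \<Rightarrow> 't) \<Rightarrow> bool" where
  "balanced R M N T \<beta> \<longleftrightarrow>
     \<beta> \<in> carrier M \<times> carrier N \<rightarrow> carrier T \<and>
     (\<forall>u\<in>carrier M. \<forall>u'\<in>carrier M. \<forall>v\<in>carrier N. \<beta> (u \<oplus>\<^bsub>M\<^esub> u', v) = \<beta> (u, v) \<oplus>\<^bsub>T\<^esub> \<beta> (u', v)) \<and>
     (\<forall>u\<in>carrier M. \<forall>v\<in>carrier N. \<forall>v'\<in>carrier N. \<beta> (u, v \<oplus>\<^bsub>N\<^esub> v') = \<beta> (u, v) \<oplus>\<^bsub>T\<^esub> \<beta> (u, v')) \<and>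
     (\<forall>r\<in>carrier R. \<forall>u\<in>carrier M. \<forall>v\<in>carrier N. \<beta> (r \<odot>\<^bsub>M\<^esub> u, v) = \<beta> (u, r \<odot>\<^bsub>N\<^esub> v))"

text \<open>Evaluation of formal sums is additive, so the three kinds of generating relations
  suffice. The support is tracked along the way, because this additivity is available only for sums
  supported on pairs from the two carriers.\<close>

lemma tensor_relations_vanish:
  fixes M :: "('r, 'a, 'l) module_scheme" and N :: "('r, 'b, 'm) module_scheme"
  assumes M: "module R M" and N: "module R N" and T: "abelian_group T" and \<beta>: "balanced R M N T \<beta>"
    and c: "c \<in> tensor_relations R M N"
  shows "Poly_Mapping.keys c \<subseteq> carrier M \<times> carrier N" and "extend_formal_sum T \<beta> c = \<zero>\<^bsub>T\<^esub>"
proof -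
  interpret M: module R M by fact
  interpret N: module R N by fact
  interpret T: abelian_group T by fact
  let ?S = "carrier M \<times> carrier N"
  let ?ok = "\<lambda>c. Poly_Mapping.keys c \<subseteq> ?S \<and> extend_formal_sum T \<beta> c = \<zero>\<^bsub>T\<^esub>"
  have \<beta>S: "\<beta> \<in> ?S \<rightarrow> carrier T"
    using \<beta> by (simp add: balanced_def)
  then have \<beta>c [simp]: "\<beta> (u, v) \<in> carrier T" if "u \<in> carrier M" "v \<in> carrier N" for u v
    using that by auto
  note E = T.extend_formal_sum_diff[OF \<beta>S] T.extend_formal_sum_of
  have keys2: "Poly_Mapping.keys (c - d) \<subseteq> ?S"
    if "Poly_Mapping.keys c \<subseteq> ?S" "Poly_Mapping.keys d \<subseteq> ?S" for c d :: "'a \<times> 'b \<Rightarrow>\<^sub>0 int"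
    using that keys_diff[of c d] by blast
  let ?rel = "{frag_of (u \<oplus>\<^bsub>M\<^esub> u', v) - frag_of (u, v) - frag_of (u', v) | u u' v.
        u \<in> carrier M \<and> u' \<in> carrier M \<and> v \<in> carrier N} \<union>
     {frag_of (u, v \<oplus>\<^bsub>N\<^esub> v') - frag_of (u, v) - frag_of (u, v') | u v v'.
        u \<in> carrier M \<and> v \<in> carrier N \<and> v' \<in> carrier N} \<union>
     {frag_of (r \<odot>\<^bsub>M\<^esub> u, v) - frag_of (u, r \<odot>\<^bsub>N\<^esub> v) | r u v.
        r \<in> carrier R \<and> u \<in> carrier M \<and> v \<in> carrier N}"
  have cancel: "p \<oplus>\<^bsub>T\<^esub> q \<ominus>\<^bsub>T\<^esub> p \<ominus>\<^bsub>T\<^esub> q = \<zero>\<^bsub>T\<^esub>" if "p \<in> carrier T" "q \<in> carrier T" for p q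
  proof -
    have "p \<oplus>\<^bsub>T\<^esub> q \<ominus>\<^bsub>T\<^esub> p \<ominus>\<^bsub>T\<^esub> q = (p \<oplus>\<^bsub>T\<^esub> q) \<oplus>\<^bsub>T\<^esub> \<ominus>\<^bsub>T\<^esub> (p \<oplus>\<^bsub>T\<^esub> q)"
      using that by (simp add: a_minus_def T.a_assoc T.minus_add)
    then show ?thesis
      using that by (simp add: T.r_neg)
  qed
  have three: "?ok (frag_of p - frag_of q - frag_of q')"
    if "p \<in> ?S" "q \<in> ?S" "q' \<in> ?S" "\<beta> p = \<beta> q \<oplus>\<^bsub>T\<^esub> \<beta> q'" for p q q'
  proof
    show "Poly_Mapping.keys (frag_of p - frag_of q - frag_of q') \<subseteq> ?S"
      using that by (intro keys2) auto
    have "extend_formal_sum T \<beta> (frag_of p - frag_of q - frag_of q') = \<beta> p \<ominus>\<^bsub>T\<^esub> \<beta> q \<ominus>\<^bsub>T\<^esub> \<beta> q'"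
      using that keys2[of "frag_of p" "frag_of q"] by (auto simp: E)
    then show "extend_formal_sum T \<beta> (frag_of p - frag_of q - frag_of q') = \<zero>\<^bsub>T\<^esub>"
      using that cancel[of "\<beta> q" "\<beta> q'"] by auto
  qed
  have two: "?ok (frag_of p - frag_of q)" if "p \<in> ?S" "q \<in> ?S" "\<beta> p = \<beta> q" for p q
  proof
    show "Poly_Mapping.keys (frag_of p - frag_of q) \<subseteq> ?S"
      using that by (intro keys2) auto
    show "extend_formal_sum T \<beta> (frag_of p - frag_of q) = \<zero>\<^bsub>T\<^esub>"
      using that by (auto simp: E a_minus_def T.r_neg)
  qed
  have rel: "?ok d" if "d \<in> ?rel" for d
    using that
  proof (elim UnE CollectE exE conjE)
    fix u u' v assume "d = frag_of (u \<oplus>\<^bsub>M\<^esub> u', v) - frag_of (u, v) - frag_of (u', v)"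
      "u \<in> carrier M" "u' \<in> carrier M" "v \<in> carrier N"
    then show "?ok d"
      using three[of "(u \<oplus>\<^bsub>M\<^esub> u', v)" "(u, v)" "(u', v)"] \<beta> by (simp add: balanced_def)
  next
    fix u v v' assume "d = frag_of (u, v \<oplus>\<^bsub>N\<^esub> v') - frag_of (u, v) - frag_of (u, v')"
      "u \<in> carrier M" "v \<in> carrier N" "v' \<in> carrier N"
    then show "?ok d"
      using three[of "(u, v \<oplus>\<^bsub>N\<^esub> v')" "(u, v)" "(u, v')"] \<beta> by (simp add: balanced_def)
  next
    fix r u v assume "d = frag_of (r \<odot>\<^bsub>M\<^esub> u, v) - frag_of (u, r \<odot>\<^bsub>N\<^esub> v)"
      "r \<in> carrier R" "u \<in> carrier M" "v \<in> carrier N"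
    then show "?ok d"
      using two[of "(r \<odot>\<^bsub>M\<^esub> u, v)" "(u, r \<odot>\<^bsub>N\<^esub> v)"] \<beta> by (simp add: balanced_def)
  qed
  have zero: "?ok 0"
    by (simp add: extend_formal_sum_def)
  have "?ok c"
    using c unfolding tensor_relations_def
  proof (induction rule: generate.induct)
    case one
    then show ?case
      using zero by simp
  next
    case (inv d)
    from rel[OF inv] have d: "Poly_Mapping.keys d \<subseteq> ?S" "extend_formal_sum T \<beta> d = \<zero>\<^bsub>T\<^esub>"
      by auto
    have "?ok (0 - d)"
      using keys2[of 0 d] T.extend_formal_sum_diff[OF \<beta>S, of 0 d] d zero by (simp add: a_minus_def)
    then show ?case
      using d(1) by simp
  next
    case (eng d d')
    then have d: "Poly_Mapping.keys d \<subseteq> ?S" "extend_formal_sum T \<beta> d = \<zero>\<^bsub>T\<^esub>"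
      "Poly_Mapping.keys d' \<subseteq> ?S" "extend_formal_sum T \<beta> d' = \<zero>\<^bsub>T\<^esub>"
      by auto
    then have "?ok (d + d')"
      using keys_add[of d d'] T.extend_formal_sum_add[OF \<beta>S d(1,3)] by auto
    then show ?case
      by simp
  qed (rule rel)
  then show "Poly_Mapping.keys c \<subseteq> ?S" "extend_formal_sum T \<beta> c = \<zero>\<^bsub>T\<^esub>"
    by auto
qed

text \<open>The isomorphism provides both halves of the universal property: surjectivity writes each
  element of T as the value of a formal sum, and by injectivity two such sums differ by a relation,
  on which every balanced map vanishes. Hence evaluating \<gamma> on any chosen formal sum is well
  defined.\<close>

lemma
  fixes M :: "('r, 'a, 'l) module_scheme" and N :: "('r, 'b, 'm) module_scheme"
  assumes M: "module R M" and N: "module R N" and T: "abelian_group T" and \<beta>: "balanced R M N T \<beta>"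
    and iso: "(\<lambda>U. the_elem (extend_formal_sum T \<beta> ` U)) \<in> iso (tensor_group R M N) (add_monoid T)"
  shows tensor_generated: "carrier T \<subseteq> generate (add_monoid T) (\<beta> ` (carrier M \<times> carrier N))"
    and tensor_extend: "\<And>T' \<gamma>. \<lbrakk>abelian_group T'; balanced R M N T' \<gamma>\<rbrakk> \<Longrightarrow>
      \<exists>h\<in>add_hom T T'. \<forall>u\<in>carrier M. \<forall>v\<in>carrier N. h (\<beta> (u, v)) = \<gamma> (u, v)"
proof -
  interpret M: module R M by fact
  interpret N: module R N by fact
  interpret T: abelian_group T by fact
  let ?S = "carrier M \<times> carrier N"
  let ?F = "free_Abelian_group ?S"
  let ?K = "tensor_relations R M N"
  let ?ext = "extend_formal_sum T \<beta>"
  note \<beta>S = \<beta>[unfolded balanced_def, THEN conjunct1]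
  note vanish = tensor_relations_vanish[OF M N]
  interpret F: group ?F
    by simp
  have K0: "0 \<in> ?K"
    using generate.one[of ?F] unfolding tensor_relations_def by simp
  have coset: "?K #>\<^bsub>?F\<^esub> c = {h + c | h. h \<in> ?K}" for c
    by (auto simp: r_coset_def)
  \<comment> \<open>Evaluation is constant on a coset of the relations, so the image is a singleton
    and \<open>the_elem\<close> returns its member.\<close>
  have val: "the_elem (?ext ` (?K #>\<^bsub>?F\<^esub> c)) = ?ext c" if c: "Poly_Mapping.keys c \<subseteq> ?S" for c
  proof -
    have "?ext (h + c) = ?ext c" if "h \<in> ?K" for h
      using T.extend_formal_sum_add[OF \<beta>S vanish(1)[OF T \<beta> that] c] vanish(2)[OF T \<beta> that]
        T.extend_formal_sum_closed[OF \<beta>S c] by simp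
    then have "?ext ` (?K #>\<^bsub>?F\<^esub> c) = {?ext c}"
      using K0 unfolding coset by (auto simp: image_iff)
    then show ?thesis
      by simp
  qed
  have carr: "carrier (tensor_group R M N) = {?K #>\<^bsub>?F\<^esub> c | c. Poly_Mapping.keys c \<subseteq> ?S}"
    by (auto simp: tensor_group_def FactGroup_def RCOSETS_def)
  have bij: "bij_betw (\<lambda>U. the_elem (?ext ` U)) (carrier (tensor_group R M N)) (carrier T)"
    using iso by (simp add: iso_def)
  have surj: "\<exists>c. Poly_Mapping.keys c \<subseteq> ?S \<and> ?ext c = t" if "t \<in> carrier T" for t
  proof -
    have "t \<in> (\<lambda>U. the_elem (?ext ` U)) ` carrier (tensor_group R M N)"
      using bij that by (simp add: bij_betw_def)
    then obtain c where "Poly_Mapping.keys c \<subseteq> ?S" "t = the_elem (?ext ` (?K #>\<^bsub>?F\<^esub> c))"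
      unfolding carr by blast
    then show ?thesis
      using val by auto
  qed
  have inj: "\<exists>h\<in>?K. c = h + d"
    if "Poly_Mapping.keys c \<subseteq> ?S" "Poly_Mapping.keys d \<subseteq> ?S" "?ext c = ?ext d" for c d
  proof -
    have "?K #>\<^bsub>?F\<^esub> c = ?K #>\<^bsub>?F\<^esub> d"
      by (rule inj_onD[OF bij_betw_imp_inj_on[OF bij]]) (use that val in \<open>auto simp: carr\<close>)
    moreover have "c \<in> ?K #>\<^bsub>?F\<^esub> c"
      unfolding coset using K0 by (intro CollectI exI[of _ 0]) simp
    ultimately show ?thesis
      unfolding coset by blast
  qed
  have sub: "\<beta> ` ?S \<subseteq> carrier T"
    using \<beta>S by auto
  show "carrier T \<subseteq> generate (add_monoid T) (\<beta> ` ?S)"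
  proof
    fix t assume "t \<in> carrier T"
    then obtain c where c: "Poly_Mapping.keys c \<subseteq> ?S" "?ext c = t"
      using surj by blast
    have "?ext c \<in> generate (add_monoid T) (\<beta> ` ?S)"
    proof (rule free_Abelian_group_induct[OF c(1)])
      show "?ext 0 \<in> generate (add_monoid T) (\<beta> ` ?S)"
        using generate.one[of "add_monoid T"] by (simp add: extend_formal_sum_def)
    next
      fix d d' assume d: "Poly_Mapping.keys d \<subseteq> ?S" "Poly_Mapping.keys d' \<subseteq> ?S"
        "?ext d \<in> generate (add_monoid T) (\<beta> ` ?S)" "?ext d' \<in> generate (add_monoid T) (\<beta> ` ?S)"
      have "\<ominus>\<^bsub>T\<^esub> ?ext d' \<in> generate (add_monoid T) (\<beta> ` ?S)"
        using T.add.generate_m_inv_closed[OF _ d(4)] sub by simp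
      then have "?ext d \<ominus>\<^bsub>T\<^esub> ?ext d' \<in> generate (add_monoid T) (\<beta> ` ?S)"
        using generate.eng[OF d(3)] by (simp add: a_minus_def)
      then show "?ext (d - d') \<in> generate (add_monoid T) (\<beta> ` ?S)"
        using T.extend_formal_sum_diff[OF \<beta>S d(1,2)] by simp
    next
      fix p assume "p \<in> ?S"
      then show "?ext (frag_of p) \<in> generate (add_monoid T) (\<beta> ` ?S)"
        using T.extend_formal_sum_of[of \<beta> p] sub by (auto intro: generate.incl)
    qed
    then show "t \<in> generate (add_monoid T) (\<beta> ` ?S)"
      by (simp add: c)
  qed
  fix T' \<gamma> assume T': "abelian_group T'" and \<gamma>: "balanced R M N T' \<gamma>"
  interpret T': abelian_group T' by fact
  note \<gamma>S = \<gamma>[unfolded balanced_def, THEN conjunct1]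
  let ?ext' = "extend_formal_sum T' \<gamma>"
  have "\<exists>h. \<forall>c. Poly_Mapping.keys c \<subseteq> ?S \<longrightarrow> h (?ext c) = ?ext' c"
  proof (intro exI allI impI)
    fix c :: "'a \<times> 'b \<Rightarrow>\<^sub>0 int" assume c: "Poly_Mapping.keys c \<subseteq> ?S"
    let ?d = "SOME d. Poly_Mapping.keys d \<subseteq> ?S \<and> ?ext d = ?ext c"
    have d: "Poly_Mapping.keys ?d \<subseteq> ?S" "?ext ?d = ?ext c"
      using someI[of "\<lambda>d. Poly_Mapping.keys d \<subseteq> ?S \<and> ?ext d = ?ext c" c] c by auto
    then obtain h where h: "h \<in> ?K" "?d = h + c"
      using inj[OF d(1) c d(2)] by blast
    then have "?ext' ?d = ?ext' h \<oplus>\<^bsub>T'\<^esub> ?ext' c"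
      using T'.extend_formal_sum_add[OF \<gamma>S vanish(1)[OF T' \<gamma> h(1)] c] by simp
    then show "(\<lambda>t. ?ext' (SOME d. Poly_Mapping.keys d \<subseteq> ?S \<and> ?ext d = t)) (?ext c) = ?ext' c"
      using vanish(2)[OF T' \<gamma> h(1)] T'.extend_formal_sum_closed[OF \<gamma>S c] by simp
  qed
  then obtain h where h: "\<And>c. Poly_Mapping.keys c \<subseteq> ?S \<Longrightarrow> h (?ext c) = ?ext' c"
    by blast
  have "h \<in> add_hom T T'"
  proof (rule add_homI)
    show "h t \<in> carrier T'" if "t \<in> carrier T" for t
      using surj[OF that] h T'.extend_formal_sum_closed[OF \<gamma>S] by auto
    fix s t assume "s \<in> carrier T" "t \<in> carrier T"
    then obtain c d where c: "Poly_Mapping.keys c \<subseteq> ?S" "?ext c = s" and d: "Poly_Mapping.keys d \<subseteq> ?S" "?ext d = t"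
      using surj by meson
    moreover have "Poly_Mapping.keys (c + d) \<subseteq> ?S"
      using keys_add[of c d] c d by blast
    ultimately show "h (s \<oplus>\<^bsub>T\<^esub> t) = h s \<oplus>\<^bsub>T'\<^esub> h t"
      using h T.extend_formal_sum_add[OF \<beta>S c(1) d(1)] T'.extend_formal_sum_add[OF \<gamma>S c(1) d(1)] by metis
  qed
  moreover have "h (\<beta> (u, v)) = \<gamma> (u, v)" if "u \<in> carrier M" "v \<in> carrier N" for u v
    using h[of "frag_of (u, v)"] T.extend_formal_sum_of[of \<beta> "(u, v)"] T'.extend_formal_sum_of[of \<gamma> "(u, v)"]
      that \<beta>S \<gamma>S by (auto simp: Pi_iff)
  ultimately show "\<exists>h\<in>add_hom T T'. \<forall>u\<in>carrier M. \<forall>v\<in>carrier N. h (\<beta> (u, v)) = \<gamma> (u, v)"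
    by blast
qed

section \<open>Morphisms of dg algebras and extension of derivations to a tensor product\<close>

locale dga_morphism = A: dga R A + B: dga R B
  for R :: "('r, 'k) ring_scheme" and A :: "('r, 'a) dga" and B :: "('r, 'b) dga" (structure) +
  fixes j :: "'a \<Rightarrow> 'b"
  assumes hom: "j \<in> dga_hom R A B"
begin

lemma ring_hom: "j \<in> ring_hom A B"
  using hom by (simp add: dga_hom_def)

lemma additive: "j \<in> add_hom A B"
  using ring_hom by (auto simp: ring_hom_def hom_def)

lemma closed [simp, intro]: "u \<in> carrier A \<Longrightarrow> j u \<in> carrier B"
  by (rule add_hom_closed[OF additive])

lemma plus: "\<lbrakk>u \<in> carrier A; v \<in> carrier A\<rbrakk> \<Longrightarrow> j (u \<oplus>\<^bsub>A\<^esub> v) = j u \<oplus> j v"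
  by (rule add_hom_add[OF additive])

lemma zero [simp]: "j \<zero>\<^bsub>A\<^esub> = \<zero>"
  by (rule add_hom_zero[OF A.is_abelian B.is_abelian additive])

lemma neg: "u \<in> carrier A \<Longrightarrow> j (\<ominus>\<^bsub>A\<^esub> u) = \<ominus> j u"
  by (rule add_hom_neg[OF A.is_abelian B.is_abelian additive])

lemma mult: "\<lbrakk>u \<in> carrier A; v \<in> carrier A\<rbrakk> \<Longrightarrow> j (u \<otimes>\<^bsub>A\<^esub> v) = j u \<otimes> j v"
  by (rule ring_hom_mult[OF ring_hom])

lemma one [simp]: "j \<one>\<^bsub>A\<^esub> = \<one>"
  by (rule ring_hom_one[OF ring_hom])

lemma smult: "\<lbrakk>r \<in> carrier R; u \<in> carrier A\<rbrakk> \<Longrightarrow> j (r \<odot>\<^bsub>A\<^esub> u) = r \<odot>\<^bsub>B\<^esub> j u"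
  using hom by (simp add: dga_hom_def)

lemma homog_mem: "u \<in> homog A i \<Longrightarrow> j u \<in> homog B i"
  using hom unfolding dga_hom_def by blast

lemma diff: "u \<in> carrier A \<Longrightarrow> j (diff A u) = diff B (j u)"
  using hom by (simp add: dga_hom_def)

lemma scalar: "r \<in> carrier R \<Longrightarrow> j (scalar A r) = scalar B r"
  by (simp add: scalar_def smult)

lemma involution: "u \<in> carrier A \<Longrightarrow> j (involution A u) = involution B (j u)"
proof (induction rule: A.homog_induct)
  case (homog i u)
  then show ?case
    using A.homog_carrier[OF homog]
    by (simp add: A.involution(2) B.involution(2)[OF homog_mem[OF homog]] signed_def neg)
qed (simp add: plus A.involution_add B.involution_add)

end

locale dga_tensor = A: dga R A + B: dga R B + T: dga R T
  for R :: "('r, 'k) ring_scheme" and A :: "('r, 'a) dga" and B :: "('r, 'b) dga"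
    and T :: "('r, 't) dga" (structure) +
  fixes jA :: "'a \<Rightarrow> 't" and jB :: "'b \<Rightarrow> 't"
  assumes tensor: "is_dg_tensor R A B T jA jB"
begin

sublocale jA: dga_morphism R A T jA
  by unfold_locales (use tensor in \<open>simp add: is_dg_tensor_def\<close>)

sublocale jB: dga_morphism R B T jB
  by unfold_locales (use tensor in \<open>simp add: is_dg_tensor_def\<close>)

abbreviation "pure \<equiv> (\<lambda>(u, v). jA u \<otimes> jB v)"

lemma balanced_pure: "balanced R A B T pure"
  by (auto simp: balanced_def jA.plus jB.plus jA.smult jB.smult T.l_distr T.r_distr
      T.smult_mult_left T.smult_mult_right)

lemma module_A: "module R A" and module_B: "module R B"
  by unfold_locales

lemma tensor_iso: "(\<lambda>U. the_elem (extend_formal_sum T pure ` U)) \<in> iso (tensor_group R A B) (add_monoid T)"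
  using tensor by (simp add: is_dg_tensor_def)

lemmas generated = tensor_generated[OF module_A module_B T.is_abelian balanced_pure tensor_iso]
lemmas extend = tensor_extend[OF module_A module_B T.is_abelian balanced_pure tensor_iso]

lemma pure_carrier: "pure ` (carrier A \<times> carrier B) \<subseteq> carrier T"
  by auto

lemma additive_eq:
  assumes "f \<in> add_hom T T" "g \<in> add_hom T T"
    and "\<And>u v. \<lbrakk>u \<in> carrier A; v \<in> carrier B\<rbrakk> \<Longrightarrow> f (jA u \<otimes> jB v) = g (jA u \<otimes> jB v)"
    and "t \<in> carrier T"
  shows "f t = g t"
  by (rule add_hom_eq_on_generate[OF T.is_abelian T.is_abelian assms(1,2) pure_carrier generated _ assms(4)])
    (use assms(3) in auto)

abbreviation "homogeneous_pure \<equiv> {jA u \<otimes> jB v | u v i j. u \<in> homog A i \<and> v \<in> homog B j}"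

text \<open>Pure tensors of inhomogeneous elements are not homogeneous, whereas
  \<open>lowers_degree\<close> requires homogeneous generators.\<close>

lemma generated_homogeneous: "carrier T \<subseteq> generate (add_monoid T) homogeneous_pure"
proof
  let ?G = "generate (add_monoid T) homogeneous_pure"
  have sub: "homogeneous_pure \<subseteq> carrier T"
    by auto
  have add: "s \<oplus> t \<in> ?G" if "s \<in> ?G" "t \<in> ?G" for s t
    using generate.eng[OF that] by simp
  have pure: "jA u \<otimes> jB v \<in> ?G" if u: "u \<in> carrier A" and v: "v \<in> carrier B" for u v
    using u
  proof (induction rule: A.homog_induct)
    case (homog i u)
    show ?case
      using v
    proof (induction rule: B.homog_induct)
      case (homog j v)
      then show ?case
        using \<open>u \<in> homog A i\<close> by (intro generate.incl) blast
    next
      case (add v w)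
      then show ?case
        using \<open>u \<in> homog A i\<close> A.homog_carrier[OF \<open>u \<in> homog A i\<close>] \<open>\<And>s t. \<lbrakk>s \<in> ?G; t \<in> ?G\<rbrakk> \<Longrightarrow> s \<oplus> t \<in> ?G\<close>
        by (simp add: jB.plus T.r_distr)
    qed
  next
    case (add u w)
    then show ?case
      using v \<open>\<And>s t. \<lbrakk>s \<in> ?G; t \<in> ?G\<rbrakk> \<Longrightarrow> s \<oplus> t \<in> ?G\<close> by (simp add: jA.plus T.l_distr)
  qed
  fix t assume "t \<in> carrier T"
  then have "t \<in> generate (add_monoid T) (pure ` (carrier A \<times> carrier B))"
    using generated by blast
  then show "t \<in> ?G"
  proof (induction rule: generate.induct)
    case one
    show ?case
      by (rule generate.one)
  next
    case (incl t)
    then show ?case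
      using pure by auto
  next
    case (inv t)
    then have "t \<in> ?G"
      using pure by auto
    then show ?case
      using T.add.generate_m_inv_closed[OF _ \<open>t \<in> ?G\<close>] sub by (simp add: a_inv_def)
  next
    case (eng s t)
    then show ?case
      by (intro generate.eng)
  qed
qed

text \<open>The derivation \<open>u \<otimes> v \<mapsto> (-1)\<^bsup>|u|\<^esup>u \<otimes> \<theta> v\<close>.\<close>

lemma tensor_derivation:
  assumes "chain_odd_derivation R B \<theta>"
  shows "\<exists>\<Theta>. chain_odd_derivation R T \<Theta> \<and> (\<forall>u\<in>carrier A. \<Theta> (jA u) = \<zero>) \<and>
    (\<forall>v\<in>carrier B. \<Theta> (jB v) = jB (\<theta> v))"
proof -
  interpret t: chain_odd_derivation R B \<theta> by fact
  have "balanced R A B T (\<lambda>(u, v). jA (involution A u) \<otimes> jB (\<theta> v))"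
    by (auto simp: balanced_def jA.plus jB.plus jA.smult jB.smult T.l_distr T.r_distr t.plus t.linear
      A.involution_add A.involution_smult T.smult_mult_left T.smult_mult_right)
  from extend[OF T.is_abelian this] obtain \<Theta> where \<Theta>: "\<Theta> \<in> add_hom T T"
    and pure: "\<And>u v. \<lbrakk>u \<in> carrier A; v \<in> carrier B\<rbrakk> \<Longrightarrow> \<Theta> (jA u \<otimes> jB v) = jA (involution A u) \<otimes> jB (\<theta> v)"
    by auto
  note rules = T.add_rules[OF \<Theta>]
  note [simp] = rules(1)
  have \<Theta>_A: "\<Theta> (jA u) = \<zero>" if "u \<in> carrier A" for u
    using pure[OF that B.one_closed] that by (simp add: t.one)
  have \<Theta>_B: "\<Theta> (jB v) = jB (\<theta> v)" if "v \<in> carrier B" for v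
    using pure[OF A.one_closed that] that by (simp add: A.involution_one)
  \<comment> \<open>The Leibniz rule for two general tensors is assembled from three special cases:
    a factor from A on the left, a factor from B on the right, and a factor from A on the
    right.\<close>
  have left: "\<Theta> (jA u \<otimes> s) = jA (involution A u) \<otimes> \<Theta> s" if u: "u \<in> carrier A" and s: "s \<in> carrier T" for u s
  proof (rule additive_eq[where f = "\<lambda>s. \<Theta> (jA u \<otimes> s)", OF _ _ _ s])
    fix u' v assume uv: "u' \<in> carrier A" "v \<in> carrier B"
    show "\<Theta> (jA u \<otimes> (jA u' \<otimes> jB v)) = jA (involution A u) \<otimes> \<Theta> (jA u' \<otimes> jB v)"
      using uv u pure[of "u \<otimes>\<^bsub>A\<^esub> u'" v] pure[of u' v] by (simp add: A.involution_mult jA.mult T.m_assoc)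
  qed (use u in \<open>auto intro!: add_homI simp: T.r_distr rules\<close>)
  have right: "\<Theta> (s \<otimes> jB v) = \<Theta> s \<otimes> jB v \<oplus> involution T s \<otimes> jB (\<theta> v)"
    if s: "s \<in> carrier T" and v: "v \<in> carrier B" for s v
  proof (rule additive_eq[where f = "\<lambda>s. \<Theta> (s \<otimes> jB v)", OF _ _ _ s])
    fix u v' assume uv: "u \<in> carrier A" "v' \<in> carrier B"
    show "\<Theta> (jA u \<otimes> jB v' \<otimes> jB v) =
        \<Theta> (jA u \<otimes> jB v') \<otimes> jB v \<oplus> involution T (jA u \<otimes> jB v') \<otimes> jB (\<theta> v)"
      using uv v pure[of u "v' \<otimes>\<^bsub>B\<^esub> v"] pure[of u v'] by (simp add: t.product jB.plus jB.mult T.r_distr T.m_assoc T.involution_mult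
          jA.involution jB.involution)
  qed (use v in \<open>auto intro!: add_homI simp: T.l_distr T.involution_add T.a_ac rules\<close>)
  have degree: "s \<in> homog T 0 \<Longrightarrow> \<Theta> s = \<zero>" "s \<in> homog T (Suc i) \<Longrightarrow> \<Theta> s \<in> homog T i" for s i
  proof -
    have S: "\<exists>k. g \<in> homog T k \<and> (k = 0 \<longrightarrow> \<Theta> g = \<zero>) \<and> \<Theta> g \<in> homog T (k - 1)"
      if g_in: "g \<in> homogeneous_pure" for g
    proof -
      obtain u v i j where g: "g = jA u \<otimes> jB v" "u \<in> homog A i" "v \<in> homog B j"
        using g_in by blast
      have c: "u \<in> carrier A" "v \<in> carrier B"
        using g by auto
      have "g \<in> homog T (i + j)"
        unfolding g by (intro T.mult_comp jA.homog_mem jB.homog_mem g)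
      moreover have "(i + j = 0 \<longrightarrow> \<Theta> g = \<zero>) \<and> \<Theta> g \<in> homog T (i + j - 1)"
      proof (cases j)
        case 0
        then have "\<Theta> g = \<zero>"
          using g c t.degree_0[of v] by (simp add: pure)
        then show ?thesis
          by simp
      next
        case (Suc l)
        then have "\<Theta> g \<in> homog T (i + l)"
          unfolding g pure[OF c]
          by (intro T.mult_comp jA.homog_mem jB.homog_mem A.involution_homog g t.degree_Suc) (use g in simp)
        then show ?thesis
          using Suc by simp
      qed
      ultimately show ?thesis
        by blast
    qed
    show "s \<in> homog T 0 \<Longrightarrow> \<Theta> s = \<zero>" "s \<in> homog T (Suc i) \<Longrightarrow> \<Theta> s \<in> homog T i"
      by (rule T.lowers_degree[OF \<Theta> generated_homogeneous S], assumption+)+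
  qed
  \<comment> \<open>The factor from A is moved to the left, where \<open>left\<close> applies, and
    back. The exchanges have signs of exponents ki and (k-1)i, as \<Theta> lowers the degree of s;
    the difference i is exactly the sign of the involution in \<open>left\<close>.\<close>
  have right_A: "\<Theta> (s \<otimes> jA u) = \<Theta> s \<otimes> jA u" if s: "s \<in> carrier T" and u: "u \<in> carrier A" for s u
    using u
  proof (induction rule: A.homog_induct)
    case (homog i u)
    then have [simp]: "u \<in> carrier A"
      by auto
    show ?case
      using s
    proof (induction rule: T.homog_induct)
      case (homog k s)
      then have [simp]: "s \<in> carrier T"
        by auto
      have "\<Theta> (s \<otimes> jA u) = \<Theta> (signed T (int (k * i)) (jA u \<otimes> s))"
        using T.graded_commute[OF homog jA.homog_mem[OF \<open>u \<in> homog A i\<close>]] by simp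
      also have "\<dots> = signed T (int (k * i)) (\<Theta> (jA u \<otimes> s))"
        by (simp add: signed_def rules)
      also have "\<dots> = signed T (int (k * i)) (jA (signed A (int i) u) \<otimes> \<Theta> s)"
        using \<open>u \<in> homog A i\<close> by (simp add: left A.involution(2))
      also have "\<dots> = \<Theta> s \<otimes> jA u"
      proof (cases k)
        case 0
        then show ?thesis
          using homog degree(1)[of s] by simp
      next
        case (Suc l)
        have "\<Theta> s \<otimes> jA u = signed T (int (l * i)) (jA u \<otimes> \<Theta> s)"
          using T.graded_commute[OF degree(2) jA.homog_mem[OF \<open>u \<in> homog A i\<close>], of s l] homog Suc by simp
        then show ?thesis
          using Suc by (simp add: signed_def jA.neg T.l_minus)
      qed
      finally show ?case .
    next
      case (add s s')
      then show ?case
        by (simp add: T.l_distr rules)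
    qed
  next
    case (add u w)
    then show ?case
      using s by (simp add: jA.plus T.r_distr rules)
  qed
  have product: "\<Theta> (s \<otimes> s') = \<Theta> s \<otimes> s' \<oplus> involution T s \<otimes> \<Theta> s'"
    if s: "s \<in> carrier T" and s': "s' \<in> carrier T" for s s'
  proof (rule additive_eq[where f = "\<lambda>s'. \<Theta> (s \<otimes> s')", OF _ _ _ s'])
    fix u v assume uv: "u \<in> carrier A" "v \<in> carrier B"
    have "\<Theta> (s \<otimes> jA u \<otimes> jB v) = \<Theta> s \<otimes> jA u \<otimes> jB v \<oplus> involution T (s \<otimes> jA u) \<otimes> jB (\<theta> v)"
      using right[of "s \<otimes> jA u" v] right_A[OF s uv(1)] uv s by simp
    then show "\<Theta> (s \<otimes> (jA u \<otimes> jB v)) = \<Theta> s \<otimes> (jA u \<otimes> jB v) \<oplus> involution T s \<otimes> \<Theta> (jA u \<otimes> jB v)"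
      using uv s pure[OF uv] by (simp add: T.involution_mult jA.involution T.m_assoc)
  qed (use s in \<open>auto intro!: add_homI simp: T.r_distr T.a_ac rules\<close>)
  have linear: "\<Theta> (r \<odot> s) = r \<odot> \<Theta> s" if r: "r \<in> carrier R" and s: "s \<in> carrier T" for r s
  proof (rule additive_eq[where f = "\<lambda>s. \<Theta> (r \<odot> s)", OF _ _ _ s])
    fix u v assume uv: "u \<in> carrier A" "v \<in> carrier B"
    show "\<Theta> (r \<odot> (jA u \<otimes> jB v)) = r \<odot> \<Theta> (jA u \<otimes> jB v)"
      using uv r pure[of "r \<odot>\<^bsub>A\<^esub> u" v] pure[of u v] by (simp add: A.involution_smult jA.smult T.smult_mult_left)
  qed (use r in \<open>auto intro!: add_homI simp: T.smult_r_distr rules\<close>)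
  have chain: "diff T (\<Theta> s) = \<ominus> \<Theta> (diff T s)" if s: "s \<in> carrier T" for s
  proof (rule additive_eq[where f = "\<lambda>s. diff T (\<Theta> s)", OF _ _ _ s])
    fix u v assume uv: "u \<in> carrier A" "v \<in> carrier B"
    have "diff T (jA u \<otimes> jB v) = jA (diff A u) \<otimes> jB v \<oplus> jA (involution A u) \<otimes> jB (diff B v)"
      using uv by (simp add: T.diff_mult jA.diff jB.diff jA.involution)
    then show "diff T (\<Theta> (jA u \<otimes> jB v)) = \<ominus> \<Theta> (diff T (jA u \<otimes> jB v))"
      using uv by (simp add: rules pure T.diff_mult A.diff_involution t.chain jA.neg jB.neg T.minus_add
          T.l_minus T.r_minus flip: jA.diff jB.diff jA.involution)
  qed (auto intro!: add_homI simp: T.diff_add T.minus_add rules)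
  have "chain_odd_derivation R T \<Theta>"
    by unfold_locales (fact \<Theta> linear degree product chain)+
  then show ?thesis
    using \<Theta>_A \<Theta>_B by blast
qed

end

section \<open>Splitting off exterior variables\<close>

text \<open>The derivations are corrected one after the other, each first against its predecessors and
  then against its own square.\<close>

lemma (in dga) anticommuting_family:
  fixes n :: nat
  assumes \<theta>: "\<And>i. i \<in> {1..n} \<Longrightarrow> chain_odd_derivation R A (\<theta> i)"
    and z: "\<And>i. i \<in> {1..n} \<Longrightarrow> z i \<in> homog A (Suc 0)" "\<And>i. i \<in> {1..n} \<Longrightarrow> diff A (z i) = \<zero>"
    and \<theta>z: "\<And>i j. \<lbrakk>i \<in> {1..n}; j \<in> {1..n}\<rbrakk> \<Longrightarrow> \<theta> i (z j) = (if i = j then \<one> else \<zero>)"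
    and K: "\<And>i u. \<lbrakk>i \<in> {1..n}; u \<in> K\<rbrakk> \<Longrightarrow> \<theta> i u = \<zero>"
  shows "\<exists>\<phi>. \<forall>i\<in>{1..n}. chain_odd_derivation R A (\<phi> i) \<and> (\<forall>u\<in>homog A (Suc 0). \<phi> i u = \<theta> i u) \<and>
    (\<forall>u\<in>K. \<phi> i u = \<zero>) \<and> (\<forall>u\<in>carrier A. \<phi> i (\<phi> i u) = \<zero>) \<and>
    (\<forall>j\<in>{1..n}. j \<noteq> i \<longrightarrow> (\<forall>u\<in>carrier A. \<phi> i (\<phi> j u) \<oplus> \<phi> j (\<phi> i u) = \<zero>))"
proof -
  \<comment> \<open>The properties every correction must keep. Agreement with \<theta>_i in degree 1
    fixes the values on all \<open>z j\<close>.\<close>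
  define good where "good i \<psi> \<longleftrightarrow> chain_odd_derivation R A \<psi> \<and> (\<forall>u\<in>homog A (Suc 0). \<psi> u = \<theta> i u) \<and>
    (\<forall>u\<in>K. \<psi> u = \<zero>)" for i \<psi>
  have good_chain: "chain_odd_derivation R A \<psi>" if "good i \<psi>" for i \<psi>
    using that by (simp add: good_def)
  have good_z: "\<psi> (z j) = (if i = j then \<one> else \<zero>)" if "good i \<psi>" "i \<in> {1..n}" "j \<in> {1..n}" for i j \<psi>
    using that \<theta>z z by (simp add: good_def)
  have good_zero: "\<psi> \<zero> = \<zero>" if "good i \<psi>" for i \<psi>
  proof -
    interpret chain_odd_derivation R A \<psi>
      using that by (rule good_chain)
    show ?thesis
      by simp
  qed
  \<comment> \<open>D vanishes in degree 1 and on K, so neither the degree-one values nor the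
    vanishing on K is affected.\<close>
  have good_correction: "good i (\<lambda>u. \<psi> u \<ominus> z j \<otimes> D u)"
    if \<psi>: "good i \<psi>" and D: "chain_even_derivation R A D" and j: "j \<in> {1..n}" and DK: "\<And>u. u \<in> K \<Longrightarrow> D u = \<zero>"
    for i j \<psi> D
  proof -
    interpret D: chain_even_derivation R A D
      by fact
    have "z j \<in> carrier A"
      using z(1)[OF j] by auto
    moreover have "\<psi> u \<in> carrier A" if "u \<in> homog A (Suc 0)" for u
      using odd_derivation.closed[OF chain_odd_derivation.axioms(1)[OF good_chain[OF \<psi>]]] that by auto
    ultimately show ?thesis
      using \<psi> chain_correction[OF good_chain[OF \<psi>] D z(1)[OF j] z(2)[OF j]] DK D.degree_le_1
      by (auto simp: good_def a_minus_def)
  qed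
  define fam where "fam k \<phi> \<longleftrightarrow> (\<forall>i\<in>{1..k}. good i (\<phi> i) \<and> (\<forall>u\<in>carrier A. \<phi> i (\<phi> i u) = \<zero>) \<and>
    (\<forall>j\<in>{1..k}. j \<noteq> i \<longrightarrow> (\<forall>u\<in>carrier A. \<phi> i (\<phi> j u) \<oplus> \<phi> j (\<phi> i u) = \<zero>)))" for k and \<phi> :: "nat \<Rightarrow> 'a \<Rightarrow> 'a"
  have "\<exists>\<phi>. fam k \<phi>" if "k \<le> n" for k
    using that
  proof (induction k)
    case 0
    then show ?case
      by (simp add: fam_def)
  next
    case (Suc k)
    then obtain \<phi> where fam: "fam k \<phi>"
      by auto
    have k: "Suc k \<in> {1..n}"
      using Suc.prems by simp
    have good: "good i (\<phi> i)" and sq: "\<And>u. u \<in> carrier A \<Longrightarrow> \<phi> i (\<phi> i u) = \<zero>"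
      and i_n: "i \<in> {1..n}" if "i \<in> {1..k}" for i
      using fam that Suc.prems by (auto simp: fam_def)
    have anti: "\<phi> i (\<phi> j u) \<oplus> \<phi> j (\<phi> i u) = \<zero>"
      if "i \<in> {1..k}" "j \<in> {1..k}" "i \<noteq> j" "u \<in> carrier A" for i j u
      using fam that by (auto simp: fam_def)
    \<comment> \<open>The new derivation is corrected along \<open>\<phi> 1\<close>, ...,
      \<open>\<phi> k\<close> in turn. Each correction uses that \<open>\<phi> (Suc l)\<close>
      already has square zero and that it anticommutes with the earlier ones, so that the relations
      already obtained persist.\<close>
    have "\<exists>\<psi>. good (Suc k) \<psi> \<and> (\<forall>i\<in>{1..l}. \<forall>u\<in>carrier A. \<phi> i (\<psi> u) \<oplus> \<psi> (\<phi> i u) = \<zero>)" if "l \<le> k" for l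
      using that
    proof (induction l)
      case 0
      then show ?case
        using \<theta>[OF k] K[OF k] by (intro exI[of _ "\<theta> (Suc k)"]) (simp add: good_def)
    next
      case (Suc l)
      then obtain \<psi> where \<psi>: "good (Suc k) \<psi>"
        and \<psi>_anti: "\<And>i u. \<lbrakk>i \<in> {1..l}; u \<in> carrier A\<rbrakk> \<Longrightarrow> \<phi> i (\<psi> u) \<oplus> \<psi> (\<phi> i u) = \<zero>"
        by auto
      have l: "Suc l \<in> {1..k}"
        using Suc.prems by simp
      let ?\<psi> = "\<lambda>u. \<psi> u \<ominus> z (Suc l) \<otimes> (\<phi> (Suc l) (\<psi> u) \<oplus> \<psi> (\<phi> (Suc l) u))"
      have "good (Suc k) ?\<psi>"
        by (intro good_correction \<psi> i_n l chain_bracket good_chain[OF good[OF l]] good_chain[OF \<psi>])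
          (use \<psi> good[OF l] good_zero[OF \<psi>] good_zero[OF good[OF l]] in \<open>auto simp: good_def\<close>)
      moreover have "\<phi> i (?\<psi> u) \<oplus> ?\<psi> (\<phi> i u) = \<zero>" if i: "i \<in> {1..Suc l}" and u: "u \<in> carrier A" for i u
      proof (cases "i = Suc l")
        case True
        show ?thesis
          unfolding True
          by (rule anticommuting_correction[OF good_chain[OF good[OF l]] good_chain[OF \<psi>] z(1)[OF i_n[OF l]] _ sq[OF l] u])
            (use good_z[OF good[OF l] i_n[OF l] i_n[OF l]] in simp_all)
      next
        case False
        then have il: "i \<in> {1..l}" and ik: "i \<in> {1..k}"
          using i Suc.prems by auto
        show ?thesis
          by (rule anticommuting_correction_preserves[OF good_chain[OF good[OF l]] good_chain[OF \<psi>]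
                good_chain[OF good[OF ik]] z(1)[OF i_n[OF l]] _ anti[OF ik l False] \<psi>_anti[OF il] u])
            (use good_z[OF good[OF ik] i_n[OF ik] i_n[OF l]] False in simp_all)
      qed
      ultimately show ?case
        by blast
    qed
    then obtain \<psi> where \<psi>: "good (Suc k) \<psi>"
      and \<psi>_anti: "\<And>i u. \<lbrakk>i \<in> {1..k}; u \<in> carrier A\<rbrakk> \<Longrightarrow> \<phi> i (\<psi> u) \<oplus> \<psi> (\<phi> i u) = \<zero>"
      by blast
    \<comment> \<open>The square comes last, because the bracket corrections would alter it, while
      correcting the square preserves the brackets.\<close>
    define \<psi>' where "\<psi>' = (\<lambda>u. \<psi> u \<ominus> z (Suc k) \<otimes> \<psi> (\<psi> u))"
    have \<psi>'_good: "good (Suc k) \<psi>'"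
      unfolding \<psi>'_def by (intro good_correction \<psi> k chain_square good_chain[OF \<psi>])
        (use \<psi> good_zero[OF \<psi>] in \<open>auto simp: good_def\<close>)
    have \<psi>'_square: "\<psi>' (\<psi>' u) = \<zero>" if "u \<in> carrier A" for u
      unfolding \<psi>'_def by (rule square_correction[OF good_chain[OF \<psi>] z(1)[OF k] _ that])
        (use good_z[OF \<psi> k k] in simp)
    have \<psi>'_anti: "\<phi> i (\<psi>' u) \<oplus> \<psi>' (\<phi> i u) = \<zero>" if i: "i \<in> {1..k}" and u: "u \<in> carrier A" for i u
      unfolding \<psi>'_def
      by (rule square_correction_preserves[OF good_chain[OF \<psi>] good_chain[OF good[OF i]] z(1)[OF k] _ \<psi>_anti[OF i] u])
        (use good_z[OF good[OF i] i_n[OF i] k] i in simp_all)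
    have carr: "\<phi> i u \<in> carrier A" "\<psi>' u \<in> carrier A" if "i \<in> {1..k}" "u \<in> carrier A" for i u
      using odd_derivation.closed[OF chain_odd_derivation.axioms(1)[OF good_chain[OF good[OF that(1)]]]]
        odd_derivation.closed[OF chain_odd_derivation.axioms(1)[OF good_chain[OF \<psi>'_good]]] that by auto
    have "\<psi>' (\<phi> i u) \<oplus> \<phi> i (\<psi>' u) = \<zero>" if "i \<in> {1..k}" "u \<in> carrier A" for i u
      using \<psi>'_anti[OF that] carr that by (metis a_comm)
    then have "fam (Suc k) (\<phi>(Suc k := \<psi>'))"
      using \<psi>'_good \<psi>'_square \<psi>'_anti good sq anti unfolding fam_def
      by (auto simp: le_Suc_eq)
    then show ?case
      by (intro exI[of _ "\<phi>(Suc k := \<psi>')"])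
  qed
  then obtain \<phi> where "fam n \<phi>"
    by blast
  then show ?thesis
    unfolding fam_def good_def by (intro exI[of _ \<phi>]) blast
qed

section \<open>Dg subalgebras\<close>

lemma homog_update_simps:
  "\<zero>\<^bsub>B\<lparr>homog := h\<rparr>\<^esub> = \<zero>\<^bsub>B\<^esub>" "carrier (B\<lparr>homog := h\<rparr>) = carrier B"
  "\<one>\<^bsub>B\<lparr>homog := h\<rparr>\<^esub> = \<one>\<^bsub>B\<^esub>" "monoid.mult (B\<lparr>homog := h\<rparr>) = monoid.mult B" "ring.add (B\<lparr>homog := h\<rparr>) = ring.add B"
  by simp_all

lemma ring_homog_update: "ring (B\<lparr>homog := h\<rparr>) = ring B"
  unfolding ring_def ring_axioms_def monoid_def abelian_group_def abelian_monoid_def abelian_group_axioms_def homog_update_simps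
  by (rule refl)

lemma ideal_homog_update: "ideal I (B\<lparr>homog := h\<rparr>) = ideal I B"
  unfolding ideal_def ideal_axioms_def ring_homog_update additive_subgroup_def homog_update_simps
  by (rule refl)

text \<open>A subalgebra that contains A_0 has the same degree-zero ring except for the record field
  \<open>homog\<close>, which the ring-theoretic notions do not see.\<close>

lemma noetherian_ring_homog_update: "noetherian_ring (B\<lparr>homog := h\<rparr>) = noetherian_ring B"
  unfolding noetherian_ring_def noetherian_ring_axioms_def genideal_def ideal_homog_update ring_homog_update homog_update_simps
  by (rule refl)

text \<open>Closure under components yields the grading, and containing A_0 passes on the Noetherian
  condition. Generation is required over \<open>homog A 0\<close>, which is also the degree-zero
  part of W.\<close>

locale sub_dga_closed = dga +
  fixes W :: "'c set"
  assumes W_carrier: "W \<subseteq> carrier A"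
    and W_add: "\<lbrakk>u \<in> W; v \<in> W\<rbrakk> \<Longrightarrow> u \<oplus> v \<in> W"
    and W_neg: "u \<in> W \<Longrightarrow> \<ominus> u \<in> W"
    and W_mult: "\<lbrakk>u \<in> W; v \<in> W\<rbrakk> \<Longrightarrow> u \<otimes> v \<in> W"
    and W_smult: "\<lbrakk>r \<in> carrier R; u \<in> W\<rbrakk> \<Longrightarrow> r \<odot> u \<in> W"
    and W_diff: "u \<in> W \<Longrightarrow> diff A u \<in> W"
    and W_coef: "u \<in> W \<Longrightarrow> G.coef u i \<in> W"
    and W_degree_0: "homog A 0 \<subseteq> W"
    and W_fin_gen: "\<exists>H. finite H \<and> H \<subseteq> homog A i \<inter> W \<and>
        (\<forall>u\<in>homog A i \<inter> W. \<exists>c\<in>H \<rightarrow> homog A 0. u = (\<Oplus>g\<in>H. c g \<otimes> g))"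
begin

abbreviation "S \<equiv> sub_dga A W"

lemma sub_simps [simp]:
  "carrier S = W" "\<zero>\<^bsub>S\<^esub> = \<zero>" "\<one>\<^bsub>S\<^esub> = \<one>" "u \<oplus>\<^bsub>S\<^esub> v = u \<oplus> v" "u \<otimes>\<^bsub>S\<^esub> v = u \<otimes> v"
  "r \<odot>\<^bsub>S\<^esub> u = r \<odot> u" "homog S i = homog A i \<inter> W" "diff S = diff A"
  by (simp_all add: sub_dga_def)

lemma W_in [simp]: "u \<in> W \<Longrightarrow> u \<in> carrier A"
  using W_carrier by blast

lemma W_zero [simp]: "\<zero> \<in> W" and W_one [simp]: "\<one> \<in> W"
  using W_degree_0 homog_zero one_comp by auto

lemma S_abelian: "abelian_group S"
proof (rule abelian_groupI)
  show "\<exists>v\<in>carrier S. v \<oplus>\<^bsub>S\<^esub> u = \<zero>\<^bsub>S\<^esub>" if "u \<in> carrier S" for u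
    using that W_neg by (intro bexI[of _ "\<ominus> u"]) (auto simp: l_neg)
qed (auto simp: W_add a_ac)

lemma S_ring: "ring S"
  by (rule ringI[OF S_abelian]) (auto intro!: monoidI simp: W_mult m_assoc l_distr r_distr)

lemma S_neg [simp]: "u \<in> W \<Longrightarrow> \<ominus>\<^bsub>S\<^esub> u = \<ominus> u"
  by (rule abelian_group.minus_equality[OF S_abelian]) (auto simp: W_neg l_neg)

lemma S_signed [simp]: "u \<in> W \<Longrightarrow> signed S k u = signed A k u"
  by (simp add: signed_def)

lemma S_finsum: "(\<And>k. k \<in> K \<Longrightarrow> f k \<in> W) \<Longrightarrow> (\<Oplus>\<^bsub>S\<^esub>k\<in>K. f k) = (\<Oplus>k\<in>K. f k) \<and> (\<Oplus>k\<in>K. f k) \<in> W"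
proof (induction K rule: infinite_finite_induct)
  interpret S: abelian_group S
    by (rule S_abelian)
  {
    case (infinite K)
    then show ?case
      by (simp add: S.finsum_infinite)
  next
    case empty
    show ?case
      by (simp add: S.finsum_empty)
  next
    case (insert k K)
    then show ?case
      by (simp add: S.finsum_insert finsum_insert Pi_def W_add)
  }
qed

lemma S_module: "module R S"
  by (rule moduleI[OF _ S_abelian]) (auto simp: W_smult smult_l_distr smult_r_distr smult_assoc1 R.is_cring)

lemma inclusion_hom: "(\<lambda>u. u) \<in> dga_hom R S A"
  by (auto simp: dga_hom_def ring_hom_def)

lemma dg_subalgebra: "dg_subalgebra R W A"
proof -
  have "dg_algebra R S"
  proof (rule dg_algebra.intro[OF S_module S_ring], rule dg_algebra_axioms.intro, unfold sub_simps)
    fix i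
    show "submodule (homog A i \<inter> W) R S"
      by (rule module.submoduleI[OF S_module])
        (auto simp: homog_add W_add homog_smult W_smult homog_neg W_neg)
    show "\<exists>H. finite H \<and> H \<subseteq> homog A i \<inter> W \<and>
        (\<forall>u\<in>homog A i \<inter> W. \<exists>c\<in>H \<rightarrow> homog A 0 \<inter> W. u = (\<Oplus>\<^bsub>S\<^esub>g\<in>H. c g \<otimes> g))"
    proof -
      obtain H where H: "finite H" "H \<subseteq> homog A i \<inter> W"
        and gen: "\<forall>u\<in>homog A i \<inter> W. \<exists>c\<in>H \<rightarrow> homog A 0. u = (\<Oplus>g\<in>H. c g \<otimes> g)"
        using W_fin_gen[of i] by blast
      have "\<exists>c\<in>H \<rightarrow> homog A 0 \<inter> W. u = (\<Oplus>\<^bsub>S\<^esub>g\<in>H. c g \<otimes> g)" if u: "u \<in> homog A i \<inter> W" for u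
      proof -
        obtain c where c: "c \<in> H \<rightarrow> homog A 0" "u = (\<Oplus>g\<in>H. c g \<otimes> g)"
          using gen u by blast
        then have "c \<in> H \<rightarrow> homog A 0 \<inter> W"
          using W_degree_0 by auto
        moreover from this have "(\<Oplus>\<^bsub>S\<^esub>g\<in>H. c g \<otimes> g) = (\<Oplus>g\<in>H. c g \<otimes> g)"
          using H(2) by (intro S_finsum[THEN conjunct1] W_mult) auto
        ultimately show ?thesis
          using c by metis
      qed
      then show ?thesis
        using H by blast
    qed
  next
    fix u assume u: "u \<in> W"
    show "\<exists>!c. (\<forall>i. c i \<in> homog A i \<inter> W) \<and> finite {i. c i \<noteq> \<zero>} \<and> u = (\<Oplus>\<^bsub>S\<^esub>i\<in>{i. c i \<noteq> \<zero>}. c i)"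
    proof (rule ex1I[of _ "G.coef u"])
      have "u \<in> carrier A"
        using u by simp
      from G.coef[OF this] show "(\<forall>i. G.coef u i \<in> homog A i \<inter> W) \<and> finite {i. G.coef u i \<noteq> \<zero>} \<and>
          u = (\<Oplus>\<^bsub>S\<^esub>i\<in>{i. G.coef u i \<noteq> \<zero>}. G.coef u i)"
        using S_finsum[of "{i. G.coef u i \<noteq> \<zero>}" "G.coef u"] W_coef[OF u] by auto
      fix c assume c: "(\<forall>i. c i \<in> homog A i \<inter> W) \<and> finite {i. c i \<noteq> \<zero>} \<and> u = (\<Oplus>\<^bsub>S\<^esub>i\<in>{i. c i \<noteq> \<zero>}. c i)"
      then have "u = (\<Oplus>i\<in>{i. c i \<noteq> \<zero>}. c i)"
        using S_finsum[of "{i. c i \<noteq> \<zero>}" c] by auto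
      then have "G.coef u = c"
        using c by (intro G.coef_unique[of "{i. c i \<noteq> \<zero>}"]) auto
      then show "c = G.coef u"
        by simp
    qed
  next
    have "degree_zero_ring S = degree_zero_ring A\<lparr>homog := homog S\<rparr>"
      using W_degree_0 by (simp add: degree_zero_ring_def sub_dga_def Int_absorb2)
    then show "noetherian_ring (degree_zero_ring S)"
      using degree_zero_noetherian by (simp only: noetherian_ring_homog_update)
  next
    fix u v i j assume uv: "u \<in> homog A i \<inter> W" "v \<in> homog A j \<inter> W"
    then show "u \<otimes> v \<in> homog A (i + j) \<inter> W"
      by (simp add: mult_comp W_mult)
    show "u \<otimes> v = signed S (int (i * j)) (v \<otimes> u)"
      using graded_commute[of u i v j] uv by (simp add: W_mult)
    show "diff A (u \<otimes> v) = diff A u \<otimes> v \<oplus> signed S (int i) (u \<otimes> diff A v)"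
      using leibniz[of u i v j] uv by (simp add: W_mult W_diff)
  next
    fix u i assume "u \<in> homog A (Suc i) \<inter> W"
    then show "diff A u \<in> homog A i \<inter> W"
      by (simp add: diff_comp_Suc W_diff)
  next
    fix u i assume "u \<in> homog A i \<inter> W" "odd i"
    then show "u \<otimes> u = \<zero>"
      using odd_square by blast
  qed (simp_all add: smult_mult_left smult_mult_right one_comp diff_add diff_smult diff_comp_0 diff_diff)
  then show ?thesis
    by (simp add: dg_subalgebra_def W_carrier)
qed

end

text \<open>Generators are a set and not a family, so when q identifies some of them, their
  coefficients have to be added.\<close>

lemma (in dga) finsum_regroup:
  assumes H: "finite H" and c: "c \<in> H \<rightarrow> homog A 0" and q: "q \<in> H \<rightarrow> carrier A"
  shows "\<exists>c'\<in>q ` H \<rightarrow> homog A 0. (\<Oplus>g\<in>H. c g \<otimes> q g) = (\<Oplus>h\<in>q ` H. c' h \<otimes> h)"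
proof (intro bexI)
  let ?F = "\<lambda>h. {g \<in> H. q g = h}"
  let ?c = "\<lambda>h. \<Oplus>g\<in>?F h. c g"
  have cq: "c g \<in> homog A 0" "c g \<in> carrier A" "q g \<in> carrier A" if "g \<in> H" for g
    using c q that by auto
  have "(\<Oplus>g\<in>\<Union>(?F ` q ` H). c g \<otimes> q g) = (\<Oplus>h\<in>q ` H. \<Oplus>g\<in>?F h. c g \<otimes> q g)"
    by (rule add.finprod_UN_disjoint) (use H cq in \<open>auto simp: pairwise_def disjnt_def\<close>)
  moreover have "\<Union>(?F ` q ` H) = H"
    by auto
  moreover have "(\<Oplus>h\<in>q ` H. \<Oplus>g\<in>?F h. c g \<otimes> q g) = (\<Oplus>h\<in>q ` H. ?c h \<otimes> h)"
  proof (rule finsum_cong')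
    fix h assume h: "h \<in> q ` H"
    have "(\<Oplus>g\<in>?F h. c g \<otimes> q g) = (\<Oplus>g\<in>?F h. c g \<otimes> h)"
      by (rule finsum_cong') (use cq h in auto)
    then show "(\<Oplus>g\<in>?F h. c g \<otimes> q g) = ?c h \<otimes> h"
      using H cq h by (subst finsum_ldistr) auto
  qed (use cq in \<open>auto intro!: m_closed finsum_closed\<close>)
  ultimately show "(\<Oplus>g\<in>H. c g \<otimes> q g) = (\<Oplus>h\<in>q ` H. ?c h \<otimes> h)"
    by simp
  show "?c \<in> q ` H \<rightarrow> homog A 0"
    using cq by (intro Pi_I homog_finsum) auto
qed

section \<open>The chain of common kernels\<close>

locale exterior_family = dga +
  fixes n :: nat and \<phi> :: "nat \<Rightarrow> 'c \<Rightarrow> 'c" and z :: "nat \<Rightarrow> 'c"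
  assumes \<phi>: "i \<in> {1..n} \<Longrightarrow> chain_odd_derivation R A (\<phi> i)"
    and z: "i \<in> {1..n} \<Longrightarrow> z i \<in> homog A (Suc 0)" and dz: "i \<in> {1..n} \<Longrightarrow> diff A (z i) = \<zero>"
    and \<phi>z: "\<lbrakk>i \<in> {1..n}; j \<in> {1..n}\<rbrakk> \<Longrightarrow> \<phi> i (z j) = (if i = j then \<one> else \<zero>)"
    and square: "\<lbrakk>i \<in> {1..n}; u \<in> carrier A\<rbrakk> \<Longrightarrow> \<phi> i (\<phi> i u) = \<zero>"
    and anticommute: "\<lbrakk>i \<in> {1..n}; j \<in> {1..n}; i \<noteq> j; u \<in> carrier A\<rbrakk> \<Longrightarrow> \<phi> i (\<phi> j u) \<oplus> \<phi> j (\<phi> i u) = \<zero>"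
begin

lemma odd: "i \<in> {1..n} \<Longrightarrow> odd_derivation R A (\<phi> i)"
  using \<phi> chain_odd_derivation.axioms(1) by blast

lemmas \<phi>_closed [simp, intro] = odd_derivation.closed[OF odd]
lemmas \<phi>_plus = odd_derivation.plus[OF odd]
lemmas \<phi>_zero [simp] = odd_derivation.zero[OF odd]
lemmas \<phi>_neg = odd_derivation.neg[OF odd]
lemmas \<phi>_minus = odd_derivation.minus[OF odd]
lemmas \<phi>_product = odd_derivation.product[OF odd]

lemma z_carrier [simp, intro]: "i \<in> {1..n} \<Longrightarrow> z i \<in> carrier A"
  using z by auto

lemma involution_zero: "involution A \<zero> = \<zero>"
  by (rule add_rules[OF involution(1)])

lemma neg_eq_zero: "\<lbrakk>u \<in> carrier A; \<ominus> u = \<zero>\<rbrakk> \<Longrightarrow> u = \<zero>"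
  using minus_minus[of u] by simp

text \<open>A filtration interpolating between W, for k = 1, and the whole algebra, for k = n + 1,
  where the index range is empty. Passing from k to k + 1 adjoins the single variable
  \<open>z k\<close>.\<close>

definition kernel :: "nat \<Rightarrow> 'c set" where
  "kernel k = {u \<in> carrier A. \<forall>i\<in>{k..n}. \<phi> i u = \<zero>}"

lemma kernel_carrier [simp]: "u \<in> kernel k \<Longrightarrow> u \<in> carrier A"
  by (simp add: kernel_def)

lemma kernel_split:
  assumes k: "k \<in> {1..n}"
  shows "kernel k = {u \<in> kernel (Suc k). \<phi> k u = \<zero>}"
proof -
  have "{k..n} = insert k {Suc k..n}"
    using k by auto
  then show ?thesis
    unfolding kernel_def by auto
qed

lemma range: "\<lbrakk>1 \<le> k; i \<in> {k..n}\<rbrakk> \<Longrightarrow> i \<in> {1..n}"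
  by auto

lemma kernel_closed:
  assumes k: "1 \<le> k"
  shows "\<zero> \<in> kernel k" "\<lbrakk>u \<in> kernel k; v \<in> kernel k\<rbrakk> \<Longrightarrow> u \<oplus> v \<in> kernel k"
    "u \<in> kernel k \<Longrightarrow> \<ominus> u \<in> kernel k" "\<lbrakk>u \<in> kernel k; v \<in> kernel k\<rbrakk> \<Longrightarrow> u \<ominus> v \<in> kernel k"
    "\<lbrakk>u \<in> kernel k; v \<in> kernel k\<rbrakk> \<Longrightarrow> u \<otimes> v \<in> kernel k" "u \<in> kernel k \<Longrightarrow> involution A u \<in> kernel k"
proof -
  note r = range[OF k]
  show "u \<in> kernel k \<Longrightarrow> involution A u \<in> kernel k"
  proof -
    assume u: "u \<in> kernel k"
    have "\<phi> i (involution A u) = \<zero>" if "i \<in> {k..n}" for i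
    proof -
      have \<phi>u: "\<phi> i u = \<zero>" and uA: "u \<in> carrier A"
        using u that unfolding kernel_def by blast+
      have "\<ominus> \<phi> i (involution A u) = involution A (\<phi> i u)"
        using odd_derivation.involution_commute[OF odd[OF r[OF that]] uA] by (rule sym)
      then show ?thesis
        using neg_eq_zero[OF \<phi>_closed[OF r[OF that] involution_closed[OF uA]]]
        unfolding \<phi>u involution_zero by blast
    qed
    then show "involution A u \<in> kernel k"
      using u by (simp add: kernel_def del: kernel_carrier)
  qed
  show "\<lbrakk>u \<in> kernel k; v \<in> kernel k\<rbrakk> \<Longrightarrow> u \<otimes> v \<in> kernel k"
    using r by (auto simp: kernel_def \<phi>_product simp del: kernel_carrier)
qed (use range[OF k] in \<open>auto simp: kernel_def \<phi>_plus \<phi>_neg \<phi>_minus a_minus_def simp del: kernel_carrier\<close>)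

lemma kernel_mult_z:
  assumes k: "k \<in> {1..n}" and u: "u \<in> kernel (Suc k)"
  shows "u \<otimes> z k \<in> kernel (Suc k)"
  using u k by (auto simp: kernel_def \<phi>_product \<phi>z simp del: kernel_carrier)

text \<open>Here the relations between the derivations enter: anticommutation keeps the value in the
  kernels for i > k, and square zero puts it into the kernel of \<open>\<phi> k\<close>.\<close>

lemma kernel_\<phi>:
  assumes k: "k \<in> {1..n}" and u: "u \<in> kernel (Suc k)"
  shows "\<phi> k u \<in> kernel k"
proof -
  have "\<phi> i (\<phi> k u) = \<zero>" if i: "i \<in> {Suc k..n}" for i
  proof -
    have "i \<in> {1..n}" "i \<noteq> k" "\<phi> i u = \<zero>" "u \<in> carrier A"
      using i k u by (auto simp: kernel_def simp del: kernel_carrier)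
    then show ?thesis
      using anticommute[of i k u] k by simp
  qed
  then show ?thesis
    using square[of k u] u k unfolding kernel_split[OF k] by (auto simp: kernel_def simp del: kernel_carrier)
qed

text \<open>The coefficient of \<open>z k\<close>: if \<open>\<phi> k\<close> kills a and b, then
  its value on a + b z_k is the involution of b, which a second involution turns back into
  b.\<close>

definition cof :: "nat \<Rightarrow> 'c \<Rightarrow> 'c" where
  "cof k u = involution A (\<phi> k u)"

definition res :: "nat \<Rightarrow> 'c \<Rightarrow> 'c" where
  "res k u = u \<ominus> cof k u \<otimes> z k"

text \<open>\<open>\<phi> k\<close> takes the same value on u and on its part
  \<open>cof k u \<otimes> z k\<close>, so it kills the difference. The part itself stays in
  \<open>kernel (Suc k)\<close> because the later derivations kill \<open>z k\<close>.\<close>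

lemma res_cof:
  assumes k: "k \<in> {1..n}" and u: "u \<in> kernel (Suc k)"
  shows "cof k u \<in> kernel k" "res k u \<in> kernel k" "u = res k u \<oplus> cof k u \<otimes> z k"
proof -
  have k1: "1 \<le> k"
    using k by simp
  show c: "cof k u \<in> kernel k"
    unfolding cof_def by (intro kernel_closed k1 kernel_\<phi> k u)
  then have c': "cof k u \<in> kernel (Suc k)" and \<phi>c: "\<phi> k (cof k u) = \<zero>"
    using kernel_split[OF k] by auto
  have carr: "cof k u \<in> carrier A" "u \<in> carrier A" "z k \<in> carrier A" "cof k u \<otimes> z k \<in> carrier A"
    using c u k by auto
  have "res k u \<in> kernel (Suc k)"
    unfolding res_def by (intro kernel_closed u kernel_mult_z k c') simp
  moreover have "\<phi> k (cof k u \<otimes> z k) = \<phi> k u"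
    using carr k \<phi>c \<phi>z[OF k k] by (simp add: \<phi>_product) (simp add: cof_def)
  then have "\<phi> k (res k u) = \<zero>"
    using carr k by (simp add: res_def \<phi>_minus)
  ultimately show "res k u \<in> kernel k"
    unfolding kernel_split[OF k] by simp
  show "u = res k u \<oplus> cof k u \<otimes> z k"
    using carr by (simp add: res_def a_minus_def a_assoc l_neg)
qed

text \<open>Together with \<open>res_cof\<close>, this makes \<open>kernel (Suc k)\<close> free over
  \<open>kernel k\<close> with basis 1 and \<open>z k\<close>.\<close>

lemma decomposition_unique:
  assumes k: "k \<in> {1..n}" and a: "a \<in> kernel k" "b \<in> kernel k"
  shows "a \<oplus> b \<otimes> z k \<in> kernel (Suc k)" "cof k (a \<oplus> b \<otimes> z k) = b" "res k (a \<oplus> b \<otimes> z k) = a"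
proof -
  have a': "a \<in> kernel (Suc k)" "\<phi> k a = \<zero>" and b': "b \<in> kernel (Suc k)" "\<phi> k b = \<zero>"
    using a kernel_split[OF k] by auto
  have carr: "a \<in> carrier A" "b \<in> carrier A" "z k \<in> carrier A" "b \<otimes> z k \<in> carrier A"
    using a k by auto
  show "a \<oplus> b \<otimes> z k \<in> kernel (Suc k)"
    by (intro kernel_closed a' kernel_mult_z k b') simp
  show c: "cof k (a \<oplus> b \<otimes> z k) = b"
    using carr k a' b' \<phi>z[OF k k] by (simp add: cof_def \<phi>_plus \<phi>_product)
  show "res k (a \<oplus> b \<otimes> z k) = a"
    unfolding res_def c using carr by (simp add: a_minus_def a_assoc r_neg)
qed

text \<open>The maps \<open>res k\<close> are composed in descending order of the index, from n on.
  They are linear over A_0 because \<open>\<phi> k\<close> kills degree 0, and they keep degrees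
  because multiplication by \<open>z k\<close> restores the degree lost. The purpose is finite
  generation of the components of the kernel.\<close>

lemma projection:
  assumes "1 \<le> k" "k \<le> Suc n"
  shows "\<exists>p. p \<in> add_hom A A \<and> (\<forall>u\<in>carrier A. p u \<in> kernel k) \<and> (\<forall>i. \<forall>u\<in>homog A i. p u \<in> homog A i) \<and>
    (\<forall>c\<in>homog A 0. \<forall>u\<in>carrier A. p (c \<otimes> u) = c \<otimes> p u) \<and> (\<forall>u\<in>kernel k. p u = u)"
  using assms(2,1)
proof (induction rule: inc_induct)
  case base
  show ?case
    by (rule exI[of _ "\<lambda>u. u"]) (auto simp: kernel_def hom_def simp del: kernel_carrier)
next
  case (step k)
  then obtain p where p: "p \<in> add_hom A A" "\<And>u. u \<in> carrier A \<Longrightarrow> p u \<in> kernel (Suc k)"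
    "\<And>i u. u \<in> homog A i \<Longrightarrow> p u \<in> homog A i"
    "\<And>c u. \<lbrakk>c \<in> homog A 0; u \<in> carrier A\<rbrakk> \<Longrightarrow> p (c \<otimes> u) = c \<otimes> p u" "\<And>u. u \<in> kernel (Suc k) \<Longrightarrow> p u = u"
    by auto
  have k: "k \<in> {1..n}"
    using step by auto
  note pc = add_hom_closed[OF p(1)]
  interpret f: odd_derivation R A "\<phi> k"
    by (rule odd[OF k])
  have cof_add: "cof k (u \<oplus> v) = cof k u \<oplus> cof k v" if "u \<in> carrier A" "v \<in> carrier A" for u v
    using that by (simp add: cof_def f.plus involution_add)
  have cof_closed: "cof k u \<in> carrier A" if "u \<in> carrier A" for u
    using that by (simp add: cof_def)
  have res_closed: "res k u \<in> carrier A" if "u \<in> carrier A" for u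
    using that k cof_closed by (simp add: res_def)
  have "(\<lambda>u. res k (p u)) \<in> add_hom A A"
    by (rule add_homI)
      (use pc k cof_closed res_closed in \<open>auto simp: res_def add_hom_add[OF p(1)] cof_add l_distr a_minus_def minus_add a_ac\<close>)
  moreover have "res k (p u) \<in> kernel k" if "u \<in> carrier A" for u
    using res_cof(2)[OF k p(2)[OF that]] .
  moreover have "res k (p u) \<in> homog A i" if u: "u \<in> homog A i" for i u
  proof (cases i)
    case 0
    then have "cof k (p u) = \<zero>"
      using f.degree_0[of "p u"] p(3)[OF u] involution_zero by (simp add: cof_def)
    then show ?thesis
      using p(3)[OF u] k by (simp add: res_def a_minus_def)
  next
    case (Suc j)
    then have "cof k (p u) \<otimes> z k \<in> homog A (j + Suc 0)"
      unfolding cof_def using f.degree_Suc[of "p u" j] p(3)[OF u]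
      by (intro mult_comp involution_homog z k) simp
    then show ?thesis
      using p(3)[OF u] Suc by (simp add: res_def homog_diff)
  qed
  moreover have "res k (p (c \<otimes> u)) = c \<otimes> res k (p u)" if c: "c \<in> homog A 0" and u: "u \<in> carrier A" for c u
  proof -
    have [simp]: "c \<in> carrier A" and inv: "involution A c = c"
      using c involution(2)[OF c] by (auto simp: signed_even)
    have "cof k (c \<otimes> p u) = c \<otimes> cof k (p u)"
      using pc[OF u] f.degree_0[OF c] by (simp add: cof_def f.product involution_mult inv)
    then show ?thesis
      using pc[OF u] cof_closed[OF pc[OF u]] k
      by (simp add: p(4)[OF c u] res_def a_minus_def r_distr r_minus m_assoc)
  qed
  moreover have "res k (p u) = u" if u: "u \<in> kernel k" for u
  proof -
    have "u \<in> kernel (Suc k)" "\<phi> k u = \<zero>"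
      using u kernel_split[OF k] by auto
    then show ?thesis
      using p(5)[of u] k u involution_zero by (simp add: res_def cof_def a_minus_def)
  qed
  ultimately show ?case
    by (intro exI[of _ "\<lambda>u. res k (p u)"]) auto
qed

lemma kernel_1: "kernel 1 = {u \<in> carrier A. \<forall>i\<in>{1..n}. \<phi> i u = \<zero>}"
  by (simp add: kernel_def del: kernel_carrier)

text \<open>Since each derivation shifts components, the components of an element of the kernel lie
  in the kernel again.\<close>

lemma coef_\<phi>:
  assumes i: "i \<in> {1..n}" and u: "u \<in> carrier A"
  shows "\<phi> i (G.coef u 0) = \<zero>" "\<phi> i (G.coef u (Suc k)) = G.coef (\<phi> i u) k"
proof -
  interpret f: odd_derivation R A "\<phi> i"
    by (rule odd[OF i])
  show "\<phi> i (G.coef u 0) = \<zero>"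
    using G.coef(1)[OF u] f.degree_0 by blast
  have "\<forall>k. \<phi> i (G.coef u (Suc k)) = G.coef (\<phi> i u) k"
    using u
  proof (induction rule: homog_induct)
    case (homog j u)
    show ?case
    proof (cases j)
      case 0
      then show ?thesis
        using homog f.degree_0[of u] coef_homog[OF homog] coef_homog[OF homog_zero] by simp
    next
      case (Suc l)
      then have "\<phi> i u \<in> homog A l"
        using homog f.degree_Suc by simp
      then show ?thesis
        using Suc coef_homog[OF homog] coef_homog[of "\<phi> i u" l] by simp
    qed
  next
    case (add u v)
    have "G.coef u k \<in> carrier A" "G.coef v k \<in> carrier A" for k
      using G.coef(1) add.hyps homog_carrier by blast+
    then show ?case
      using add by (simp add: G.coef_add f.plus)
  qed
  then show "\<phi> i (G.coef u (Suc k)) = G.coef (\<phi> i u) k"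
    by blast
qed

sublocale W: sub_dga_closed R A "kernel 1"
proof
  fix u i assume u: "u \<in> kernel 1"
  have "\<phi> j (G.coef u i) = \<zero>" if "j \<in> {1..n}" for j
    using coef_\<phi>[OF that, of u] u that coef_homog[OF homog_zero[of 0]] by (cases i) (auto simp: kernel_def simp del: kernel_carrier)
  moreover have "G.coef u i \<in> carrier A"
    using G.coef(1)[of u i] kernel_carrier[OF u] homog_carrier by blast
  ultimately show "G.coef u i \<in> kernel 1"
    by (simp add: kernel_def del: kernel_carrier)
next
  fix i
  \<comment> \<open>p fixes the kernel and is linear over A_0, so it carries generators of a
    component of the algebra to generators of the corresponding component of the kernel.\<close>
  obtain p where p: "p \<in> add_hom A A" "\<And>u. u \<in> carrier A \<Longrightarrow> p u \<in> kernel 1"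
    "\<And>i u. u \<in> homog A i \<Longrightarrow> p u \<in> homog A i"
    "\<And>c u. \<lbrakk>c \<in> homog A 0; u \<in> carrier A\<rbrakk> \<Longrightarrow> p (c \<otimes> u) = c \<otimes> p u" "\<And>u. u \<in> kernel 1 \<Longrightarrow> p u = u"
    using projection[of 1] by auto
  obtain H where H: "finite H" "H \<subseteq> homog A i"
    and gen: "\<And>u. u \<in> homog A i \<Longrightarrow> \<exists>c\<in>H \<rightarrow> homog A 0. u = (\<Oplus>g\<in>H. c g \<otimes> g)"
    using comp_fin_gen[of i] by blast
  have "\<exists>c\<in>p ` H \<rightarrow> homog A 0. u = (\<Oplus>g\<in>p ` H. c g \<otimes> g)" if u: "u \<in> homog A i \<inter> kernel 1" for u
  proof -
    obtain c where c: "c \<in> H \<rightarrow> homog A 0" "u = (\<Oplus>g\<in>H. c g \<otimes> g)"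
      using gen u by blast
    have cH: "c g \<in> carrier A" "g \<in> carrier A" if "g \<in> H" for g
      using c H that by auto
    have "u = p (\<Oplus>g\<in>H. c g \<otimes> g)"
      using p(5)[of u] u c(2) by simp
    also have "\<dots> = (\<Oplus>g\<in>H. p (c g \<otimes> g))"
      by (rule add_hom_finsum[OF is_abelian is_abelian p(1)]) (use cH in auto)
    also have "\<dots> = (\<Oplus>g\<in>H. c g \<otimes> p g)"
      by (rule finsum_cong') (use cH p(4)[OF funcset_mem[OF c(1)]] add_hom_closed[OF p(1)] in auto)
    finally show ?thesis
      using finsum_regroup[OF H(1) c(1), of p] add_hom_closed[OF p(1)] cH by auto
  qed
  then show "\<exists>H. finite H \<and> H \<subseteq> homog A i \<inter> kernel 1 \<and>
      (\<forall>u\<in>homog A i \<inter> kernel 1. \<exists>c\<in>H \<rightarrow> homog A 0. u = (\<Oplus>g\<in>H. c g \<otimes> g))"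
    using H p(2,3) by (intro exI[of _ "p ` H"]) auto
next
  fix u assume u: "u \<in> kernel 1"
  have "\<phi> i (diff A u) = \<zero>" if i: "i \<in> {1..n}" for i
  proof -
    have \<phi>u: "\<phi> i u = \<zero>" and uA: "u \<in> carrier A"
      using u i unfolding kernel_def by blast+
    have "\<ominus> \<phi> i (diff A u) = diff A (\<phi> i u)"
      using chain_odd_derivation.chain[OF \<phi>[OF i] uA] by (rule sym)
    then show ?thesis
      using neg_eq_zero[OF \<phi>_closed[OF i diff_closed[OF uA]]] unfolding \<phi>u diff_zero by blast
  qed
  then show "diff A u \<in> kernel 1"
    using u by (simp add: kernel_def del: kernel_carrier)
next
  show "homog A 0 \<subseteq> kernel 1"
    using odd_derivation.degree_0[OF odd] by (auto simp: kernel_def simp del: kernel_carrier)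
  show "r \<odot> u \<in> kernel 1" if "r \<in> carrier R" "u \<in> kernel 1" for r u
    using that odd_derivation.linear[OF odd] by (auto simp: kernel_def simp del: kernel_carrier)
qed (auto intro: kernel_closed)

section \<open>Expansion in monomials of the exterior variables\<close>

definition words :: "nat \<Rightarrow> nat list set" where
  "words k = {xs. set xs \<subseteq> {k..n} \<and> sorted_wrt (<) xs}"

lemma words_top: "words (Suc n) = {[]}"
  by (auto simp: words_def)

lemma words_split:
  assumes "k \<le> n"
  shows "words k = words (Suc k) \<union> (#) k ` words (Suc k)" "words (Suc k) \<inter> (#) k ` words (Suc k) = {}"
proof
  show "words (Suc k) \<inter> (#) k ` words (Suc k) = {}"
    by (auto simp: words_def)
  show "words (Suc k) \<union> (#) k ` words (Suc k) \<subseteq> words k"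
    using assms by (force simp: words_def)
  show "words k \<subseteq> words (Suc k) \<union> (#) k ` words (Suc k)"
  proof
    fix xs assume xs: "xs \<in> words k"
    show "xs \<in> words (Suc k) \<union> (#) k ` words (Suc k)"
    proof (cases xs)
      case Nil
      then show ?thesis
        by (simp add: words_def)
    next
      case (Cons y ys)
      have y: "k \<le> y" "y \<le> n" "\<And>x. x \<in> set ys \<Longrightarrow> y < x \<and> x \<le> n" "sorted_wrt (<) ys"
        using xs by (auto simp: words_def Cons)
      show ?thesis
      proof (cases "y = k")
        case True
        then show ?thesis
          using y by (auto simp: words_def Cons Suc_le_eq)
      next
        case False
        then have "\<And>x. x \<in> set ys \<Longrightarrow> k < x"
          using y by (meson le_less_trans)
        then show ?thesis
          using y False by (auto simp: words_def Cons Suc_le_eq)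
      qed
    qed
  qed
qed

lemma finite_words: "k \<le> Suc n \<Longrightarrow> finite (words k)"
  by (induction rule: inc_induct) (simp_all add: words_top words_split(1))

lemma monomial_closed: "\<lbrakk>1 \<le> k; xs \<in> words k\<rbrakk> \<Longrightarrow> monomial A z xs \<in> carrier A"
  by (induction xs) (auto simp: monomial_def words_def)

text \<open>Words are paired according to whether they start with k, and the leading factor
  \<open>z k\<close> is absorbed into the coefficient. This trades coefficients from
  \<open>kernel k\<close> for coefficients from \<open>kernel (Suc k)\<close>.\<close>

lemma words_sum:
  assumes k: "k \<in> {1..n}" and c: "\<And>xs. xs \<in> words k \<Longrightarrow> c xs \<in> carrier A"
  shows "(\<Oplus>xs\<in>words k. c xs \<otimes> monomial A z xs) =
    (\<Oplus>xs\<in>words (Suc k). (c xs \<oplus> c (k # xs) \<otimes> z k) \<otimes> monomial A z xs)"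
proof -
  have split: "words k = words (Suc k) \<union> (#) k ` words (Suc k)" "words (Suc k) \<inter> (#) k ` words (Suc k) = {}"
    using words_split k by auto
  have fin: "finite (words (Suc k))"
    using finite_words k by auto
  have [simp]: "monomial A z xs \<in> carrier A" "c xs \<in> carrier A" "c (k # xs) \<in> carrier A"
    if "xs \<in> words (Suc k)" for xs
    using monomial_closed[OF _ that] c split(1) that by auto
  have [simp]: "z k \<in> carrier A"
    using k by simp
  have Cons: "monomial A z (k # xs) = z k \<otimes> monomial A z xs" for xs
    by (simp add: monomial_def)
  have "(\<Oplus>xs\<in>words k. c xs \<otimes> monomial A z xs) =
      (\<Oplus>xs\<in>words (Suc k). c xs \<otimes> monomial A z xs) \<oplus> (\<Oplus>xs\<in>(#) k ` words (Suc k). c xs \<otimes> monomial A z xs)"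
    unfolding split(1) by (rule finsum_Un_disjoint) (use fin split(2) in \<open>auto simp: Cons\<close>)
  also have "(\<Oplus>xs\<in>(#) k ` words (Suc k). c xs \<otimes> monomial A z xs) =
      (\<Oplus>xs\<in>words (Suc k). c (k # xs) \<otimes> monomial A z (k # xs))"
    by (rule finsum_reindex) (auto simp: Cons)
  also have "(\<Oplus>xs\<in>words (Suc k). c xs \<otimes> monomial A z xs) \<oplus> \<dots> =
      (\<Oplus>xs\<in>words (Suc k). c xs \<otimes> monomial A z xs \<oplus> c (k # xs) \<otimes> monomial A z (k # xs))"
    by (rule finsum_addf[symmetric]) (auto simp: Cons)
  also have "\<dots> = (\<Oplus>xs\<in>words (Suc k). (c xs \<oplus> c (k # xs) \<otimes> z k) \<otimes> monomial A z xs)"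
    by (rule finsum_cong') (auto simp: Cons l_distr m_assoc)
  finally show ?thesis .
qed

definition expansion :: "nat \<Rightarrow> 'c \<Rightarrow> (nat list \<Rightarrow> 'c) \<Rightarrow> bool" where
  "expansion k u c \<longleftrightarrow> (\<forall>xs\<in>words k. c xs \<in> kernel k) \<and> (\<forall>xs. xs \<notin> words k \<longrightarrow> c xs = \<zero>) \<and>
    u = (\<Oplus>xs\<in>words k. c xs \<otimes> monomial A z xs)"

lemma expansion_step:
  assumes k: "k \<in> {1..n}" and c: "expansion k u c"
  shows "expansion (Suc k) u (\<lambda>xs. if xs \<in> words (Suc k) then c xs \<oplus> c (k # xs) \<otimes> z k else \<zero>)"
proof -
  have split: "words k = words (Suc k) \<union> (#) k ` words (Suc k)"
    using words_split k by auto
  have ck: "c xs \<in> kernel k" if "xs \<in> words k" for xs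
    using c that by (simp add: expansion_def)
  have closed: "c xs \<oplus> c (k # xs) \<otimes> z k \<in> kernel (Suc k)" if "xs \<in> words (Suc k)" for xs
    using decomposition_unique(1)[OF k ck ck, of xs "k # xs"] split that by auto
  have "u = (\<Oplus>xs\<in>words (Suc k). (c xs \<oplus> c (k # xs) \<otimes> z k) \<otimes> monomial A z xs)"
    using c words_sum[OF k kernel_carrier[OF ck]] by (simp add: expansion_def)
  also have "\<dots> = (\<Oplus>xs\<in>words (Suc k). (if xs \<in> words (Suc k) then c xs \<oplus> c (k # xs) \<otimes> z k else \<zero>) \<otimes> monomial A z xs)"
    by (rule finsum_cong') (use kernel_carrier[OF closed] monomial_closed[of "Suc k"] in auto)
  finally show ?thesis
    using closed by (simp add: expansion_def)
qed

text \<open>At k = n + 1 only the empty word remains and its coefficient is u. Going down, equality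
  of the merged coefficients splits by uniqueness of the decomposition along
  \<open>z k\<close>.\<close>

lemma expansion_unique:
  assumes "1 \<le> k" "k \<le> Suc n" "expansion k u c" "expansion k u d"
  shows "c = d"
  using assms(2,1,3,4)
proof (induction arbitrary: c d rule: inc_induct)
  case base
  have "c [] = d []"
    using base monomial_closed[of "Suc n" "[]"] by (auto simp: expansion_def words_top monomial_def finsum_insert)
  then have "c xs = d xs" for xs
    using base by (cases "xs = []") (auto simp: expansion_def words_top)
  then show ?case
    by blast
next
  case (step k)
  have k: "k \<in> {1..n}"
    using step by auto
  have split: "words k = words (Suc k) \<union> (#) k ` words (Suc k)"
    using words_split k by auto
  have eq: "(\<lambda>xs. if xs \<in> words (Suc k) then c xs \<oplus> c (k # xs) \<otimes> z k else \<zero>) =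
      (\<lambda>xs. if xs \<in> words (Suc k) then d xs \<oplus> d (k # xs) \<otimes> z k else \<zero>)"
    using step by (intro step.IH expansion_step k) simp_all
  have "c xs = d xs \<and> c (k # xs) = d (k # xs)" if xs: "xs \<in> words (Suc k)" for xs
  proof -
    have "c xs \<oplus> c (k # xs) \<otimes> z k = d xs \<oplus> d (k # xs) \<otimes> z k"
      using fun_cong[OF eq, of xs] xs by simp
    moreover have "c ys \<in> kernel k \<and> d ys \<in> kernel k" if "ys \<in> {xs, k # xs}" for ys
      using that xs split step.prems by (auto simp: expansion_def)
    ultimately show ?thesis
      using decomposition_unique(2,3)[OF k] by (metis insertI1 insertI2)
  qed
  then have "c xs = d xs" for xs
    using step.prems split by (cases "xs \<in> words k") (auto simp: expansion_def)
  then show ?case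
    by blast
qed

text \<open>Starting from u as the coefficient of the empty word, each descent splits every
  coefficient along one more \<open>z k\<close>.\<close>

lemma expansion_exists:
  assumes "1 \<le> k" "k \<le> Suc n" "u \<in> carrier A"
  shows "\<exists>c. expansion k u c"
  using assms(2,1)
proof (induction rule: inc_induct)
  case base
  have "expansion (Suc n) u (\<lambda>xs. if xs = [] then u else \<zero>)"
  proof -
    have "u \<in> kernel (Suc n)"
      using assms(3) unfolding kernel_def by simp
    moreover have "(\<Oplus>xs\<in>{[]}. (if xs = [] then u else \<zero>) \<otimes> monomial A z xs) = u"
      using assms(3) by (subst finsum_insert) (auto simp: monomial_def)
    ultimately show ?thesis
      by (simp only: expansion_def words_top) simp
  qed
  then show ?case
    by (intro exI)
next
  case (step k)
  then obtain c where c: "expansion (Suc k) u c"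
    by auto
  have k: "k \<in> {1..n}"
    using step by auto
  have split: "words k = words (Suc k) \<union> (#) k ` words (Suc k)" "words (Suc k) \<inter> (#) k ` words (Suc k) = {}"
    using words_split k by auto
  \<comment> \<open>The remainder of a coefficient stays at its word, and its cofactor goes to the
    word with k put in front; \<open>tl\<close> recovers the original word.\<close>
  define d where "d xs = (if xs \<in> words (Suc k) then res k (c xs) else
      if xs \<in> (#) k ` words (Suc k) then cof k (c (tl xs)) else \<zero>)" for xs
  have ck: "c xs \<in> kernel (Suc k)" if "xs \<in> words (Suc k)" for xs
    using c that by (simp add: expansion_def)
  have d: "d xs \<in> kernel k" if "xs \<in> words k" for xs
    using that split res_cof(1,2)[OF k ck] by (auto simp: d_def)
  have d': "d xs \<oplus> d (k # xs) \<otimes> z k = c xs" if xs: "xs \<in> words (Suc k)" for xs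
  proof -
    have "k # xs \<notin> words (Suc k)"
      by (auto simp: words_def)
    then show ?thesis
      using xs res_cof(3)[OF k ck[OF xs]] by (simp add: d_def)
  qed
  have "u = (\<Oplus>xs\<in>words (Suc k). c xs \<otimes> monomial A z xs)"
    using c by (simp add: expansion_def)
  also have "\<dots> = (\<Oplus>xs\<in>words (Suc k). (d xs \<oplus> d (k # xs) \<otimes> z k) \<otimes> monomial A z xs)"
    by (rule finsum_cong') (use d' kernel_carrier[OF ck] monomial_closed[of "Suc k"] in auto)
  also have "\<dots> = (\<Oplus>xs\<in>words k. d xs \<otimes> monomial A z xs)"
    by (rule words_sum[OF k kernel_carrier[OF d], symmetric])
  finally have "expansion k u d"
    using d split(1) by (auto simp: expansion_def d_def)
  then show ?case
    by (intro exI)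
qed

theorem exterior_cycle_extension: "exterior_cycle_extension R (sub_dga A (kernel 1)) A (\<lambda>u. u) n z"
proof -
  define r where "r = {(i, j). i \<in> {1..n} \<and> j \<in> {1..n} \<and> i \<le> j}"
  have lin: "linear_order_on {1..n} r"
    unfolding linear_order_on_def partial_order_on_def preorder_on_def r_def
    by (auto simp: refl_on_def trans_def antisym_def total_on_def)
  \<comment> \<open>All variables have the odd degree 1, so no letter may repeat, and weakly
    increasing words become strictly increasing.\<close>
  have normal: "normal_words {1..n} (\<lambda>_. 1) r = words 1"
  proof -
    have "sorted_wrt (\<lambda>x y. (x, y) \<in> r \<and> (x = y \<longrightarrow> even (1::nat))) xs \<longleftrightarrow> sorted_wrt (<) xs"
      if "set xs \<subseteq> {1..n}" for xs
      using that by (induction xs) (force simp: r_def)+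
    then show ?thesis
      by (auto simp: normal_words_def words_def)
  qed
  have "\<exists>!c. (\<forall>xs\<in>normal_words {1..n} (\<lambda>_. 1) r. c xs \<in> carrier W.S) \<and>
      (\<forall>xs. xs \<notin> normal_words {1..n} (\<lambda>_. 1) r \<longrightarrow> c xs = \<zero>\<^bsub>W.S\<^esub>) \<and> finite {xs. c xs \<noteq> \<zero>\<^bsub>W.S\<^esub>} \<and>
      u = (\<Oplus>xs\<in>{xs. c xs \<noteq> \<zero>\<^bsub>W.S\<^esub>}. c xs \<otimes> monomial A z xs)" if u: "u \<in> carrier A" for u
  proof -
    have fin: "finite (words 1)"
      by (rule finite_words) simp
    have *: "(\<forall>xs\<in>words 1. c xs \<in> kernel 1) \<and> (\<forall>xs. xs \<notin> words 1 \<longrightarrow> c xs = \<zero>) \<and> finite {xs. c xs \<noteq> \<zero>} \<and>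
        u = (\<Oplus>xs\<in>{xs. c xs \<noteq> \<zero>}. c xs \<otimes> monomial A z xs) \<longleftrightarrow> expansion 1 u c" for c
    proof -
      have "finite {xs. c xs \<noteq> \<zero>} \<and>
          (\<Oplus>xs\<in>{xs. c xs \<noteq> \<zero>}. c xs \<otimes> monomial A z xs) = (\<Oplus>xs\<in>words 1. c xs \<otimes> monomial A z xs)"
        if c: "\<forall>xs\<in>words 1. c xs \<in> kernel 1" "\<forall>xs. xs \<notin> words 1 \<longrightarrow> c xs = \<zero>"
      proof
        have sub: "{xs. c xs \<noteq> \<zero>} \<subseteq> words 1"
          using c by blast
        then show "finite {xs. c xs \<noteq> \<zero>}"
          using fin by (rule finite_subset)
        show "(\<Oplus>xs\<in>{xs. c xs \<noteq> \<zero>}. c xs \<otimes> monomial A z xs) = (\<Oplus>xs\<in>words 1. c xs \<otimes> monomial A z xs)"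
          by (rule add.finprod_mono_neutral_cong_left[OF fin sub]) (use c kernel_carrier[of _ 1] monomial_closed[of 1] in auto)
      qed
      then show ?thesis
        unfolding expansion_def by auto
    qed
    have "\<exists>!c. expansion 1 u c"
      using expansion_exists[of 1 u] expansion_unique[of 1 u] u by auto
    then show ?thesis
      unfolding normal W.sub_simps * .
  qed
  then have "free_variables W.S A (\<lambda>u. u) {1..n} (\<lambda>_. 1) z"
    unfolding free_variables_def using lin z by (intro conjI exI[of _ r]) auto
  moreover have "(\<lambda>u. u) \<in> dga_hom R W.S A"
    by (rule W.inclusion_hom)
  moreover have "dg_algebra R W.S"
    using W.dg_subalgebra by (simp add: dg_subalgebra_def)
  \<comment> \<open>The boundaries of the \<open>z i\<close> are zero, which still has to be
    exhibited in the generated subring, as 1 + (-1).\<close>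
  moreover have "\<zero> \<in> generate_ring A H" for H
    using generate_ring.eng_add[OF generate_ring.one generate_ring.a_inv[OF generate_ring.one], of A H] by (simp add: r_neg)
  ultimately show ?thesis
    using dz dg_algebra_axioms
    by (simp add: exterior_cycle_extension_def semi_free_extension_def)
qed

end

section \<open>Derivations of minimal models\<close>

lemma minimal_model_free:
  assumes "minimal_model R I B X \<delta> \<xi> \<epsilon>"
  obtains ord where "free_dga R B X \<delta> \<xi> ord"
proof -
  have sf: "semi_free_extension R (concentrated (\<lambda>r. r) R) B (scalar B) X \<delta> \<xi>"
    using assms by (simp add: minimal_model_def)
  then have B: "dg_algebra R B" and fv: "free_variables (concentrated (\<lambda>r. r) R) B (scalar B) X \<delta> \<xi>"
    by (auto simp: semi_free_extension_def)
  then obtain ord where "linear_order_on X ord"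
    "\<And>u. u \<in> carrier B \<Longrightarrow> \<exists>!c. (\<forall>xs\<in>normal_words X \<delta> ord. c xs \<in> carrier R) \<and>
          (\<forall>xs. xs \<notin> normal_words X \<delta> ord \<longrightarrow> c xs = \<zero>\<^bsub>R\<^esub>) \<and> finite {xs. c xs \<noteq> \<zero>\<^bsub>R\<^esub>} \<and>
          u = (\<Oplus>\<^bsub>B\<^esub>xs\<in>{xs. c xs \<noteq> \<zero>\<^bsub>R\<^esub>}. scalar B (c xs) \<otimes>\<^bsub>B\<^esub> monomial B \<xi> xs)"
    unfolding free_variables_def concentrated_def by auto
  moreover have "\<And>y. y \<in> X \<Longrightarrow> \<xi> y \<in> homog B (\<delta> y)"
    using fv by (simp add: free_variables_def)
  ultimately have "free_dga R B X \<delta> \<xi> ord"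
    using B by (intro free_dga.intro dga.intro free_dga_axioms.intro)
  then show ?thesis
    by (rule that)
qed

text \<open>Two inputs are supplied to \<open>chain_derivation_exists\<close>. Acyclicity in
  positive degrees holds because the target of \<epsilon> lives in degree 0. In degree 0, a cycle of
  degree 1 is a relation between the generators of I, its image is the coefficient of one
  \<open>a i\<close>, and once this lies in I it is killed by \<epsilon>, hence a boundary.\<close>

lemma minimal_model_derivation:
  fixes B :: "('r, 'b) dga" and n m :: nat
  assumes R: "cring R" and I: "ideal I R"
    and direct_sum: "module_direct_sum (R Quot I) (conormal R I) F C"
    and basis: "module_basis (R Quot I) (conormal R I) F {1..n} (\<lambda>i. ideal_prod R I I +>\<^bsub>R\<^esub> a i)"
    and a: "\<And>i. i \<in> {1..n} \<Longrightarrow> a i \<in> I"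
    and b: "\<And>j. j \<in> {1..m} \<Longrightarrow> b j \<in> I \<and> ideal_prod R I I +>\<^bsub>R\<^esub> b j \<in> C"
    and mm: "minimal_model R I B X \<delta> \<xi> \<epsilon>"
    and bij: "bij_betw (\<lambda>v. diff B (\<xi> v)) {v \<in> X. \<delta> v = 1} (scalar B ` (a ` {1..n} \<union> b ` {1..m}))"
    and x: "\<forall>i\<in>{1..n}. x i \<in> X \<and> \<delta> (x i) = 1 \<and> diff B (\<xi> (x i)) = scalar B (a i)"
    and inj: "inj_on x {1..n}" and i: "i \<in> {1..n}"
  shows "\<exists>\<theta>. chain_odd_derivation R B \<theta> \<and> \<theta> (\<xi> (x i)) = \<one>\<^bsub>B\<^esub> \<and>
    (\<forall>y\<in>X. \<delta> y = 1 \<and> y \<noteq> x i \<longrightarrow> \<theta> (\<xi> y) = \<zero>\<^bsub>B\<^esub>)"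
proof -
  interpret N: conormal_module I R
    using R I by (rule conormal_module.intro[rotated])
  obtain ord where "free_dga R B X \<delta> \<xi> ord"
    using minimal_model_free[OF mm] .
  then interpret B: free_dga R B X \<delta> \<xi> ord .
  let ?Q = "concentrated (\<lambda>r. I +>\<^bsub>R\<^esub> r) (R Quot I)"
  have q: "quasi_iso R B ?Q \<epsilon>" and \<epsilon>: "\<epsilon> \<in> dga_hom R B ?Q"
    using mm by (auto simp: minimal_model_def quasi_iso_def)
  interpret Q: ring "R Quot I"
    by (rule N.quotient_is_ring)
  have \<epsilon>_scalar: "\<epsilon> (scalar B r) = I +>\<^bsub>R\<^esub> r" if "r \<in> carrier R" for r
  proof -
    have "\<epsilon> (scalar B r) = (I +>\<^bsub>R\<^esub> r) \<otimes>\<^bsub>R Quot I\<^esub> \<epsilon> \<one>\<^bsub>B\<^esub>"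
      using \<epsilon> that by (simp add: dga_hom_def scalar_def concentrated_def)
    moreover have "\<epsilon> \<one>\<^bsub>B\<^esub> = \<one>\<^bsub>R Quot I\<^esub>"
      using \<epsilon> by (simp add: dga_hom_def ring_hom_def concentrated_def)
    ultimately show ?thesis
      using N.quot_carrier[OF that] by simp
  qed
  let ?X1 = "{v \<in> X. \<delta> v = 1}"
  have bound: "\<exists>w\<in>homog B (Suc 0). diff B w = \<theta> u"
    if \<theta>: "odd_derivation R B \<theta>" "\<theta> (\<xi> (x i)) = \<one>\<^bsub>B\<^esub>"
      and \<theta>0: "\<And>y. \<lbrakk>y \<in> X; \<delta> y = 1; y \<noteq> x i\<rbrakk> \<Longrightarrow> \<theta> (\<xi> y) = \<zero>\<^bsub>B\<^esub>"
      and u: "u \<in> homog B (Suc 0)" "diff B u = \<zero>\<^bsub>B\<^esub>" for \<theta> u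
  proof -
    interpret t: odd_derivation R B \<theta>
      by (rule \<theta>)
    have pos: "\<And>y. y \<in> X \<Longrightarrow> 1 \<le> \<delta> y"
      using mm by (simp add: minimal_model_def)
    obtain K r where K: "finite K" "K \<subseteq> ?X1" and r: "\<And>y. r y \<in> carrier R"
      and r0: "\<And>y. y \<notin> K \<Longrightarrow> r y = \<zero>\<^bsub>R\<^esub>" and uK: "u = (\<Oplus>\<^bsub>B\<^esub>y\<in>K. r y \<odot>\<^bsub>B\<^esub> \<xi> y)"
      using B.degree_one_expansion[OF pos u(1)] by auto
    \<comment> \<open>The support is enlarged by all \<open>x j\<close>, with zero coefficients
      where necessary, so that the relation splits into a full sum over the \<open>a j\<close> and a
      remainder.\<close>
    define L where "L = K \<union> x ` {1..n}"
    have L: "finite L" "L \<subseteq> ?X1" "x i \<in> L" "x ` {1..n} \<subseteq> L"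
      using K x i by (auto simp: L_def)
    have \<xi>L: "\<xi> y \<in> carrier B" if "y \<in> L" for y
      using L that by auto
    have uL: "u = (\<Oplus>\<^bsub>B\<^esub>y\<in>L. r y \<odot>\<^bsub>B\<^esub> \<xi> y)"
      unfolding uK by (rule B.add.finprod_mono_neutral_cong_left) (use L r r0 \<xi>L in \<open>auto simp: L_def\<close>)
    have "\<exists>s. s \<in> a ` {1..n} \<union> b ` {1..m} \<and> diff B (\<xi> y) = scalar B s" if "y \<in> ?X1" for y
      using bij_betw_apply[OF bij that] by blast
    then obtain g where g: "\<And>y. y \<in> ?X1 \<Longrightarrow> g y \<in> a ` {1..n} \<union> b ` {1..m} \<and> diff B (\<xi> y) = scalar B (g y)"
      by metis
    have gI: "g y \<in> I" if "y \<in> ?X1" for y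
      using g[OF that] a b by auto
    have gR: "g y \<in> carrier R" if "y \<in> L" for y
      using gI[of y] L(2) that N.Icarr by blast
    have gx: "g (x j) = a j" if "j \<in> {1..n}" for j
      using g[of "x j"] gI[of "x j"] x that a[OF that] N.Icarr
      by (intro inj_onD[OF B.scalar_inj]) auto
    \<comment> \<open>The differential is injective on the variables of degree 1, so one that is not
      among the \<open>x j\<close> cannot map to any \<open>a j\<close>; it maps to some
      \<open>b j\<close>, whose class lies in C.\<close>
    have gC: "ideal_prod R I I +>\<^bsub>R\<^esub> g y \<in> C" if y: "y \<in> L - x ` {1..n}" for y
    proof -
      have y1: "y \<in> ?X1"
        using y L by auto
      have "g y \<notin> a ` {1..n}"
      proof
        assume "g y \<in> a ` {1..n}"
        then obtain j where j: "j \<in> {1..n}" "g y = a j"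
          by blast
        then have "diff B (\<xi> y) = diff B (\<xi> (x j))"
          using g[OF y1] x by simp
        then have "y = x j"
          using bij y1 x j by (auto simp: bij_betw_def inj_on_def)
        then show False
          using y j by blast
      qed
      then show ?thesis
        using g[OF y1] b by auto
    qed
    have scalar_hom: "scalar B \<in> add_hom R B"
      by (rule add_homI) (auto simp: scalar_def B.smult_l_distr)
    have "scalar B (\<Oplus>\<^bsub>R\<^esub>y\<in>L. r y \<otimes>\<^bsub>R\<^esub> g y) = (\<Oplus>\<^bsub>B\<^esub>y\<in>L. scalar B (r y \<otimes>\<^bsub>R\<^esub> g y))"
      by (rule add_hom_finsum[OF N.is_abelian_group B.is_abelian scalar_hom]) (use r gR in auto)
    also have "\<dots> = (\<Oplus>\<^bsub>B\<^esub>y\<in>L. diff B (r y \<odot>\<^bsub>B\<^esub> \<xi> y))"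
      by (rule B.finsum_cong')
        (use r gR \<xi>L g L(2) in \<open>auto simp: scalar_def B.smult_assoc1 B.diff_smult subset_iff\<close>)
    also have "\<dots> = diff B u"
      unfolding uL by (rule add_hom_finsum[OF B.is_abelian B.is_abelian B.diff_add_hom, symmetric])
        (use r \<xi>L in auto)
    also have "\<dots> = scalar B \<zero>\<^bsub>R\<^esub>"
      using u by (simp add: scalar_def)
    finally have "(\<Oplus>\<^bsub>R\<^esub>y\<in>L. r y \<otimes>\<^bsub>R\<^esub> g y) = \<zero>\<^bsub>R\<^esub>"
      using r gR by (intro inj_onD[OF B.scalar_inj]) (auto intro!: N.finsum_closed)
    moreover have "(\<Oplus>\<^bsub>R\<^esub>y\<in>L. r y \<otimes>\<^bsub>R\<^esub> g y) =
        (\<Oplus>\<^bsub>R\<^esub>y\<in>x ` {1..n}. r y \<otimes>\<^bsub>R\<^esub> g y) \<oplus>\<^bsub>R\<^esub> (\<Oplus>\<^bsub>R\<^esub>y\<in>L - x ` {1..n}. r y \<otimes>\<^bsub>R\<^esub> g y)"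
    proof -
      have "L = x ` {1..n} \<union> (L - x ` {1..n})"
        using L by blast
      moreover have "(\<Oplus>\<^bsub>R\<^esub>y\<in>x ` {1..n} \<union> (L - x ` {1..n}). r y \<otimes>\<^bsub>R\<^esub> g y) =
          (\<Oplus>\<^bsub>R\<^esub>y\<in>x ` {1..n}. r y \<otimes>\<^bsub>R\<^esub> g y) \<oplus>\<^bsub>R\<^esub> (\<Oplus>\<^bsub>R\<^esub>y\<in>L - x ` {1..n}. r y \<otimes>\<^bsub>R\<^esub> g y)"
        by (rule N.finsum_Un_disjoint) (use L r gR in auto)
      ultimately show ?thesis
        by simp
    qed
    moreover have "(\<Oplus>\<^bsub>R\<^esub>y\<in>x ` {1..n}. r y \<otimes>\<^bsub>R\<^esub> g y) = (\<Oplus>\<^bsub>R\<^esub>j\<in>{1..n}. r (x j) \<otimes>\<^bsub>R\<^esub> g (x j))"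
      by (rule N.finsum_reindex) (use L r gR inj in auto)
    moreover have "(\<Oplus>\<^bsub>R\<^esub>j\<in>{1..n}. r (x j) \<otimes>\<^bsub>R\<^esub> g (x j)) = (\<Oplus>\<^bsub>R\<^esub>j\<in>{1..n}. r (x j) \<otimes>\<^bsub>R\<^esub> a j)"
      by (rule N.finsum_cong') (use gx r a N.Icarr in auto)
    ultimately have syz: "(\<Oplus>\<^bsub>R\<^esub>j\<in>{1..n}. r (x j) \<otimes>\<^bsub>R\<^esub> a j) \<oplus>\<^bsub>R\<^esub> (\<Oplus>\<^bsub>R\<^esub>y\<in>L - x ` {1..n}. r y \<otimes>\<^bsub>R\<^esub> g y) = \<zero>\<^bsub>R\<^esub>"
      by simp
    have rI: "r (x i) \<in> I"
      by (rule N.syzygy_coefficient[where r = "\<lambda>j. r (x j)" and s = r, OF direct_sum basis a r _ _ gC r syz i])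
        (use L gI in auto)
    have "\<theta> u = (\<Oplus>\<^bsub>B\<^esub>y\<in>L. \<theta> (r y \<odot>\<^bsub>B\<^esub> \<xi> y))"
      unfolding uL by (rule add_hom_finsum[OF B.is_abelian B.is_abelian t.additive]) (use r \<xi>L in auto)
    \<comment> \<open>The derivation is linear and kills every degree-one variable except
      \<open>x i\<close>, so it reads off one coefficient.\<close>
    also have "\<dots> = (\<Oplus>\<^bsub>B\<^esub>y\<in>L. if x i = y then scalar B (r y) else \<zero>\<^bsub>B\<^esub>)"
      by (rule B.finsum_cong') (use r \<xi>L \<theta> \<theta>0 L(2) in \<open>auto simp: t.linear scalar_def\<close>)
    also have "\<dots> = scalar B (r (x i))"
      by (rule B.finsum_singleton) (use L r in auto)
    finally have \<theta>u: "\<theta> u = scalar B (r (x i))" .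
    have "\<epsilon> (scalar B (r (x i))) = \<epsilon> \<zero>\<^bsub>B\<^esub>"
    proof -
      have "I +>\<^bsub>R\<^esub> r (x i) = I +>\<^bsub>R\<^esub> \<zero>\<^bsub>R\<^esub>"
        using N.quotient_eq_iff_same_a_r_cos[OF I r[of "x i"] N.zero_closed] rI r by (simp add: a_minus_def)
      then show ?thesis
        using \<epsilon>_scalar[OF r[of "x i"]] \<epsilon>_scalar[OF N.zero_closed] by (simp add: scalar_def)
    qed
    then show ?thesis
      unfolding \<theta>u using B.quasi_iso_boundary[OF q B.scalar_homog[OF r] B.diff_scalar[OF r]] by blast
  qed
  show ?thesis
  proof (rule B.chain_derivation_exists)
    show "\<And>y. y \<in> X \<Longrightarrow> 1 \<le> \<delta> y"
      using mm by (simp add: minimal_model_def)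
    show "diff B (\<xi> y) \<in> generate_ring B (scalar B ` carrier R \<union> \<xi> ` {y' \<in> X. \<delta> y' < \<delta> y})" if "y \<in> X" for y
      using mm that by (simp add: minimal_model_def semi_free_extension_def concentrated_def)
    show "\<exists>w\<in>homog B (Suc (Suc k)). diff B w = u" if u: "u \<in> homog B (Suc k)" "diff B u = \<zero>\<^bsub>B\<^esub>" for k u
    proof (rule B.quasi_iso_boundary[OF q u])
      have "\<epsilon> ` homog B (Suc k) \<subseteq> homog ?Q (Suc k)"
        using \<epsilon> unfolding dga_hom_def by blast
      then have "\<epsilon> v = \<zero>\<^bsub>R Quot I\<^esub>" if "v \<in> homog B (Suc k)" for v
        using that by (auto simp: concentrated_def)
      then show "\<epsilon> u = \<epsilon> \<zero>\<^bsub>B\<^esub>"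
        using u by simp
    qed
    show "x i \<in> X" "\<delta> (x i) = 1"
      using x i by auto
  qed (rule bound)
qed

section \<open>The splitting of A[X]\<close>

theorem proposition3p1:
  fixes n m :: nat
    and R :: "('r, 'k) ring_scheme"
    and I :: "'r set"
    and a b :: "nat \<Rightarrow> 'r"
    and F C :: "'r set set"
    and RX :: "('r, 'b) dga" and X :: "'v set" and \<delta> :: "'v \<Rightarrow> nat"
    and \<xi> :: "'v \<Rightarrow> 'b" and \<epsilon> :: "'b \<Rightarrow> 'r set" and x :: "nat \<Rightarrow> 'v"
    and A :: "('r, 'a) dga"
    and AX :: "('r, 't) dga" and jA :: "'a \<Rightarrow> 't" and jX :: "'b \<Rightarrow> 't"
  assumes "noetherian_ring R" and "local_ring R"
    and "ideal I R" and "I \<noteq> carrier R"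
    and "n = f_rank (R Quot I) (conormal R I)"
    and "minimally_generates (genideal R) (Sum_Type.Plus {1..n} {1..m}) (case_sum a b) I"
    and "module_direct_sum (R Quot I) (conormal R I) F C"
    and "module_basis (R Quot I) (conormal R I) F {1..n} (\<lambda>i. ideal_prod R I I +>\<^bsub>R\<^esub> a i)"
    and "minimally_generates (module_span (R Quot I) (conormal R I))
           {1..m} (\<lambda>j. ideal_prod R I I +>\<^bsub>R\<^esub> b j) C"
    and "minimal_model R I RX X \<delta> \<xi> \<epsilon>"
    and "bij_betw (\<lambda>v. diff RX (\<xi> v)) {v \<in> X. \<delta> v = 1}
           (scalar RX ` (a ` {1..n} \<union> b ` {1..m}))"
    and "\<forall>i\<in>{1..n}. x i \<in> X \<and> \<delta> (x i) = 1 \<and> diff RX (\<xi> (x i)) = scalar RX (a i)"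
    and "dg_algebra R A"
    and "genideal (degree_zero_ring A) (scalar A ` I) \<subseteq> diff A ` homog A 1"
    and "is_dg_tensor R A RX AX jA jX"
  shows "\<exists>\<theta> :: 'v \<Rightarrow> 't \<Rightarrow> 't.
    (\<forall>v \<in> x ` {1..n}.
       chain_derivation R AX (-1) (\<theta> v) \<and>
       (\<forall>u\<in>carrier A. \<theta> v (jA u) = \<zero>\<^bsub>AX\<^esub>) \<and>
       \<theta> v (jX (\<xi> v)) = \<one>\<^bsub>AX\<^esub> \<and>
       (\<forall>y \<in> {y \<in> X. \<delta> y = 1} - {v}. \<theta> v (jX (\<xi> y)) = \<zero>\<^bsub>AX\<^esub>)) \<and>
    (let W = {u \<in> carrier AX. \<forall>v \<in> x ` {1..n}. \<theta> v u = \<zero>\<^bsub>AX\<^esub>}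
     in dg_subalgebra R W AX \<and>
        (\<exists>(E :: ('r, 't) dga) \<kappa> z.
           exterior_cycle_extension R (sub_dga AX W) E \<kappa> n z \<and> dga_iso R AX E \<noteq> {}))"
proof -
  note noeth = assms(1) and local = assms(2) and I = assms(3) and gens = assms(6) and ds = assms(7)
    and basis = assms(8) and C = assms(9) and mm = assms(10) and bij = assms(11) and x = assms(12)
    and A = assms(13) and IA = assms(14) and tensor = assms(15)
  have R: "cring R"
    using local by (simp add: local_ring_def)
  interpret R: cring R by fact
  let ?P = "Sum_Type.Plus {1..n} {1..m}"
  have gen_sub: "case_sum a b ` ?P \<subseteq> I"
  proof -
    have "case_sum a b ` ?P \<subseteq> genideal R (case_sum a b ` ?P)"
      by (auto simp: genideal_def)
    then show ?thesis
      using gens by (simp add: minimally_generates_def)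
  qed
  then have ab: "a ` {1..n} \<union> b ` {1..m} \<subseteq> I"
    by (simp add: Plus_def image_Un image_image)
  then have a: "a i \<in> I" if "i \<in> {1..n}" for i
    using that by blast
  have "b ` {1..m} \<subseteq> I"
    using ab by blast
  moreover have "(\<lambda>j. ideal_prod R I I +>\<^bsub>R\<^esub> b j) ` {1..m} \<subseteq> C"
    using C by (auto simp: minimally_generates_def module_span_def)
  ultimately have b: "b j \<in> I \<and> ideal_prod R I I +>\<^bsub>R\<^esub> b j \<in> C" if "j \<in> {1..m}" for j
    using that by blast
  \<comment> \<open>Of two equal generators one could be dropped, against minimality. Hence the
    variables \<open>x i\<close> are distinct as well, which separates the values of the derivations
    on them.\<close>
  have inj_a: "inj_on a {1..n}"
  proof (rule inj_onI, rule ccontr)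
    fix i j assume ij: "i \<in> {1..n}" "j \<in> {1..n}" "a i = a j" "i \<noteq> j"
    have "case_sum a b ` ?P = case_sum a b ` (?P - {Inl i})"
    proof
      show "case_sum a b ` ?P \<subseteq> case_sum a b ` (?P - {Inl i})"
      proof
        fix g assume "g \<in> case_sum a b ` ?P"
        then obtain p where p: "p \<in> ?P" "g = case_sum a b p"
          by blast
        show "g \<in> case_sum a b ` (?P - {Inl i})"
        proof (cases "p = Inl i")
          case True
          then show ?thesis
            using p ij by (intro image_eqI[of _ _ "Inl j"]) auto
        next
          case False
          then show ?thesis
            using p by blast
        qed
      qed
    qed blast
    then have "genideal R (case_sum a b ` (?P - {Inl i})) = I"
      using gens by (simp add: minimally_generates_def)
    moreover have "?P - {Inl i} \<subset> ?P"
      using ij by blast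
    ultimately show False
      using gens by (simp add: minimally_generates_def)
  qed
  obtain ord where "free_dga R RX X \<delta> \<xi> ord"
    using minimal_model_free[OF mm] .
  then interpret RX: free_dga R RX X \<delta> \<xi> ord .
  interpret A: dga R A
    using A by (rule dga.intro)
  have "dg_algebra R AX"
    using tensor by (simp add: is_dg_tensor_def)
  then interpret dga_tensor R A RX AX jA jX
    using tensor by (intro dga_tensor.intro dga_tensor_axioms.intro dga.intro A RX.dg_algebra_axioms)
  have aR: "a i \<in> carrier R" if "i \<in> {1..n}" for i
    using a[OF that] ideal.Icarr[OF I] by blast
  have inj_x: "inj_on x {1..n}"
  proof (rule inj_onI)
    fix i j assume ij: "i \<in> {1..n}" "j \<in> {1..n}" "x i = x j"
    then have "scalar RX (a i) = scalar RX (a j)"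
      using x by metis
    then have "a i = a j"
      using inj_onD[OF RX.scalar_inj _ aR aR] ij by blast
    then show "i = j"
      using inj_onD[OF inj_a] ij by blast
  qed
  have "\<exists>\<theta>. chain_odd_derivation R RX \<theta> \<and> \<theta> (\<xi> (x i)) = \<one>\<^bsub>RX\<^esub> \<and>
      (\<forall>y\<in>X. \<delta> y = 1 \<and> y \<noteq> x i \<longrightarrow> \<theta> (\<xi> y) = \<zero>\<^bsub>RX\<^esub>)" if "i \<in> {1..n}" for i
    by (rule minimal_model_derivation[OF R I ds basis a b mm bij x inj_x that])
  then obtain \<theta> where \<theta>: "\<And>i. i \<in> {1..n} \<Longrightarrow> chain_odd_derivation R RX (\<theta> i)"
    and \<theta>1: "\<And>i. i \<in> {1..n} \<Longrightarrow> \<theta> i (\<xi> (x i)) = \<one>\<^bsub>RX\<^esub>"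
    and \<theta>0: "\<And>i y. \<lbrakk>i \<in> {1..n}; y \<in> X; \<delta> y = 1; y \<noteq> x i\<rbrakk> \<Longrightarrow> \<theta> i (\<xi> y) = \<zero>\<^bsub>RX\<^esub>"
    by metis
  have "\<exists>\<Theta>. chain_odd_derivation R AX \<Theta> \<and> (\<forall>u\<in>carrier A. \<Theta> (jA u) = \<zero>\<^bsub>AX\<^esub>) \<and>
      (\<forall>v\<in>carrier RX. \<Theta> (jX v) = jX (\<theta> i v))" if "i \<in> {1..n}" for i
    by (rule tensor_derivation[OF \<theta>[OF that]])
  then obtain \<Theta> where \<Theta>: "\<And>i. i \<in> {1..n} \<Longrightarrow> chain_odd_derivation R AX (\<Theta> i)"
    and \<Theta>A: "\<And>i u. \<lbrakk>i \<in> {1..n}; u \<in> carrier A\<rbrakk> \<Longrightarrow> \<Theta> i (jA u) = \<zero>\<^bsub>AX\<^esub>"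
    and \<Theta>X: "\<And>i v. \<lbrakk>i \<in> {1..n}; v \<in> carrier RX\<rbrakk> \<Longrightarrow> \<Theta> i (jX v) = jX (\<theta> i v)"
    by metis
  have \<Theta>1: "\<Theta> i (jX (\<xi> (x i))) = \<one>\<^bsub>AX\<^esub>" if "i \<in> {1..n}" for i
    using \<Theta>X[OF that, of "\<xi> (x i)"] \<theta>1[OF that] x that by simp
  have \<Theta>0: "\<Theta> i (jX (\<xi> y)) = \<zero>\<^bsub>AX\<^esub>" if "i \<in> {1..n}" "y \<in> X" "\<delta> y = 1" "y \<noteq> x i" for i y
    using \<Theta>X[OF that(1), of "\<xi> y"] \<theta>0[OF that] that by simp
  have "\<exists>\<alpha>\<in>homog A 1. diff A \<alpha> = scalar A (a i)" if "i \<in> {1..n}" for i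
  proof -
    have "scalar A (a i) \<in> genideal (degree_zero_ring A) (scalar A ` I)"
      using a[OF that] by (auto simp: genideal_def)
    then show ?thesis
      using IA by (metis imageE subsetD)
  qed
  then obtain \<alpha> where \<alpha>: "\<And>i. i \<in> {1..n} \<Longrightarrow> \<alpha> i \<in> homog A 1"
    and d\<alpha>: "\<And>i. i \<in> {1..n} \<Longrightarrow> diff A (\<alpha> i) = scalar A (a i)"
    by metis
  \<comment> \<open>Both terms have boundary \<open>a i\<close>, so the difference is a cycle; and
    since the derivations vanish on A, they take the same values on \<open>z i\<close> as on the
    variable \<open>x i\<close>.\<close>
  define z where "z i = jX (\<xi> (x i)) \<ominus>\<^bsub>AX\<^esub> jA (\<alpha> i)" for i
  have var_homog: "jX (\<xi> y) \<in> homog AX (Suc 0)" if "y \<in> X" "\<delta> y = 1" for y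
    using jB.homog_mem[OF RX.var_homog[OF that(1)]] that by simp
  have \<alpha>A: "\<alpha> i \<in> carrier A" and xX: "x i \<in> X" "\<delta> (x i) = 1" if "i \<in> {1..n}" for i
    using A.homog_carrier[OF \<alpha>[OF that]] x that by auto
  have z_homog: "z i \<in> homog AX (Suc 0)" if "i \<in> {1..n}" for i
    unfolding z_def using var_homog[OF xX[OF that]] jA.homog_mem[OF \<alpha>[OF that]] by (simp add: T.homog_diff)
  have dz: "diff AX (z i) = \<zero>\<^bsub>AX\<^esub>" if i: "i \<in> {1..n}" for i
  proof -
    have "diff AX (jX (\<xi> (x i))) = scalar AX (a i)"
      using jB.diff[of "\<xi> (x i)"] xX[OF i] x i aR[OF i] by (simp add: jB.scalar)
    moreover have "diff AX (jA (\<alpha> i)) = scalar AX (a i)"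
      using jA.diff[OF \<alpha>A[OF i]] d\<alpha>[OF i] aR[OF i] by (simp add: jA.scalar)
    ultimately show ?thesis
      using xX[OF i] \<alpha>A[OF i] aR[OF i] by (simp add: z_def T.diff_add T.diff_neg a_minus_def T.r_neg)
  qed
  have \<Theta>z: "\<Theta> i (z j) = (if i = j then \<one>\<^bsub>AX\<^esub> else \<zero>\<^bsub>AX\<^esub>)" if ij: "i \<in> {1..n}" "j \<in> {1..n}" for i j
  proof -
    interpret t: chain_odd_derivation R AX "\<Theta> i"
      by (rule \<Theta>) fact
    have "\<Theta> i (z j) = \<Theta> i (jX (\<xi> (x j)))"
      using \<Theta>A[OF ij(1) \<alpha>A[OF ij(2)]] xX[OF ij(2)] \<alpha>A[OF ij(2)] by (simp add: z_def t.plus t.neg a_minus_def)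
    moreover have "x j \<noteq> x i" if "i \<noteq> j"
      using inj_onD[OF inj_x _ ij(2,1)] that by blast
    ultimately show ?thesis
      using \<Theta>1[OF ij(1)] \<Theta>0[OF ij(1) xX[OF ij(2)]] by auto
  qed
  let ?fam = "\<lambda>\<phi> i. chain_odd_derivation R AX (\<phi> i) \<and> (\<forall>u\<in>homog AX (Suc 0). \<phi> i u = \<Theta> i u) \<and>
    (\<forall>u\<in>jA ` carrier A. \<phi> i u = \<zero>\<^bsub>AX\<^esub>) \<and> (\<forall>u\<in>carrier AX. \<phi> i (\<phi> i u) = \<zero>\<^bsub>AX\<^esub>) \<and>
    (\<forall>j\<in>{1..n}. j \<noteq> i \<longrightarrow> (\<forall>u\<in>carrier AX. \<phi> i (\<phi> j u) \<oplus>\<^bsub>AX\<^esub> \<phi> j (\<phi> i u) = \<zero>\<^bsub>AX\<^esub>))"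
  have "\<exists>\<phi>. \<forall>i\<in>{1..n}. ?fam \<phi> i"
    \<comment> \<open>Taking K to be the image of A keeps the corrected derivations zero on A, and
      agreement in degree 1 keeps their values on X_1.\<close>
    by (rule T.anticommuting_family[OF \<Theta> z_homog dz \<Theta>z]) (use \<Theta>A in auto)
  then obtain \<phi> where fam: "\<forall>i\<in>{1..n}. ?fam \<phi> i"
    by (elim exE)
  have \<phi>: "chain_odd_derivation R AX (\<phi> i)"
    and \<phi>\<Theta>: "\<And>u. u \<in> homog AX (Suc 0) \<Longrightarrow> \<phi> i u = \<Theta> i u"
    and \<phi>A: "\<And>u. u \<in> carrier A \<Longrightarrow> \<phi> i (jA u) = \<zero>\<^bsub>AX\<^esub>"
    and \<phi>2: "\<And>u. u \<in> carrier AX \<Longrightarrow> \<phi> i (\<phi> i u) = \<zero>\<^bsub>AX\<^esub>"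
    and \<phi>\<phi>: "\<And>j u. \<lbrakk>j \<in> {1..n}; j \<noteq> i; u \<in> carrier AX\<rbrakk> \<Longrightarrow>
      \<phi> i (\<phi> j u) \<oplus>\<^bsub>AX\<^esub> \<phi> j (\<phi> i u) = \<zero>\<^bsub>AX\<^esub>" if i: "i \<in> {1..n}" for i
    using bspec[OF fam i] by blast+
  interpret E: exterior_family R AX n \<phi> z
  proof (intro exterior_family.intro exterior_family_axioms.intro T.dga_axioms)
    show "\<phi> i (z j) = (if i = j then \<one>\<^bsub>AX\<^esub> else \<zero>\<^bsub>AX\<^esub>)" if "i \<in> {1..n}" "j \<in> {1..n}" for i j
      unfolding \<phi>\<Theta>[OF that(1) z_homog[OF that(2)]] by (rule \<Theta>z[OF that])
    show "\<phi> i (\<phi> j u) \<oplus>\<^bsub>AX\<^esub> \<phi> j (\<phi> i u) = \<zero>\<^bsub>AX\<^esub>"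
      if "i \<in> {1..n}" "j \<in> {1..n}" "i \<noteq> j" "u \<in> carrier AX" for i j u
      by (rule \<phi>\<phi>[OF that(1,2) that(3)[symmetric] that(4)])
  qed (fact \<phi> z_homog dz \<phi>2)+
  \<comment> \<open>The derivations are indexed by numbers in the construction but by variables in
    the statement; injectivity of x allows the translation.\<close>
  define \<psi> where "\<psi> v = \<phi> (inv_into {1..n} x v)" for v
  have \<psi>: "\<psi> (x i) = \<phi> i" if "i \<in> {1..n}" for i
    using inv_into_f_f[OF inj_x that] by (simp add: \<psi>_def)
  have kernel: "{u \<in> carrier AX. \<forall>v\<in>x ` {1..n}. \<psi> v u = \<zero>\<^bsub>AX\<^esub>} = E.kernel 1"
    unfolding E.kernel_1 using \<psi> by auto
  have id: "(\<lambda>u. u) \<in> dga_iso R AX AX"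
    by (auto simp: dga_iso_def dga_hom_def ring_hom_def bij_betw_def)
  show ?thesis
  proof (intro exI[of _ \<psi>] conjI ballI)
    fix v assume "v \<in> x ` {1..n}"
    then obtain i where i: "i \<in> {1..n}" "v = x i"
      by blast
    show "chain_derivation R AX (-1) (\<psi> v)"
      using chain_odd_derivation.chain_derivation[OF \<phi>] \<psi> i by simp
    show "\<psi> v (jA u) = \<zero>\<^bsub>AX\<^esub>" if "u \<in> carrier A" for u
      using \<phi>A[OF i(1) that] \<psi> i by simp
    show "\<psi> v (jX (\<xi> v)) = \<one>\<^bsub>AX\<^esub>"
      using \<phi>\<Theta>[OF i(1) var_homog[OF xX[OF i(1)]]] \<Theta>1[OF i(1)] \<psi>[OF i(1)] i by simp
    show "\<psi> v (jX (\<xi> y)) = \<zero>\<^bsub>AX\<^esub>" if "y \<in> {y \<in> X. \<delta> y = 1} - {v}" for y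
      using \<phi>\<Theta>[OF i(1) var_homog[of y]] \<Theta>0[OF i(1), of y] \<psi>[OF i(1)] i that by simp
  next
    show "let W = {u \<in> carrier AX. \<forall>v\<in>x ` {1..n}. \<psi> v u = \<zero>\<^bsub>AX\<^esub>}
      in dg_subalgebra R W AX \<and> (\<exists>(E :: ('r, 't) dga) \<kappa> z.
        exterior_cycle_extension R (sub_dga AX W) E \<kappa> n z \<and> dga_iso R AX E \<noteq> {})"
      unfolding Let_def kernel using E.W.dg_subalgebra E.exterior_cycle_extension id by blast
  qed
qed

end
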